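(* For every even integer $\ell\ge 2$ there is a nonempty class of long-branched maps $f(z)=z^\ell+c_1$, $c_1\in\mathbb{R}$, with connected Julia set $\mathcal{J}$, with $0\in\mathcal{J}$ and with $0$ recurrent, such that each map $f$ of the class has no acip other than those supported on $\omega(0)$; that is, for every $\delta$-conformal measure $\mu_\delta$ of $f$ (any $\delta>0$), every $f$-invariant Borel probability measure $\mu\ll\mu_\delta$ satisfies $\mu(\omega(0))=1$.
   Context: $\omega(0)$ is the $\omega$-limit set of the critical point $0$; $0$ is recurrent if $0\in\omega(0)$. An acip with respect to $m$ is an $f$-invariant probability measure absolutely continuous with respect to $m$. $f$ is long-branched if there is $\kappa>0$ such that for all $n\ge1$ and all maximal intervals $J\subset\mathbb{R}$ on which $f^n$ is monotone, $|f^n(J)|>\kappa$ (where $|\cdot|$ denotes length, possibly infinite). A $\delta$-conformal measure of $f$ is a Borel probability measure $\mu_\delta$ supported on the Julia set $\mathcal{J}$ of $f$ such that $\mu_\delta(f(A))=\int_A|Df(z)|^\delta\,d\mu_\delta(z)$ for every Borel set $A$ on which $f$ is one-to-one. *)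

theory Defs
  imports "HOL-Probability.Probability"
begin

definition unicritical :: "nat \<Rightarrow> 'a::comm_ring_1 \<Rightarrow> 'a \<Rightarrow> 'a" where
  "unicritical l c z = z ^ l + c"

definition omega_limit :: "('a::topological_space \<Rightarrow> 'a) \<Rightarrow> 'a \<Rightarrow> 'a set" where
  "omega_limit f x = {y. \<exists>r::nat \<Rightarrow> nat. strict_mono r \<and> (\<lambda>k. (f ^^ r k) x) \<longlonglongrightarrow> y}"

definition recurrent :: "('a::topological_space \<Rightarrow> 'a) \<Rightarrow> 'a \<Rightarrow> bool" where
  "recurrent f x \<longleftrightarrow> x \<in> omega_limit f x"

(* Normality in the sense of the Riemann sphere, for families of holomorphic functions on a
   connected open set: by Hurwitz, a locally uniform limit in the spherical metric is then either
   finite everywhere or identically infinity. *)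
definition normal_family_on :: "(complex \<Rightarrow> complex) set \<Rightarrow> complex set \<Rightarrow> bool" where
  "normal_family_on F U \<longleftrightarrow>
     (\<forall>s::nat \<Rightarrow> complex \<Rightarrow> complex. range s \<subseteq> F \<longrightarrow>
        (\<exists>r::nat \<Rightarrow> nat. strict_mono r \<and>
           ((\<exists>g. \<forall>K. compact K \<and> K \<subseteq> U \<longrightarrow> uniform_limit K (\<lambda>n. s (r n)) g sequentially) \<or>
            (\<forall>K. compact K \<and> K \<subseteq> U \<longrightarrow>
               (\<forall>B::real. \<forall>\<^sub>F n in sequentially. \<forall>z\<in>K. B < norm (s (r n) z))))))"

(* The finite parts of the Fatou and Julia sets. For a polynomial of degree at least 2 the point
   at infinity is a superattracting fixed point, so the Julia set lies in the plane. *)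
definition fatou_set :: "(complex \<Rightarrow> complex) \<Rightarrow> complex set" where
  "fatou_set f = {z. \<exists>U. open U \<and> connected U \<and> z \<in> U \<and>
     normal_family_on (range (\<lambda>n. f ^^ n)) U}"

definition julia_set :: "(complex \<Rightarrow> complex) \<Rightarrow> complex set" where
  "julia_set f = - fatou_set f"

definition monotone_interval :: "(real \<Rightarrow> real) \<Rightarrow> real set \<Rightarrow> bool" where
  "monotone_interval g J \<longleftrightarrow> is_interval J \<and> (mono_on J g \<or> antimono_on J g)"

definition maximal_monotone_interval :: "(real \<Rightarrow> real) \<Rightarrow> real set \<Rightarrow> bool" where
  "maximal_monotone_interval g J \<longleftrightarrow>
     monotone_interval g J \<and> (\<forall>J'. monotone_interval g J' \<and> J \<subseteq> J' \<longrightarrow> J' = J)"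

definition long_branched :: "(real \<Rightarrow> real) \<Rightarrow> bool" where
  "long_branched f \<longleftrightarrow>
     (\<exists>\<kappa>::real. \<kappa> > 0 \<and>
        (\<forall>n\<ge>1. \<forall>J. maximal_monotone_interval (f ^^ n) J \<longrightarrow>
           emeasure lborel ((f ^^ n) ` J) > ennreal \<kappa>))"

(* The image of a Borel set under an injective polynomial is Borel, so the left-hand side of the
   conformality equation is the genuine measure of the image. *)
definition conformal_measure :: "(complex \<Rightarrow> complex) \<Rightarrow> real \<Rightarrow> complex measure \<Rightarrow> bool" where
  "conformal_measure f \<delta> \<mu> \<longleftrightarrow>
     prob_space \<mu> \<and> sets \<mu> = sets borel \<and> emeasure \<mu> (julia_set f) = 1 \<and>
     (\<forall>A\<in>sets borel. inj_on f A \<longrightarrow>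
        emeasure \<mu> (f ` A) = (\<integral>\<^sup>+z\<in>A. ennreal (norm (deriv f z) powr \<delta>) \<partial>\<mu>))"

definition invariant_measure :: "('a::topological_space \<Rightarrow> 'a) \<Rightarrow> 'a measure \<Rightarrow> bool" where
  "invariant_measure f \<mu> \<longleftrightarrow> sets \<mu> = sets borel \<and> distr \<mu> borel f = \<mu>"

(* In the library's argument order, absolutely_continuous m mu says mu << m. *)
definition acip :: "('a::topological_space \<Rightarrow> 'a) \<Rightarrow> 'a measure \<Rightarrow> 'a measure \<Rightarrow> bool" where
  "acip f m \<mu> \<longleftrightarrow> prob_space \<mu> \<and> invariant_measure f \<mu> \<and> absolutely_continuous m \<mu>"

end

theory Submission
  imports Defs "HOL-Complex_Analysis.Complex_Analysis"
begin

text \<open>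
  The maps are normalized as \<open>g y = y\<^sup>l + a - a\<^sup>l\<close>, with orientation reversing fixed point \<open>a < 0\<close>,
  and the class consists of a single map. Its parameter \<open>a\<close> is a limit of nested parameter
  intervals. At each stage an iterate \<open>F = g\<^sup>m\<close> maps an interval \<open>[X, 0]\<close> increasingly, with
  \<open>F X = a\<close>, and \<open>F 0\<close> runs from \<open>0\<close> to \<open>a\<close> over the parameter interval. At the last parameter for which
  the orbit of \<open>0\<close> under \<open>F\<close> stays in \<open>[X, 0]\<close> there is a parabolic fixed point of \<open>F\<close>; just behind it
  the fixed point has become a gate through which the orbits of \<open>0\<close> and of a small interval next to
  \<open>0\<close> pass so slowly that the time of passage exceeds any prescribed power of the inverse length of
  the interval. Among these parameters one finds the next stage, with \<open>X\<close> arbitrarily close to \<open>0\<close>.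

  In the limit the critical point is recurrent. Moreover, whenever \<open>g\<^sup>p 0\<close> lies in \<open>(a, -a)\<close>, it
  is negative and \<open>g\<^sup>p\<close> increases to the left of \<open>0\<close>; hence a branch between two critical points
  covers \<open>[a, 0]\<close> or \<open>[0, -a]\<close> when its second end point becomes critical, and it is folded
  at most two iterates later, when it is still long. The interval next to \<open>0\<close> is
  expanded to \<open>[a, -a]\<close> with bounded distortion, hence \<open>0\<close> is in the Julia set and the
  complex neighbourhood \<open>W\<close> of the interval which follows it has \<open>\<delta>\<close>-conformal measure at least of the
  order of the \<open>\<delta>\<close>-th power of the length. If an acip charged a disc off \<open>\<omega>(0)\<close>, then the
  conformal measure of the preimages of the disc under all iterates would be bounded below, and that
  of their parts which are sent to \<open>W\<close> would be at least a constant times the measure of \<open>W\<close>. But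
  these parts stay near \<open>\<omega>(0)\<close> for a time long compared to the inverse of the measure of \<open>W\<close>, so
  those belonging to different times are disjoint, and their total measure is larger than \<open>1\<close>.
\<close>

section \<open>Koebe distortion\<close>

text \<open>One map has to serve all \<delta> and all conformal measures at once. Of such a measure
  only the total mass, the positive mass of discs around Julia points and the scaling law are used,
  so everything comes down to a time against a power of a length. The obstacle is the order of
  choices: closing the gate further prolongs the passage, but must not shrink the entering interval.
  Bounded distortion removes it, since the length is bounded below by data of the window around the
  parabolic point that are fixed beforehand; the time is chosen afterwards. No asymptotics of the
  passage is needed: that nearby parameters still take many iterates is continuity. A distortion
  constant that is not sharp suffices, so it is taken from Schottky's theorem. The fixed point
  \<open>a\<close> is the parameter, so that the point on which critical orbits are made to land is
  explicit for every map; evenness supplies its second preimage \<open>-a\<close> and allows every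
  branch to be studied to the left of \<open>0\<close>.\<close>

lemma univalent_unit_disc_omits:
  assumes hol: "f holomorphic_on ball 0 1" and inj: "inj_on f (ball 0 1)"
    and f0: "f 0 = 0" and f1: "deriv f 0 = 1"
  obtains v where "norm v < 2" "v \<notin> f ` ball 0 1"
proof -
  have "\<not> ball 0 2 \<subseteq> f ` ball 0 1"
  proof
    assume sub: "ball 0 2 \<subseteq> f ` ball 0 1"
    obtain g where g: "g holomorphic_on (f ` ball 0 1)"
      "\<And>z. z \<in> ball 0 1 \<Longrightarrow> deriv f z * deriv g (f z) = 1"
      "\<And>z. z \<in> ball 0 1 \<Longrightarrow> g (f z) = z"
      using holomorphic_has_inverse[OF hol open_ball inj] by blast
    have dg: "deriv g 0 = 1"
      using g(2)[of 0] f0 f1 by simp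
    have gb: "norm (g w) \<le> 1" if w: "w \<in> ball 0 2" for w
    proof -
      obtain z where "z \<in> ball 0 1" "w = f z" using sub w by blast
      then show ?thesis using g(3)[of z] by simp
    qed
    have h2: "g holomorphic_on ball 0 2" using g(1) sub holomorphic_on_subset by blast
    \<comment> \<open>The inverse is bounded by 1 on the circle of radius 3/2, so its derivative at
      0 is at most 2/3, whereas it equals 1.\<close>
    have "norm ((deriv ^^ 1) g 0) \<le> fact 1 * 1 / (3/2) ^ 1"
    proof (rule Cauchy_inequality)
      show "g holomorphic_on ball 0 (3/2)" using h2 by (rule holomorphic_on_subset) auto
      show "continuous_on (cball 0 (3/2)) g"
        by (rule holomorphic_on_imp_continuous_on, rule holomorphic_on_subset[OF h2]) auto
      show "norm (g x) \<le> 1" if "norm (0 - x) = 3/2" for x using gb[of x] that by simp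
    qed simp
    then show False using dg by simp
  qed
  then obtain v where "v \<in> ball 0 2" "v \<notin> f ` ball 0 1" by blast
  then show ?thesis using that[of v] by simp
qed

text \<open>The family of univalent functions on the unit disc is controlled by Schottky's theorem: if
  \<open>v\<close> is an omitted value, then a square root \<open>g\<close> of \<open>1 - f/v\<close> omits both \<open>0\<close> and \<open>-1\<close>, since
  \<open>g z = -1\<close> would force \<open>f z = 0\<close>, hence \<open>z = 0\<close>, where \<open>g\<close> equals \<open>1\<close>.\<close>

definition koebe :: real where
  "koebe = 64 * (1 + (exp (pi * exp (pi * (4 + 12)))) ^ 2)"

lemma koebe_pos: "koebe > 0"
  unfolding koebe_def by (simp add: add_pos_nonneg)

lemma univalent_unit_disc_second_deriv:
  assumes hol: "f holomorphic_on ball 0 1" and inj: "inj_on f (ball 0 1)"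
    and f0: "f 0 = 0" and f1: "deriv f 0 = 1"
  shows "norm ((deriv ^^ 2) f 0) \<le> koebe"
proof -
  obtain v where v: "norm v < 2" "v \<notin> f ` ball 0 1"
    using univalent_unit_disc_omits[OF assms] by blast
  have v0: "v \<noteq> 0" using v(2) f0 by (metis centre_in_ball image_eqI zero_less_one)
  define h where "h = (\<lambda>z. 1 - f z / v)"
  have holh: "h holomorphic_on ball 0 1" unfolding h_def using hol v0 by (intro holomorphic_intros) auto
  have hnz: "h z \<noteq> 0" if "z \<in> ball 0 1" for z
  proof
    assume "h z = 0"
    then have "f z = v" using v0 by (simp add: h_def field_simps)
    then show False using v(2) that by blast
  qed
  obtain lg where lg: "lg holomorphic_on ball 0 1" "\<And>z. z \<in> ball 0 1 \<Longrightarrow> h z = exp (lg z)"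
    using contractible_imp_holomorphic_log[OF holh _ hnz] convex_imp_contractible[OF convex_ball] by metis
  define g where "g = (\<lambda>z. exp ((lg z - lg 0) / 2))"
  have holg: "g holomorphic_on ball 0 1" unfolding g_def using lg(1) by (intro holomorphic_intros) auto
  have h0: "h 0 = 1" by (simp add: h_def f0)
  have gsq: "g z ^ 2 = h z" if "z \<in> ball 0 1" for z
  proof -
    have "g z ^ 2 = exp (lg z - lg 0)" unfolding g_def by (simp add: power2_eq_square flip: exp_add)
    also have "\<dots> = h z / h 0" using lg(2)[of z] lg(2)[of 0] that by (simp add: exp_diff)
    finally show ?thesis by (simp add: h0)
  qed
  have g0: "g 0 = 1" by (simp add: g_def)
  have gm1: "g z \<noteq> -1" if z: "z \<in> ball 0 1" for z
  proof
    assume "g z = -1"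
    then have "h z = 1" using gsq[OF z] by simp
    then have "f z = f 0" using v0 by (simp add: h_def f0)
    then have "z = 0" using inj z by (auto dest: inj_onD)
    then show False using g0 \<open>g z = -1\<close> by simp
  qed
  let ?S = "exp (pi * exp (pi * (4 + 12)))"
  have gb: "norm (g z) \<le> ?S" if z: "norm z \<le> 1/4" for z
  proof -
    \<comment> \<open>The sign turns the omitted value -1 into 1, and halving the argument brings
      the closed unit disc into the open one. With bound 1 at the centre and \<open>t = 1/2\<close>
      the exponent in Schottky's theorem is 4 + 12.\<close>
    define k where "k = (\<lambda>z. - g (z/2))"
    have "norm (k (2*z)) \<le> exp(pi * exp(pi * (2 + 2 * 1 + 12 * (1/2) / (1 - 1/2))))"
    proof (rule Schottky[where f=k and z="2*z" and r=1 and t="1/2"])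
      have "(g \<circ> (\<lambda>z. z/2)) holomorphic_on cball 0 1"
        by (rule holomorphic_on_compose_gen[of _ _ _ "ball 0 1"])
          (auto intro!: holomorphic_intros holg simp: norm_divide)
      then show "k holomorphic_on cball 0 1"
        unfolding k_def by (intro holomorphic_intros) (simp add: o_def)
      show "norm (k 0) \<le> 1" by (simp add: k_def g0)
      show "\<not> (k z = 0 \<or> k z = 1)" if "z \<in> cball 0 1" for z
      proof -
        have "z/2 \<in> ball 0 1" using that by (simp add: norm_divide)
        from gm1[OF this] show ?thesis by (auto simp: k_def g_def minus_equation_iff)
      qed
      show "norm (2*z) \<le> 1/2" using z by (simp add: norm_mult)
    qed auto
    then have "norm (k (2*z)) \<le> ?S" by simp
    then show ?thesis by (simp add: k_def)
  qed
  have fb: "norm (f z) \<le> 2 * (1 + ?S^2)" if z: "norm z \<le> 1/4" for z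
  proof -
    have zb: "z \<in> ball 0 1" using z by simp
    have "f z = v * (1 - g z ^ 2)" using gsq[OF zb] v0 by (simp add: h_def field_simps)
    then have "norm (f z) = norm v * norm (1 - g z ^ 2)" by (simp add: norm_mult)
    also have "\<dots> \<le> 2 * (1 + ?S^2)"
    proof (rule mult_mono)
      have "norm (1 - g z ^ 2) \<le> 1 + norm (g z) ^ 2"
        using norm_triangle_ineq4[of 1 "g z ^ 2"] by (simp add: norm_power)
      also have "\<dots> \<le> 1 + ?S^2" using gb[OF z] by (intro add_left_mono power_mono) auto
      finally show "norm (1 - g z ^ 2) \<le> 1 + ?S^2" .
    qed (use v in auto)
    finally show ?thesis .
  qed
  have "norm ((deriv ^^ 2) f 0) \<le> fact 2 * (2 * (1 + ?S^2)) / (1/4) ^ 2"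
  proof (rule Cauchy_inequality)
    show "f holomorphic_on ball 0 (1/4)" using hol by (rule holomorphic_on_subset) auto
    show "continuous_on (cball 0 (1/4)) f"
      by (rule holomorphic_on_imp_continuous_on, rule holomorphic_on_subset[OF hol]) auto
  qed (use fb in auto)
  \<comment> \<open>The 64 in \<open>koebe\<close> is the product of \<open>fact 2\<close>, the
    bound 2 for \<open>norm v\<close>, and 16 from the radius 1/4.\<close>
  also have "\<dots> = koebe" by (simp add: koebe_def power2_eq_square)
  finally show ?thesis .
qed

text \<open>Affine changes in source and target reduce this to the normalized case; the ratio of
  second to first derivative scales like the inverse of the radius.\<close>

lemma univalent_second_deriv_bound:
  assumes hol: "f holomorphic_on ball w s" and inj: "inj_on f (ball w s)" and s: "s > 0"
  shows "norm (deriv (deriv f) w) \<le> koebe / s * norm (deriv f w)"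
proof -
  define d where "d = deriv f w"
  have d0: "d \<noteq> 0" unfolding d_def
    using holomorphic_injective_imp_regular[OF hol open_ball inj] s by simp
  define A where "A = (\<lambda>z::complex. w + of_real s * z)"
  have Ain: "A z \<in> ball w s \<longleftrightarrow> z \<in> ball 0 1" for z
    using s by (simp add: A_def dist_norm norm_mult)
  define g where "g = (\<lambda>z. (f (A z) - f w) / (of_real s * d))"
  have dA: "(A has_field_derivative of_real s) (at z)" for z
    unfolding A_def by (auto intro!: derivative_eq_intros)
  have hold: "deriv f holomorphic_on ball w s" using hol by (simp add: holomorphic_deriv)
  have df: "(f has_field_derivative deriv f z) (at z)" if "z \<in> ball w s" for z
    using hol that by (simp add: holomorphic_derivI)
  have ddf: "(deriv f has_field_derivative deriv (deriv f) z) (at z)" if "z \<in> ball w s" for z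
    using hold that by (simp add: holomorphic_derivI)
  have dg: "(g has_field_derivative deriv f (A z) / d) (at z)" if "z \<in> ball 0 1" for z
    unfolding g_def using s d0 Ain[of z] that
    by (auto intro!: derivative_eq_intros DERIV_chain2[OF df dA])
  have holg: "g holomorphic_on ball 0 1"
    unfolding holomorphic_on_open[OF open_ball] using dg by blast
  have g1: "deriv g z = deriv f (A z) / d" if "z \<in> ball 0 1" for z using dg[OF that] by (rule DERIV_imp_deriv)
  have "deriv (deriv g) 0 = deriv (\<lambda>z. deriv f (A z) / d) 0"
    by (rule deriv_cong_ev) (use g1 in \<open>auto simp: eventually_nhds intro!: exI[of _ "ball 0 1"]\<close>)
  also have "\<dots> = deriv (deriv f) w * of_real s / d"
  proof (rule DERIV_imp_deriv)
    have "A 0 = w" by (simp add: A_def)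
    then have "(deriv f has_field_derivative deriv (deriv f) w) (at (A 0))" using ddf[of w] s by simp
    from DERIV_chain2[OF this dA]
    show "((\<lambda>z. deriv f (A z) / d) has_field_derivative deriv (deriv f) w * of_real s / d) (at 0)"
      by (rule DERIV_cdivide)
  qed
  finally have g2: "deriv (deriv g) 0 = deriv (deriv f) w * of_real s / d" .
  have injg: "inj_on g (ball 0 1)"
  proof (rule inj_onI)
    fix x y assume xy: "x \<in> ball 0 1" "y \<in> ball 0 1" "g x = g y"
    then have "f (A x) = f (A y)" using s d0 by (simp add: g_def)
    then have "A x = A y" using inj Ain xy by (auto dest: inj_onD)
    then show "x = y" using s by (simp add: A_def)
  qed
  have "norm ((deriv ^^ 2) g 0) \<le> koebe"
    by (rule univalent_unit_disc_second_deriv[OF holg injg])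
      (use g1[of 0] d0 in \<open>auto simp: g_def A_def d_def\<close>)
  then have "norm (deriv (deriv f) w) * s / norm d \<le> koebe"
    using s by (simp add: numeral_2_eq_2 g2 norm_mult norm_divide)
  then show ?thesis using s d0 by (simp add: d_def field_simps)
qed

text \<open>The ratio of second to first derivative is the derivative of a logarithm of
  \<open>deriv f\<close>, so a bound \<open>M\<close> on it makes that logarithm Lipschitz on the
  convex set \<open>T\<close>. Only its real part is needed.\<close>

lemma log_deriv_distortion:
  assumes hol: "f holomorphic_on U" and U: "open U" "convex U"
    and nz: "\<And>z. z \<in> U \<Longrightarrow> deriv f z \<noteq> 0"
    and bd: "\<And>z. z \<in> T \<Longrightarrow> norm (deriv (deriv f) z) \<le> M * norm (deriv f z)"
    and T: "convex T" "T \<subseteq> U" and x: "x \<in> T" and y: "y \<in> T"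
  shows "norm (deriv f x) \<le> exp (M * norm (x - y)) * norm (deriv f y)"
proof -
  have hold: "deriv f holomorphic_on U" using hol U by (simp add: holomorphic_deriv)
  obtain g where g: "g holomorphic_on U" "\<And>z. z \<in> U \<Longrightarrow> deriv f z = exp (g z)"
    using contractible_imp_holomorphic_log[OF hold convex_imp_contractible[OF U(2)] nz] by metis
  have dg: "(g has_field_derivative deriv g z) (at z)" if "z \<in> U" for z
    using g(1) that U(1) by (simp add: holomorphic_derivI)
  have M: "norm (deriv g z) \<le> M" if "z \<in> T" for z
  proof -
    have zU: "z \<in> U" using that T by blast
    have "deriv (deriv f) z = deriv (\<lambda>z. exp (g z)) z"
      by (rule deriv_cong_ev) (use g(2) U zU in \<open>auto simp: eventually_nhds intro!: exI[of _ U]\<close>)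
    also have "\<dots> = exp (g z) * deriv g z"
      by (rule DERIV_imp_deriv) (auto intro!: derivative_eq_intros dg zU)
    finally have "norm (exp (g z)) * norm (deriv g z) \<le> M * norm (exp (g z))"
      using bd[OF that] g(2)[OF zU] by (simp add: norm_mult)
    then show ?thesis by simp
  qed
  have "norm (g x - g y) \<le> M * norm (x - y)"
    by (rule field_differentiable_bound[OF T(1) _ M x y])
      (use dg T in \<open>blast intro: has_field_derivative_at_within\<close>)
  then have "Re (g x) - Re (g y) \<le> M * norm (x - y)"
    using abs_Re_le_cmod[of "g x - g y"] by simp
  then have "exp (Re (g x)) \<le> exp (M * norm (x - y)) * exp (Re (g y))"
    by (simp flip: exp_add)
  moreover have "deriv f x = exp (g x)" "deriv f y = exp (g y)" using g(2) x y T(2) by blast+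
  ultimately show ?thesis by simp
qed

text \<open>Only the margin \<open>s\<close> between \<open>T\<close> and the boundary of
  \<open>U\<close> enters. In this form the estimate serves vertical strips and discs alike.\<close>

lemma univalent_distortion:
  assumes hol: "f holomorphic_on U" and U: "open U" "convex U" and inj: "inj_on f U"
    and T: "convex T" and s: "s > 0" and sub: "\<And>z. z \<in> T \<Longrightarrow> ball z s \<subseteq> U"
    and x: "x \<in> T" and y: "y \<in> T"
  shows "norm (deriv f x) \<le> exp (koebe / s * norm (x - y)) * norm (deriv f y)"
proof (rule log_deriv_distortion[OF hol U _ _ T _ x y])
  show "deriv f z \<noteq> 0" if "z \<in> U" for z
    using holomorphic_injective_imp_regular[OF hol U(1) inj that] .
  show "T \<subseteq> U" using sub s by (meson centre_in_ball subset_iff)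
  show "norm (deriv (deriv f) z) \<le> koebe / s * norm (deriv f z)" if "z \<in> T" for z
    by (rule univalent_second_deriv_bound[OF _ _ s])
      (use hol inj sub[OF that] in \<open>auto intro: holomorphic_on_subset inj_on_subset\<close>)
qed

section \<open>The filled Julia set\<close>

lemma unicritical_iterate_Suc: "(unicritical l c ^^ Suc n) z = (unicritical l c ^^ n) (unicritical l c z)"
  by (simp add: funpow_Suc_right del: funpow.simps)

lemma unicritical_iterate_holomorphic [holomorphic_intros]: "(unicritical l (c::complex) ^^ n) holomorphic_on S"
proof (induction n)
  case (Suc n)
  then show ?case by (auto simp: unicritical_def intro!: holomorphic_intros)
qed simp

lemma unicritical_iterate_continuous [continuous_intros]: "continuous_on S (unicritical l (c::complex) ^^ n)"
  by (intro holomorphic_on_imp_continuous_on unicritical_iterate_holomorphic)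

lemma unicritical_holomorphic [holomorphic_intros]: "unicritical l (c::complex) holomorphic_on S"
  using unicritical_iterate_holomorphic[where n=1] by simp

lemma unicritical_continuous [continuous_intros]: "continuous_on S (unicritical l (c::complex))"
  using unicritical_iterate_continuous[where n=1] by simp

text \<open>From this modulus on, each step increases the modulus by at least 2, so escape is at
  least linear.\<close>

definition escape_radius :: "complex \<Rightarrow> real" where "escape_radius c = 2 + norm c"

text \<open>The strict inequality presents the set by preimages of an open disc, as the
  connectedness proof wants it. A point of modulus exactly the escape radius escapes, so the weak
  inequality gives the same set and shows that it is closed.\<close>

definition filled_julia :: "nat \<Rightarrow> complex \<Rightarrow> complex set" where
  "filled_julia l c = {z. \<forall>n. norm ((unicritical l c ^^ n) z) < escape_radius c}"

locale unicritical_map =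
  fixes l :: nat and c :: complex
  assumes l_ge_2: "l \<ge> 2"
begin

abbreviation "f \<equiv> unicritical l c"
abbreviation "R \<equiv> escape_radius c"
abbreviation "K \<equiv> filled_julia l c"

lemma R_pos: "R \<ge> 2" by (simp add: escape_radius_def)

lemma norm_f_escape: assumes "norm z \<ge> R" shows "norm (f z) \<ge> norm z + 2"
proof -
  have z2: "norm z \<ge> 2" using assms by (simp add: escape_radius_def add.commute order_trans[OF _ assms])
  have "norm z ^ l \<ge> norm z ^ 2" using z2 l_ge_2 by (intro power_increasing) auto
  moreover have "norm z ^ 2 \<ge> 2 * norm z" using z2 by (simp add: power2_eq_square mult_right_mono)
  moreover have "norm (f z) \<ge> norm z ^ l - norm c"
    using norm_diff_ineq[of "z^l" c] by (simp add: unicritical_def norm_power)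
  ultimately show ?thesis using assms by (simp add: escape_radius_def)
qed

lemma norm_iterate_escape: assumes "norm z \<ge> R" shows "norm ((f ^^ n) z) \<ge> norm z + 2 * n"
proof (induction n)
  case (Suc n)
  have "norm ((f ^^ n) z) \<ge> R" using Suc assms by simp
  from norm_f_escape[OF this] Suc show ?case by simp
qed simp

lemma mem_filled_alt: "z \<in> K \<longleftrightarrow> (\<forall>n. norm ((f ^^ n) z) \<le> R)"
proof
  assume *: "\<forall>n. norm ((f ^^ n) z) \<le> R"
  show "z \<in> K" unfolding filled_julia_def
  proof (intro CollectI allI, rule ccontr)
    fix n assume "\<not> norm ((f ^^ n) z) < R"
    then have "norm (f ((f ^^ n) z)) \<ge> norm ((f ^^ n) z) + 2" "norm ((f ^^ n) z) \<ge> R"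
      using norm_f_escape by auto
    then show False using *[rule_format, of "Suc n"] by simp
  qed
qed (auto simp: filled_julia_def less_imp_le)

lemma filled_bounded_orbit: "z \<in> K \<longleftrightarrow> bounded (range (\<lambda>n. (f ^^ n) z))"
proof
  assume "z \<in> K" then show "bounded (range (\<lambda>n. (f ^^ n) z))"
    by (auto simp: mem_filled_alt bounded_iff)
next
  assume "bounded (range (\<lambda>n. (f ^^ n) z))"
  then obtain B where B: "\<And>n. norm ((f ^^ n) z) \<le> B" by (auto simp: bounded_iff)
  show "z \<in> K" unfolding filled_julia_def
  proof (intro CollectI allI, rule ccontr)
    fix n assume "\<not> norm ((f ^^ n) z) < R"
    then have *: "norm ((f ^^ (m + n)) z) \<ge> norm ((f ^^ n) z) + 2 * m" for m
      using norm_iterate_escape[of "(f ^^ n) z" m] by (simp add: funpow_add)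
    obtain m :: nat where "B < m" using reals_Archimedean2 by blast
    then show False using *[of m] B[of "m + n"] norm_ge_zero[of "(f ^^ n) z"] by linarith
  qed
qed

lemma f_in_filled_iff: "f z \<in> K \<longleftrightarrow> z \<in> K"
proof
  assume *: "f z \<in> K"
  have "norm z \<le> R"
  proof (rule ccontr)
    assume "\<not> norm z \<le> R"
    then show False using norm_f_escape[of z] * by (auto simp: filled_julia_def dest!: spec[of _ 0])
  qed
  moreover have "norm ((f ^^ Suc n) z) \<le> R" for n
    using * by (simp add: mem_filled_alt funpow_Suc_right del: funpow.simps)
  ultimately show "z \<in> K" unfolding mem_filled_alt by (metis funpow_0 not0_implies_Suc)
next
  assume "z \<in> K"
  then have "norm ((f ^^ Suc n) z) < R" for n unfolding filled_julia_def by blast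
  then show "f z \<in> K" unfolding filled_julia_def by (simp add: funpow_Suc_right del: funpow.simps)
qed

lemma filled_closed: "closed K"
proof -
  have "K = (\<Inter>n. {z. norm ((f ^^ n) z) \<le> R})" using mem_filled_alt by auto
  then show ?thesis by (simp add: closed_INT closed_Collect_le continuous_on_norm unicritical_iterate_continuous)
qed

lemma filled_subset_ball: "K \<subseteq> ball 0 R"
  unfolding filled_julia_def by (auto dest: spec[of _ 0])

lemma filled_compact: "compact K"
  using filled_closed filled_subset_ball bounded_subset[OF bounded_ball] compact_eq_bounded_closed by blast

lemma interior_filled_fatou: assumes "z \<in> interior K" shows "z \<in> fatou_set f"
proof -
  obtain e where e: "e > 0" "ball z e \<subseteq> K" using assms mem_interior by blast
  have "normal_family_on (range (\<lambda>n. f ^^ n)) (ball z e)"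
    unfolding normal_family_on_def
  proof (intro allI impI)
    fix s :: "nat \<Rightarrow> complex \<Rightarrow> complex" assume s: "range s \<subseteq> range (\<lambda>n. f ^^ n)"
    have bd: "\<exists>B. \<forall>h\<in>range (\<lambda>n. f ^^ n). \<forall>z\<in>A. norm (h z) \<le> B" if "A \<subseteq> ball z e" for A
      using that e(2) by (intro exI[of _ R]) (auto simp: mem_filled_alt subset_iff)
    have hol: "\<And>h. h \<in> range (\<lambda>n. f ^^ n) \<Longrightarrow> h holomorphic_on ball z e"
      using unicritical_iterate_holomorphic by blast
    obtain g r where gr: "strict_mono (r :: nat \<Rightarrow> nat)"
       "\<And>A. \<lbrakk>compact A; A \<subseteq> ball z e\<rbrakk> \<Longrightarrow> uniform_limit A (s \<circ> r) g sequentially"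
      by (rule Montel[OF open_ball hol bd s]) blast+
    then show "\<exists>r. strict_mono r \<and>
      ((\<exists>g. \<forall>K. compact K \<and> K \<subseteq> ball z e \<longrightarrow> uniform_limit K (\<lambda>n. s (r n)) g sequentially) \<or>
       (\<forall>K. compact K \<and> K \<subseteq> ball z e \<longrightarrow> (\<forall>B. \<forall>\<^sub>F n in sequentially. \<forall>z\<in>K. B < norm (s (r n) z))))"
      by (intro exI[of _ r] conjI disjI1 exI[of _ g]) (auto simp: o_def)
  qed
  then show ?thesis unfolding fatou_set_def using e by (auto intro!: exI[of _ "ball z e"])
qed

lemma exterior_filled_fatou: assumes "z \<notin> K" shows "z \<in> fatou_set f"
proof -
  obtain N where N: "norm ((f ^^ N) z) > R" using assms mem_filled_alt[of z] by (auto simp: not_le)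
  define U0 where "U0 = {w. norm ((f ^^ N) w) > R}"
  have oU: "open U0" unfolding U0_def
    by (intro open_Collect_less continuous_on_norm unicritical_iterate_continuous continuous_on_const)
  have "z \<in> U0" using N by (simp add: U0_def)
  with oU obtain e where e: "e > 0" "ball z e \<subseteq> U0" by (rule openE)
  have big: "norm ((f ^^ (N + m)) w) \<ge> 2 * m" if "w \<in> ball z e" for w m
  proof -
    have "norm ((f ^^ m) ((f ^^ N) w)) \<ge> norm ((f ^^ N) w) + 2 * m"
      using that e(2) by (intro norm_iterate_escape) (auto simp: U0_def)
    moreover have "(f ^^ (N + m)) w = (f ^^ m) ((f ^^ N) w)" by (simp add: funpow_add add.commute[of N])
    ultimately show ?thesis using norm_ge_zero[of "(f ^^ N) w"] by (metis add_increasing order_refl order_trans)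
  qed
  have "normal_family_on (range (\<lambda>n. f ^^ n)) (ball z e)"
    unfolding normal_family_on_def
  proof (intro allI impI)
    fix s :: "nat \<Rightarrow> complex \<Rightarrow> complex" assume s: "range s \<subseteq> range (\<lambda>n. f ^^ n)"
    then have "\<forall>n. \<exists>j. s n = f ^^ j" by blast
    then obtain k where k: "\<And>n. s n = f ^^ k n" by metis
    show "\<exists>r. strict_mono r \<and>
      ((\<exists>g. \<forall>K. compact K \<and> K \<subseteq> ball z e \<longrightarrow> uniform_limit K (\<lambda>n. s (r n)) g sequentially) \<or>
       (\<forall>K. compact K \<and> K \<subseteq> ball z e \<longrightarrow> (\<forall>B. \<forall>\<^sub>F n in sequentially. \<forall>z\<in>K. B < norm (s (r n) z))))"
    \<comment> \<open>A sequence in the family may repeat iterates. Either one iterate recurs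
      infinitely often and gives a constant subsequence, or the exponents tend to infinity and the
      whole sequence diverges uniformly.\<close>
    proof (cases "\<exists>j. infinite {n. k n = j}")
      case True
      then obtain j where j: "infinite {n. k n = j}" by blast
      let ?r = "enumerate {n. k n = j}"
      have "strict_mono ?r" using j by (rule strict_mono_enumerate)
      moreover have "s (?r n) = f ^^ j" for n using enumerate_in_set[OF j, of n] k by simp
      ultimately show ?thesis
        by (intro exI[of _ ?r]) (auto intro!: exI[of _ "f ^^ j"] simp: uniform_limit_iff)
    next
      case False
      have lim: "filterlim k at_top sequentially"
        unfolding filterlim_at_top
      proof
        fix Z
        have "finite {n. k n < Z}"
        proof (rule finite_subset)
          show "{n. k n < Z} \<subseteq> (\<Union>j<Z. {n. k n = j})" by auto
          show "finite (\<Union>j<Z. {n. k n = j})" using False by auto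
        qed
        then show "\<forall>\<^sub>F n in sequentially. Z \<le> k n"
          unfolding eventually_cofinite[symmetric] cofinite_eq_sequentially[symmetric]
          by (simp add: eventually_cofinite not_le)
      qed
      have "\<forall>\<^sub>F n in sequentially. \<forall>w\<in>A. B < norm (s n w)" if "A \<subseteq> ball z e" for A B
      proof -
        obtain m :: nat where m: "B < m" using reals_Archimedean2 by blast
        have "\<forall>\<^sub>F n in sequentially. N + m \<le> k n" using lim by (simp add: filterlim_at_top)
        then show ?thesis
        proof eventually_elim
          case (elim n)
          then obtain i where i: "k n = N + (m + i)" by (metis add.assoc le_Suc_ex)
          show ?case
          proof
            fix w assume "w \<in> A"
            then have "norm (s n w) \<ge> 2 * (m + i)" using big[of w "m+i"] that k i by auto
            then show "B < norm (s n w)" using m by simp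
          qed
        qed
      qed
      then show ?thesis by (intro exI[of _ id]) (auto simp: strict_mono_id)
    qed
  qed
  then show ?thesis unfolding fatou_set_def using e by (auto intro!: exI[of _ "ball z e"])
qed

text \<open>A frontier point has a bounded orbit and escaping points next to it. The escaping ones
  exclude a finite locally uniform limit, the bounded one excludes divergence to infinity.\<close>

lemma frontier_filled_not_fatou: assumes "z \<in> frontier K" shows "z \<notin> fatou_set f"
proof
  assume "z \<in> fatou_set f"
  then obtain U where U: "open U" "z \<in> U" "normal_family_on (range (\<lambda>n. f ^^ n)) U"
    unfolding fatou_set_def by blast
  obtain e where e: "e > 0" "cball z e \<subseteq> U" using U open_contains_cball by blast
  have zK: "z \<in> K" using assms filled_closed by (simp add: frontier_def)
  obtain w where w: "w \<in> ball z e" "w \<notin> K"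
    using assms e(1) by (metis frontier_straddle dist_commute mem_ball)
  have "range (\<lambda>n. f ^^ n) \<subseteq> range (\<lambda>n. f ^^ n)" by simp
  with U(3) obtain r where r: "strict_mono (r :: nat \<Rightarrow> nat)"
    and or: "(\<exists>g. \<forall>A. compact A \<and> A \<subseteq> U \<longrightarrow> uniform_limit A (\<lambda>n. f ^^ (r n)) g sequentially) \<or>
       (\<forall>A. compact A \<and> A \<subseteq> U \<longrightarrow> (\<forall>B. \<forall>\<^sub>F n in sequentially. \<forall>z\<in>A. B < norm ((f ^^ (r n)) z)))"
    unfolding normal_family_on_def by (elim allE[of _ "\<lambda>n. f ^^ n"]) auto
  from or show False
  proof
    assume "\<exists>g. \<forall>A. compact A \<and> A \<subseteq> U \<longrightarrow> uniform_limit A (\<lambda>n. f ^^ (r n)) g sequentially"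
    then obtain g where "uniform_limit (cball z e) (\<lambda>n. f ^^ (r n)) g sequentially"
      using compact_cball[of z e] e(2) by blast
    then have lim: "(\<lambda>n. (f ^^ (r n)) w) \<longlonglongrightarrow> g w" using w by (auto dest!: tendsto_uniform_limitI)
    obtain N where N: "norm ((f ^^ N) w) > R" using w mem_filled_alt[of w] by (auto simp: not_le)
    have "\<forall>\<^sub>F n in sequentially. norm ((f ^^ (r n)) w) < norm (g w) + 1"
      using tendsto_norm[OF lim] by (auto elim!: order_tendstoD)
    then obtain n0 where n0: "\<And>n. n \<ge> n0 \<Longrightarrow> norm ((f ^^ (r n)) w) < norm (g w) + 1"
      by (auto simp: eventually_sequentially)
    obtain m :: nat where m: "norm (g w) + 1 < m" using reals_Archimedean2 by blast
    let ?n = "n0 + N + m"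
    have "r ?n \<ge> N + m" using seq_suble[OF r, of ?n] by simp
    then obtain i where i: "r ?n = m + i + N" by (metis add.commute add.left_commute le_Suc_ex)
    have "norm ((f ^^ (m + i)) ((f ^^ N) w)) \<ge> norm ((f ^^ N) w) + 2 * (m + i)"
      using norm_iterate_escape[of "(f ^^ N) w" "m + i"] N by simp
    then have "norm ((f ^^ (r ?n)) w) \<ge> norm ((f ^^ N) w) + 2 * (m + i)" by (simp add: i funpow_add)
    moreover have "norm ((f ^^ (r ?n)) w) < norm (g w) + 1" by (rule n0) simp
    moreover have "norm ((f ^^ N) w) \<ge> 0" "real (2 * (m + i)) \<ge> m" by simp_all
    ultimately show False using m by linarith
  next
    assume "\<forall>A. compact A \<and> A \<subseteq> U \<longrightarrow> (\<forall>B. \<forall>\<^sub>F n in sequentially. \<forall>z\<in>A. B < norm ((f ^^ (r n)) z))"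
    moreover have "compact {z}" "{z} \<subseteq> U" using U by auto
    ultimately have "\<forall>\<^sub>F n in sequentially. \<forall>z\<in>{z}. R < norm ((f ^^ (r n)) z)" by blast
    then obtain n where "R < norm ((f ^^ (r n)) z)" by (auto simp: eventually_sequentially)
    then show False using zK by (auto simp: mem_filled_alt not_less[symmetric])
  qed
qed

lemma julia_eq_frontier: "julia_set f = frontier K"
proof -
  have "z \<in> fatou_set f \<longleftrightarrow> z \<notin> frontier K" for z
  proof (cases "z \<in> frontier K")
    case False
    then consider "z \<in> interior K" | "z \<notin> K" using filled_closed by (auto simp: frontier_def)
    then show ?thesis using False interior_filled_fatou exterior_filled_fatou by metis
  qed (use frontier_filled_not_fatou in auto)
  then show ?thesis unfolding julia_set_def by auto
qed

lemma julia_closed: "closed (julia_set f)" by (simp add: julia_eq_frontier)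
lemma julia_subset: "julia_set f \<subseteq> K" using filled_closed by (auto simp: julia_eq_frontier frontier_def)

section \<open>Connectedness of the filled Julia set and of its frontier\<close>

lemma connected_complement_filled: "connected (- K)"
proof (rule ccontr)
  assume "\<not> connected (- K)"
  moreover have "bounded (- (- K))" using filled_compact compact_imp_bounded by simp
  ultimately obtain C where C: "C \<in> components (- K)" "bounded C"
    using cobounded_has_bounded_component[of "- K"] by auto
  have openC: "open C" by (rule open_components[OF _ C(1)]) (use filled_closed in blast)
  have fr: "frontier C \<subseteq> K"
    using frontier_of_components_closed_complement[OF filled_closed C(1)] filled_closed
    by (auto simp: frontier_def)
  obtain w where w: "w \<in> C" using C in_components_nonempty by blast
  \<comment> \<open>Maximum modulus: a bounded component has its frontier in \<open>K\<close>, where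
    all iterates are bounded by \<open>R\<close>, so it would lie in \<open>K\<close>
    itself.\<close>
  have "norm ((f ^^ n) w) \<le> R" for n
  proof (rule maximum_modulus_frontier[of "f ^^ n" C])
    show "norm ((f ^^ n) z) \<le> R" if "z \<in> frontier C" for z using that fr by (auto simp: mem_filled_alt)
  qed (use w C in \<open>auto intro: unicritical_iterate_holomorphic unicritical_iterate_continuous\<close>)
  then have "w \<in> K" by (simp add: mem_filled_alt)
  then show False using w C in_components_subset by blast
qed

lemma f_not_constant: assumes "open S" "S \<noteq> {}" shows "\<not> f constant_on S"
proof
  assume "f constant_on S"
  then obtain y0 where "\<And>x. x \<in> S \<Longrightarrow> x ^ l + c = y0" unfolding constant_on_def unicritical_def by blast
  then have y: "\<And>x. x \<in> S \<Longrightarrow> x ^ l = y0 - c" by (simp add: eq_diff_eq)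
  have "S \<subseteq> {x. x ^ l = y0 - c}" using y by auto
  moreover have "finite {x. x ^ l = y0 - c}" using l_ge_2 by (intro finite_nth_roots) auto
  ultimately show False using assms finite_imp_not_open finite_subset by blast
qed

text \<open>The image of each component of the preimage is open and relatively closed, hence all of
  \<open>U\<close>. So every component contains a preimage of \<open>c\<close>; the only one is
  \<open>0\<close>, and the components coincide.\<close>

lemma connected_preimage:
  assumes U: "open U" "connected U" "bounded U" and cU: "c \<in> U"
  shows "connected (f -` U)"
proof -
  let ?V = "f -` U"
  have openV: "open ?V" by (rule open_vimage[OF U(1) unicritical_continuous])
  have boV: "bounded ?V"
  proof -
    obtain B where B: "\<And>u. u \<in> U \<Longrightarrow> norm u \<le> B" using U(3) by (auto simp: bounded_iff)
    have "norm z \<le> max R B" if "z \<in> ?V" for z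
      using norm_f_escape[of z] B[of "f z"] that by (cases "norm z \<ge> R") auto
    then show ?thesis unfolding bounded_iff by blast
  qed
  have zero: "0 \<in> C" if C: "C \<in> components ?V" for C
  proof -
    have openC: "open C" using C openV open_components by blast
    have Cne: "C \<noteq> {}" using C in_components_nonempty by blast
    have CV: "C \<subseteq> ?V" using C in_components_subset by blast
    have con: "connected C" using C in_components_connected by blast
    have "open (f ` C)"
    proof (rule open_mapping_thm[of f C C])
      show "f holomorphic_on C" by (rule unicritical_holomorphic)
      show "\<not> f constant_on C" by (rule f_not_constant[OF openC Cne])
    qed (use openC con in simp_all)
    then have "openin (top_of_set U) (f ` C)" using CV U(1) by (simp add: openin_open_eq image_subset_iff_subset_vimage)
    moreover have "closedin (top_of_set U) (f ` C)"
    proof -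
      have "f ` C = U \<inter> closure (f ` C)"
      proof
        show "f ` C \<subseteq> U \<inter> closure (f ` C)" using CV closure_subset[of "f ` C"] by blast
        show "U \<inter> closure (f ` C) \<subseteq> f ` C"
        proof
          fix w assume w: "w \<in> U \<inter> closure (f ` C)"
          then have "w \<in> closure (f ` C)" by blast
          then obtain x where x: "\<And>n. x n \<in> f ` C" "x \<longlonglongrightarrow> w" unfolding closure_sequential by blast
          then have "\<forall>n. \<exists>y. y \<in> C \<and> x n = f y" by blast
          then obtain z where z: "\<And>n. z n \<in> C" "\<And>n. x n = f (z n)" by metis
          have bz: "bounded (range z)" by (rule bounded_subset[OF boV]) (use z(1) CV in blast)
          obtain z0 r where r: "strict_mono (r :: nat \<Rightarrow> nat)" "(z \<circ> r) \<longlonglongrightarrow> z0"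
            using bounded_imp_convergent_subsequence[OF bz] by metis
          have "(\<lambda>n. f ((z \<circ> r) n)) \<longlonglongrightarrow> f z0"
            by (rule continuous_on_tendsto_compose[OF unicritical_continuous[of UNIV] r(2)]) auto
          moreover have "(\<lambda>n. f ((z \<circ> r) n)) \<longlonglongrightarrow> w"
            using LIMSEQ_subseq_LIMSEQ[OF x(2) r(1)] z(2) by (simp add: o_def)
          ultimately have fz: "f z0 = w" by (rule LIMSEQ_unique)
          then have "z0 \<in> ?V" using w by simp
          define D where "D = connected_component_set ?V z0"
          have D: "open D" "z0 \<in> D" "D \<in> components ?V"
            unfolding D_def using \<open>z0 \<in> ?V\<close> openV
            by (simp_all add: open_connected_component componentsI)
          have "\<forall>\<^sub>F n in sequentially. (z \<circ> r) n \<in> D" by (rule topological_tendstoD[OF r(2) D(1,2)])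
          then obtain n where "(z \<circ> r) n \<in> D" by (auto simp: eventually_sequentially)
          then have "D = C" using z(1)[of "r n"] components_eq[OF D(3) C] by (simp add: disjoint_iff) blast
          then show "w \<in> f ` C" using fz D(2) by blast
        qed
      qed
      then show ?thesis unfolding closedin_closed using closed_closure by blast
    qed
    ultimately have "f ` C = {} \<or> f ` C = U" using U(2) unfolding connected_clopen by metis
    then have "f ` C = U" using Cne by simp
    then obtain z where "z \<in> C" "f z = c" using cU by (metis imageE)
    then show ?thesis using l_ge_2 by (auto simp: unicritical_def)
  qed
  have "C = D" if "C \<in> components ?V" "D \<in> components ?V" for C D
    using zero[OF that(1)] zero[OF that(2)] components_eq[OF that] by blast
  then have "\<exists>a. components ?V \<subseteq> {a}" by blast
  then show ?thesis unfolding connected_eq_components_subset_sing_exists .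
qed

text \<open>\<open>K\<close> is the nested intersection of the closures of the preimages of the
  escape disc. If \<open>0\<close> does not escape, the critical value \<open>c\<close> lies in each
  of these preimages, so their connectedness is inherited step by step.\<close>

lemma connected_filled: assumes "0 \<in> K" shows "connected K"
proof -
  define A where "A n = (f ^^ n) -` ball 0 R" for n
  have A0: "A 0 = ball 0 R" by (auto simp: A_def)
  have ASuc: "A (Suc n) = f -` A n" for n unfolding A_def by (auto simp: unicritical_iterate_Suc simp del: funpow.simps)
  have Abd: "A n \<subseteq> ball 0 R" for n
  proof
    fix z assume "z \<in> A n"
    then show "z \<in> ball 0 R" using norm_iterate_escape[of z n] by (cases "norm z \<ge> R") (auto simp: A_def)
  qed
  have Aopen: "open (A n)" for n unfolding A_def by (intro open_vimage unicritical_iterate_continuous) simp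
  have f0: "f 0 = c" using l_ge_2 by (simp add: unicritical_def)
  have cA: "c \<in> A n" for n
  proof -
    have "(f ^^ Suc n) 0 = (f ^^ n) c" by (simp only: unicritical_iterate_Suc f0)
    then show ?thesis using assms unfolding A_def filled_julia_def
      by (metis (mono_tags) dist_0_norm mem_Collect_eq mem_ball vimageI)
  qed
  have Acon: "connected (A n)" for n
  proof (induction n)
    case (Suc n)
    show ?case unfolding ASuc
      by (rule connected_preimage[OF Aopen Suc bounded_subset[OF bounded_ball Abd] cA])
  qed (simp add: A0)
  have clA: "closure (A (Suc n)) \<subseteq> A n" for n
  proof
    fix z assume z: "z \<in> closure (A (Suc n))"
    have "closed {z. norm ((f ^^ Suc n) z) \<le> R}"
      by (intro closed_Collect_le continuous_on_norm unicritical_iterate_continuous continuous_on_const)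
    moreover have "A (Suc n) \<subseteq> {z. norm ((f ^^ Suc n) z) \<le> R}" unfolding A_def by auto
    ultimately have "norm ((f ^^ Suc n) z) \<le> R" using z closure_minimal by blast
    then have "norm (f ((f ^^ n) z)) \<le> R" by simp
    then have "norm ((f ^^ n) z) < R" using norm_f_escape[of "(f ^^ n) z"] by linarith
    then show "z \<in> A n" by (simp add: A_def)
  qed
  have "K = (\<Inter>n. closure (A n))"
  proof
    show "K \<subseteq> (\<Inter>n. closure (A n))"
      using closure_subset unfolding A_def filled_julia_def by fastforce
    show "(\<Inter>n. closure (A n)) \<subseteq> K"
    proof
      fix z assume "z \<in> (\<Inter>n. closure (A n))"
      then have "z \<in> A n" for n using clA by blast
      then show "z \<in> K" by (auto simp: A_def filled_julia_def)
    qed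
  qed
  moreover have "connected (\<Inter> (range (\<lambda>n. closure (A n))))"
  proof (rule connected_nest)
    show "compact (closure (A n))" for n
      using bounded_subset[OF bounded_ball Abd] by simp
    show "connected (closure (A n))" for n using Acon by (rule connected_imp_connected_closure)
    show "closure (A n) \<subseteq> closure (A m)" if "m \<le> n" for m n
    proof (rule lift_Suc_antimono_le[OF _ that, of "\<lambda>n. closure (A n)"])
      show "closure (A (Suc n)) \<subseteq> closure (A n)" for n using clA closure_subset by blast
    qed
  qed
  ultimately show ?thesis by simp
qed

lemma connected_julia: assumes "0 \<in> K" shows "connected (julia_set f)"
  unfolding julia_eq_frontier
  by (rule connected_frontier_simple[OF connected_filled[OF assms] connected_complement_filled])

section \<open>Blow-up of neighbourhoods of Julia points\<close>

lemma two_preimages: assumes "c \<noteq> 0" obtains u where "f u = w" "u \<noteq> w"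
proof (cases "f w = w")
  case True
  have l0: "l \<noteq> 0" using l_ge_2 by simp
  \<comment> \<open>Only \<open>0\<close> can be its own sole preimage, and it is fixed only when
    \<open>c = 0\<close>. For other fixed \<open>w\<close> a root of unity gives a second
    preimage.\<close>
  have "w \<noteq> 0" using True assms l0 by (auto simp: unicritical_def power_0_left)
  define u where "u = w * cis (2 * pi / l)"
  have "cis (2 * pi / l) ^ l = 1" unfolding Complex.DeMoivre using l0 by (simp add: cis_2pi)
  then have "f u = w" using True by (simp add: u_def unicritical_def power_mult_distrib)
  moreover have "cis (2 * pi / l) \<noteq> 1"
  proof
    assume "cis (2 * pi / l) = 1"
    then have "cos (2 * pi / l) = 1" by (metis cis.sel(1) one_complex.sel(1))
    moreover have "cos (2 * pi / l) < cos 0"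
      using l_ge_2 by (intro cos_monotone_0_pi) (auto simp: field_simps)
    ultimately show False by simp
  qed
  then have "u \<noteq> w" using \<open>w \<noteq> 0\<close> by (simp add: u_def)
  ultimately show ?thesis by (rule that)
next
  case False
  obtain u where "u ^ l = w - c"
    using exists_complex_root[of l "w - c"] l_ge_2 by (metis less_le_trans not_gr_zero pos2 zero_less_iff_neq_zero)
  then have "f u = w" by (simp add: unicritical_def)
  then show ?thesis using that[of u] False by metis
qed

text \<open>If \<open>w\<close> is omitted by all iterates on the ball, so is a preimage
  \<open>u\<close> of it. Two omitted values bound all iterates on a smaller ball, which would then
  lie inside \<open>K\<close>. There are no exceptional points, since \<open>c\<close> is not
  0.\<close>

lemma julia_blowup:
  assumes z: "z \<in> julia_set f" and r: "r > 0" and c: "c \<noteq> 0"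
  shows "\<exists>n. w \<in> (f ^^ n) ` ball z r"
proof (rule ccontr)
  assume "\<not> ?thesis"
  then have om: "\<And>n x. x \<in> ball z r \<Longrightarrow> (f ^^ n) x \<noteq> w" by (metis imageI)
  obtain u where u: "f u = w" "u \<noteq> w" using two_preimages[OF c] by blast
  have omu: "(f ^^ n) x \<noteq> u" if "x \<in> ball z r" for n x
    using om[OF that, of "Suc n"] u(1) by auto
  have zK: "z \<in> K" using z julia_subset by blast
  let ?S = "exp (pi * exp (pi * (2 + 2 * ((R + norm w) / norm (u - w)) + 12 * (1/2) / (1 - 1/2))))"
  have bd: "norm ((f ^^ n) y) \<le> norm w + norm (u - w) * ?S" if y: "y \<in> ball z (r/4)" for n y
  proof -
    \<comment> \<open>The omitted values become 0 and 1. Radius \<open>r/2\<close> keeps the image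
      of the closed unit disc inside the ball, and Schottky's bound at modulus 1/2 covers radius
      \<open>r/4\<close>.\<close>
    define k where "k = (\<lambda>x. ((f ^^ n) (z + of_real (r/2) * x) - w) / (u - w))"
    define x where "x = (y - z) / of_real (r/2)"
    have "norm (k x) \<le> ?S"
    proof (rule Schottky[where f=k and z=x])
      have "((f ^^ n) \<circ> (\<lambda>x. z + of_real (r/2) * x)) holomorphic_on cball 0 1"
        by (rule holomorphic_on_compose) (auto intro!: holomorphic_intros unicritical_iterate_holomorphic)
      then show "k holomorphic_on cball 0 1"
        unfolding k_def o_def using u(2) by (intro holomorphic_intros) auto
      have "norm ((f ^^ n) z - w) \<le> R + norm w"
        using zK norm_triangle_ineq4[of "(f ^^ n) z" w] by (auto simp: mem_filled_alt intro: order_trans add_right_mono)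
      then show "norm (k 0) \<le> (R + norm w) / norm (u - w)"
        by (simp add: k_def norm_divide divide_right_mono)
      show "\<not> (k x = 0 \<or> k x = 1)" if "x \<in> cball 0 1" for x
      proof -
        have "norm (of_real (r/2) * x) \<le> r/2 * 1"
          unfolding norm_mult using that r by (intro mult_mono) auto
        then have "norm (of_real (r/2) * x) < r" using r by linarith
        then have "z + of_real (r/2) * x \<in> ball z r" by (simp add: dist_norm)
        then show ?thesis using om omu u(2) by (simp add: k_def)
      qed
      show "norm x \<le> 1/2" using y r by (simp add: x_def norm_divide dist_norm norm_minus_commute divide_simps del: of_real_divide)
    qed auto
    moreover have "(f ^^ n) y = w + (u - w) * k x"
      using u(2) r by (simp add: k_def x_def del: of_real_divide)
    ultimately show ?thesis
      using norm_triangle_ineq[of w "(u - w) * k x"]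
      by (simp add: norm_mult) (meson add_left_mono mult_left_mono norm_ge_zero order_trans)
  qed
  have "ball z (r/4) \<subseteq> K"
  proof
    fix y assume "y \<in> ball z (r/4)"
    then show "y \<in> K" unfolding filled_bounded_orbit bounded_iff using bd by blast
  qed
  then have "z \<in> interior K" using r by (meson centre_in_ball interiorI open_ball zero_less_divide_iff zero_less_numeral)
  then show False using z by (simp add: julia_eq_frontier frontier_def)
qed

end

section \<open>Inverse branches\<close>

lemma unicritical_iterate_of_real:
  "(unicritical l (complex_of_real c) ^^ n) (of_real x) = of_real ((unicritical l c ^^ n) x)"
  by (induction n) (simp_all add: unicritical_def)

lemma unicritical_iterate_continuous_real [continuous_intros]: "continuous_on S (unicritical l (c::real) ^^ n)"
proof (induction n)
  case (Suc n)
  then show ?case by (auto simp: unicritical_def intro!: continuous_intros)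
qed (simp add: continuous_on_id)

lemma one_signed: assumes "connected S" "(0::real) \<notin> S"
  obtains e :: real where "e \<in> {-1,1}" "\<And>y. y \<in> S \<Longrightarrow> y = e * \<bar>y\<bar>"
proof (cases "\<exists>y\<in>S. y > 0")
  case True
  then obtain y where y: "y \<in> S" "y > 0" by blast
  have "x > 0" if "x \<in> S" for x
  proof (rule ccontr)
    assume "\<not> x > 0"
    then have "0 \<in> S" using connectedD_interval[OF assms(1) that y(1), of 0] y by simp
    then show False using assms by simp
  qed
  then show ?thesis using that[of 1] by force
next
  case False
  then show ?thesis using that[of "-1"] by force
qed

text \<open>Off the real axis the branch avoids the real critical values automatically, because real
  points have real iterates; on the axis it follows the given monotone real branch.\<close>

lemma real_inverse_branch:
  fixes S :: "real set"
  assumes l: "even l" "l \<ge> 2" and "connected S"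
    and "\<And>i y. i < N \<Longrightarrow> y \<in> S \<Longrightarrow> (unicritical l c ^^ i) y \<noteq> 0"
    and "open U" "\<And>x. complex_of_real x \<in> U \<Longrightarrow> x \<in> (unicritical l c ^^ N) ` S"
  shows "\<exists>\<phi>. \<phi> holomorphic_on U \<and> (\<forall>w\<in>U. (unicritical l (complex_of_real c) ^^ N) (\<phi> w) = w) \<and>
    (\<forall>y\<in>S. complex_of_real ((unicritical l c ^^ N) y) \<in> U \<longrightarrow>
       \<phi> (of_real ((unicritical l c ^^ N) y)) = of_real y)"
  using assms(3,4,6)
proof (induction N arbitrary: S)
  case 0
  then show ?case by (intro exI[of _ id]) (auto simp: holomorphic_on_id[unfolded id_def] id_def)
next
  case (Suc N)
  let ?g = "unicritical l c" and ?f = "unicritical l (complex_of_real c)"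
  have S0: "0 \<notin> S" using Suc.prems(2)[of 0] by auto
  then obtain e where e: "e \<in> {-1,1}" "\<And>y. y \<in> S \<Longrightarrow> y = e * \<bar>y\<bar>" using one_signed[OF Suc.prems(1)] by blast
  have el: "e ^ l = 1" using e(1) l(1) by auto
  have "\<exists>\<phi>. \<phi> holomorphic_on U \<and> (\<forall>w\<in>U. (?f ^^ N) (\<phi> w) = w) \<and>
    (\<forall>y\<in>?g ` S. complex_of_real ((?g ^^ N) y) \<in> U \<longrightarrow> \<phi> (of_real ((?g ^^ N) y)) = of_real y)"
  proof (rule Suc.IH)
    show "connected (?g ` S)" using Suc.prems(1)
      by (rule connected_continuous_image[rotated]) (auto simp: unicritical_def intro!: continuous_intros)
    show "(?g ^^ i) y \<noteq> 0" if "i < N" "y \<in> ?g ` S" for i y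
      using that Suc.prems(2)[of "Suc i"] by (auto simp: unicritical_iterate_Suc simp del: funpow.simps)
    show "x \<in> (?g ^^ N) ` ?g ` S" if "complex_of_real x \<in> U" for x
      using Suc.prems(3)[OF that] by (auto simp: unicritical_iterate_Suc simp del: funpow.simps)
  qed
  then obtain \<psi> where \<psi>: "\<psi> holomorphic_on U" "\<And>w. w \<in> U \<Longrightarrow> (?f ^^ N) (\<psi> w) = w"
    "\<And>y. y \<in> S \<Longrightarrow> complex_of_real ((?g ^^ N) (?g y)) \<in> U \<Longrightarrow> \<psi> (of_real ((?g ^^ N) (?g y))) = of_real (?g y)"
    by blast
  have pos: "y ^ l > 0" if "y \<in> S" for y
    using that S0 l by (metis zero_less_power_eq)
  \<comment> \<open>If the value were on the slit, \<open>\<psi> w\<close> and therefore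
    \<open>w\<close> would be real; then \<open>\<psi> w\<close> is the real image of some
    \<open>y\<close> in \<open>S\<close>, and subtracting \<open>c\<close> leaves
    \<open>y ^ l > 0\<close>.\<close>
  have Ln: "\<psi> w - of_real c \<notin> \<real>\<^sub>\<le>\<^sub>0" if w: "w \<in> U" for w
  proof
    assume "\<psi> w - of_real c \<in> \<real>\<^sub>\<le>\<^sub>0"
    then obtain r where r: "r \<le> 0" "\<psi> w = of_real (r + c)" by (auto elim!: nonpos_Reals_cases simp: algebra_simps)
    then have w_eq: "w = of_real ((?g ^^ N) (r + c))"
      using \<psi>(2)[OF w] unicritical_iterate_of_real by metis
    then have "(?g ^^ N) (r + c) \<in> (?g ^^ Suc N) ` S" using w by (intro Suc.prems(3)) simp
    then obtain y where y: "y \<in> S" "(?g ^^ N) (r + c) = (?g ^^ N) (?g y)"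
      by (auto simp: unicritical_iterate_Suc simp del: funpow.simps)
    then have "\<psi> w = of_real (?g y)" using \<psi>(3)[OF y(1)] w w_eq by simp
    then have "r + c = ?g y" using r(2) by (metis of_real_eq_iff)
    then show False using pos[OF y(1)] r by (simp add: unicritical_def)
  qed
  \<comment> \<open>The principal root is positive on the positive axis; the sign \<open>e\<close>
    of \<open>S\<close> selects the required root, and is again an \<open>l\<close>-th root of unity
    because \<open>l\<close> is even.\<close>
  define \<phi> where "\<phi> = (\<lambda>w. of_real e * exp (Ln (\<psi> w - of_real c) / of_nat l))"
  have hol: "\<phi> holomorphic_on U" unfolding \<phi>_def
    using Ln \<psi>(1) l by (intro holomorphic_intros) auto
  have root: "\<phi> w ^ l = \<psi> w - of_real c" if "w \<in> U" for w
  proof -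
    have "\<psi> w - of_real c \<noteq> 0" using Ln[OF that] by auto
    then show ?thesis using l el unfolding \<phi>_def
      by (simp add: power_mult_distrib flip: exp_of_nat_mult of_real_power)
  qed
  have "(?f ^^ Suc N) (\<phi> w) = w" if "w \<in> U" for w
    unfolding unicritical_iterate_Suc using root[OF that] \<psi>(2)[OF that] by (simp add: unicritical_def)
  moreover have "\<phi> (of_real ((?g ^^ Suc N) y)) = of_real y"
    if y: "y \<in> S" "complex_of_real ((?g ^^ Suc N) y) \<in> U" for y
  proof -
    have "\<psi> (of_real ((?g ^^ Suc N) y)) - of_real c = of_real (y ^ l)"
      using \<psi>(3)[OF y(1)] y(2) by (simp add: unicritical_iterate_Suc del: funpow.simps) (simp add: unicritical_def)
    moreover have "exp (Ln (of_real (y ^ l)) / of_nat l) = complex_of_real \<bar>y\<bar>"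
    proof -
      have "Ln (complex_of_real (y ^ l)) = of_real (ln (y ^ l))" using pos[OF y(1)] by (rule Ln_of_real)
      also have "ln (y ^ l) = ln (\<bar>y\<bar> ^ l)" using l by (simp add: power_even_abs)
      also have "ln (\<bar>y\<bar> ^ l) = l * ln \<bar>y\<bar>" by (rule ln_realpow)
      finally have "Ln (of_real (y ^ l)) = of_nat l * complex_of_real (ln \<bar>y\<bar>)" by simp
      then have "Ln (of_real (y ^ l)) / of_nat l = complex_of_real (ln \<bar>y\<bar>)" using l(2) by (simp del: of_real_power)
      moreover have "exp (complex_of_real (ln \<bar>y\<bar>)) = of_real \<bar>y\<bar>"
      proof -
        have "0 < \<bar>y\<bar>" using y S0 by auto
        then show ?thesis by (simp add: exp_of_real)
      qed
      ultimately show ?thesis by simp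
    qed
    ultimately have "\<phi> (of_real ((?g ^^ Suc N) y)) = of_real (e * \<bar>y\<bar>)" by (simp add: \<phi>_def)
    then show ?thesis using e(2)[OF y(1)] by simp
  qed
  ultimately show ?case using hol by blast
qed

text \<open>This is the chain rule product, stated over any commutative ring so that real and
  complex derivatives are the same expression on the real axis.\<close>

definition orbit_deriv :: "nat \<Rightarrow> 'a::comm_ring_1 \<Rightarrow> nat \<Rightarrow> 'a \<Rightarrow> 'a" where
  "orbit_deriv l c n z = (\<Prod>i<n. of_nat l * ((unicritical l c ^^ i) z) ^ (l - 1))"

lemma iterate_has_derivative:
  fixes z :: "'a::real_normed_field"
  shows "((unicritical l c ^^ n) has_field_derivative orbit_deriv l c n z) (at z)"
proof (induction n)
  case (Suc n)
  have "(unicritical l c has_field_derivative of_nat l * ((unicritical l c ^^ n) z) ^ (l - 1)) (at ((unicritical l c ^^ n) z))"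
    unfolding unicritical_def by (auto intro!: derivative_eq_intros)
  from DERIV_chain[OF this Suc] show ?case by (simp add: orbit_deriv_def o_def mult.commute)
qed (auto simp: orbit_deriv_def id_def)

lemma deriv_iterate: "deriv (unicritical l c ^^ n) z = orbit_deriv l c n z"
  by (rule DERIV_imp_deriv[OF iterate_has_derivative])

lemma orbit_deriv_of_real: "orbit_deriv l (complex_of_real c) n (of_real x) = of_real (orbit_deriv l c n x)"
  by (simp add: orbit_deriv_def unicritical_iterate_of_real)

lemma inverse_branch_deriv:
  assumes "\<phi> holomorphic_on U" "open U" "\<And>w. w \<in> U \<Longrightarrow> (unicritical l c ^^ n) (\<phi> w) = w" "w \<in> U"
  shows "orbit_deriv l c n (\<phi> w) * deriv \<phi> w = 1"
proof -
  have "(\<phi> has_field_derivative deriv \<phi> w) (at w)" using assms by (simp add: holomorphic_derivI)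
  from DERIV_chain[OF iterate_has_derivative this]
  have "(((unicritical l c ^^ n) \<circ> \<phi>) has_field_derivative orbit_deriv l c n (\<phi> w) * deriv \<phi> w) (at w)" .
  moreover have "(((unicritical l c ^^ n) \<circ> \<phi>) has_field_derivative 1) (at w)"
    by (rule has_field_derivative_transform_within_open[OF DERIV_ident assms(2,4)]) (use assms(3) in auto)
  ultimately show ?thesis by (rule DERIV_unique)
qed

lemma strip_convex: "convex {w. a < Re w \<and> Re w < b}" "convex {w. a \<le> Re w \<and> Re w \<le> b}"
proof -
  have "{w. a < Re w \<and> Re w < b} = {w. Re w > a} \<inter> {w. Re w < b}" by auto
  then show "convex {w. a < Re w \<and> Re w < b}" by (simp add: convex_Int convex_halfspace_Re_gt convex_halfspace_Re_lt)
  have "{w. a \<le> Re w \<and> Re w \<le> b} = {w. Re w \<ge> a} \<inter> {w. Re w \<le> b}" by auto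
  then show "convex {w. a \<le> Re w \<and> Re w \<le> b}" by (simp add: convex_Int convex_halfspace_Re_ge convex_halfspace_Re_le)
qed

lemma strip_open: "open {w. a < Re w \<and> Re w < b}"
  by (intro open_Collect_conj open_Collect_less continuous_intros)

lemma strip_ball: assumes "a + s \<le> Re z" "Re z \<le> b - s" shows "ball z s \<subseteq> {w. a < Re w \<and> Re w < b}"
proof
  fix w assume "w \<in> ball z s"
  then have "\<bar>Re z - Re w\<bar> < s" using abs_Re_le_cmod[of "z - w"] by (simp add: dist_norm)
  then show "w \<in> {w. a < Re w \<and> Re w < b}" using assms by auto
qed

text \<open>The inverse of a real branch onto \<open>(a, b)\<close> extends univalently to the whole
  vertical strip over \<open>(a, b)\<close>, and points at distance \<open>s\<close> from the ends
  have discs of radius \<open>s\<close> in the strip. Distortion of the inverse is that of the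
  iterate read backwards.\<close>

lemma real_koebe:
  fixes u v a b s c :: real
  assumes l: "even l" "l \<ge> 2"
    and nz: "\<And>i y. i < N \<Longrightarrow> y \<in> {u<..<v} \<Longrightarrow> (unicritical l c ^^ i) y \<noteq> 0"
    and im: "{a<..<b} \<subseteq> (unicritical l c ^^ N) ` {u<..<v}"
    and s: "s > 0" and y: "y \<in> {u<..<v}" "a + s \<le> (unicritical l c ^^ N) y" "(unicritical l c ^^ N) y \<le> b - s"
    and z: "z \<in> {u<..<v}" "a + s \<le> (unicritical l c ^^ N) z" "(unicritical l c ^^ N) z \<le> b - s"
  shows "\<bar>orbit_deriv l c N y\<bar> \<le>
    exp (koebe / s * \<bar>(unicritical l c ^^ N) y - (unicritical l c ^^ N) z\<bar>) * \<bar>orbit_deriv l c N z\<bar>"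
proof -
  let ?g = "unicritical l c" and ?f = "unicritical l (complex_of_real c)"
  define U where "U = {w. a < Re w \<and> Re w < b}"
  have U: "open U" "convex U" unfolding U_def by (rule strip_open, rule strip_convex)
  have "x \<in> (?g ^^ N) ` {u<..<v}" if "complex_of_real x \<in> U" for x using im that by (auto simp: U_def)
  from real_inverse_branch[OF l connected_Ioo nz U(1) this]
  obtain \<phi> where \<phi>: "\<phi> holomorphic_on U" "\<And>w. w \<in> U \<Longrightarrow> (?f ^^ N) (\<phi> w) = w"
     "\<And>x. x \<in> {u<..<v} \<Longrightarrow> complex_of_real ((?g ^^ N) x) \<in> U \<Longrightarrow> \<phi> (of_real ((?g ^^ N) x)) = of_real x"
    by blast
  have inj: "inj_on \<phi> U" using \<phi>(2) by (metis inj_onI)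
  have D: "of_real (orbit_deriv l c N x) * deriv \<phi> (of_real ((?g ^^ N) x)) = 1"
    if "x \<in> {u<..<v}" "complex_of_real ((?g ^^ N) x) \<in> U" for x
    using inverse_branch_deriv[OF \<phi>(1) U(1) \<phi>(2) that(2)] \<phi>(3)[OF that] by (simp add: orbit_deriv_of_real)
  have yU: "complex_of_real ((?g ^^ N) y) \<in> U" and zU: "complex_of_real ((?g ^^ N) z) \<in> U"
    using y z s by (auto simp: U_def)
  have "norm (deriv \<phi> (of_real ((?g ^^ N) z))) \<le>
     exp (koebe / s * norm (complex_of_real ((?g ^^ N) z) - of_real ((?g ^^ N) y))) * norm (deriv \<phi> (of_real ((?g ^^ N) y)))"
  proof (rule univalent_distortion[OF \<phi>(1) U inj _ s, of "{w. a + s \<le> Re w \<and> Re w \<le> b - s}"])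
    show "ball z s \<subseteq> U" if "z \<in> {w. a + s \<le> Re w \<and> Re w \<le> b - s}" for z
      unfolding U_def by (rule strip_ball) (use that in auto)
  qed (use y z in \<open>auto intro: strip_convex\<close>)
  moreover have "norm (complex_of_real ((?g ^^ N) z) - of_real ((?g ^^ N) y)) = \<bar>(?g ^^ N) y - (?g ^^ N) z\<bar>"
    by (metis norm_minus_commute norm_of_real of_real_diff real_norm_def)
  moreover have "norm (deriv \<phi> (of_real ((?g ^^ N) x))) = 1 / \<bar>orbit_deriv l c N x\<bar> \<and> orbit_deriv l c N x \<noteq> 0"
    if "x \<in> {u<..<v}" "complex_of_real ((?g ^^ N) x) \<in> U" for x
  proof -
    have "\<bar>orbit_deriv l c N x\<bar> * norm (deriv \<phi> (of_real ((?g ^^ N) x))) = 1"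
      using arg_cong[OF D[OF that], of norm] by (simp add: norm_mult)
    then show ?thesis by (cases "orbit_deriv l c N x = 0") (auto simp: nonzero_eq_divide_eq mult.commute)
  qed
  ultimately show ?thesis using yU zU y(1) z(1) by (simp add: field_simps)
qed

lemma strict_mono_on_between:
  assumes "strict_mono_on S (G::real \<Rightarrow> real)" "x \<in> S" "y \<in> S" "z \<in> S" "x \<le> z" "z \<le> y"
  shows "G x \<le> G z" "G z \<le> G y"
  using assms by (meson strict_mono_on_leD)+

lemma iterate_MVT:
  fixes c :: real
  assumes "x < y"
  obtains z where "x < z" "z < y"
    "(unicritical l c ^^ N) y - (unicritical l c ^^ N) x = (y - x) * orbit_deriv l c N z"
  using MVT2[OF assms, of "unicritical l c ^^ N" "orbit_deriv l c N"] iterate_has_derivative by metis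

text \<open>Ratios of lengths are compared through mean value points and the distortion of the
  derivative between them. The inequality is multiplied out, so that no quotient has to be
  controlled.\<close>

lemma real_koebe_lengths:
  fixes u v a b s c :: real
  assumes l: "even l" "l \<ge> 2"
    and nz: "\<And>i y. i < N \<Longrightarrow> y \<in> {u<..<v} \<Longrightarrow> (unicritical l c ^^ i) y \<noteq> 0"
    and mono: "strict_mono_on {u<..<v} (unicritical l c ^^ N)"
    and im: "{a<..<b} \<subseteq> (unicritical l c ^^ N) ` {u<..<v}"
    and s: "s > 0"
    and y: "u < y1" "y1 < y2" "y2 < v" "a + s \<le> (unicritical l c ^^ N) y1" "(unicritical l c ^^ N) y2 \<le> b - s"
    and z: "u < z1" "z1 < z2" "z2 < v" "a + s \<le> (unicritical l c ^^ N) z1" "(unicritical l c ^^ N) z2 \<le> b - s"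
  shows "(y2 - y1) * ((unicritical l c ^^ N) z2 - (unicritical l c ^^ N) z1) \<le>
    exp (koebe / s * (b - a)) * ((unicritical l c ^^ N) y2 - (unicritical l c ^^ N) y1) * (z2 - z1)"
proof -
  let ?G = "unicritical l c ^^ N"
  obtain y where yy: "y1 < y" "y < y2" "?G y2 - ?G y1 = (y2 - y1) * orbit_deriv l c N y"
    using iterate_MVT[OF y(2)] by blast
  obtain z where zz: "z1 < z" "z < z2" "?G z2 - ?G z1 = (z2 - z1) * orbit_deriv l c N z"
    using iterate_MVT[OF z(2)] by blast
  have Gy: "?G y1 \<le> ?G y" "?G y \<le> ?G y2"
    by (rule strict_mono_on_between[OF mono]; use y yy in force)+
  have Gz: "?G z1 \<le> ?G z" "?G z \<le> ?G z2"
    by (rule strict_mono_on_between[OF mono]; use z zz in force)+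
  have "?G y1 < ?G y2" by (rule strict_mono_onD[OF mono]) (use y in auto)
  then have Dy: "orbit_deriv l c N y > 0" using yy y by (metis diff_gt_0_iff_gt zero_less_mult_pos)
  have "?G z1 < ?G z2" by (rule strict_mono_onD[OF mono]) (use z in auto)
  then have Dz: "orbit_deriv l c N z > 0" using zz z by (metis diff_gt_0_iff_gt zero_less_mult_pos)
  have "\<bar>orbit_deriv l c N z\<bar> \<le> exp (koebe / s * \<bar>?G z - ?G y\<bar>) * \<bar>orbit_deriv l c N y\<bar>"
    by (rule real_koebe[OF l nz im s]) (use y z yy zz Gy Gz in auto)
  also have "\<dots> \<le> exp (koebe / s * (b - a)) * \<bar>orbit_deriv l c N y\<bar>"
  proof (intro mult_right_mono)
    have "\<bar>?G z - ?G y\<bar> \<le> b - a" using y z Gy Gz s by linarith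
    then show "exp (koebe / s * \<bar>?G z - ?G y\<bar>) \<le> exp (koebe / s * (b - a))"
      using s koebe_pos by (simp only: exp_le_cancel_iff) (intro mult_left_mono, auto)
  qed simp
  finally have le: "orbit_deriv l c N z \<le> exp (koebe / s * (b - a)) * orbit_deriv l c N y" using Dy Dz by simp
  have "(y2 - y1) * (?G z2 - ?G z1) = (y2 - y1) * (z2 - z1) * orbit_deriv l c N z" by (simp add: zz)
  also have "\<dots> \<le> (y2 - y1) * (z2 - z1) * (exp (koebe / s * (b - a)) * orbit_deriv l c N y)"
    using y z by (intro mult_left_mono le) auto
  also have "\<dots> = exp (koebe / s * (b - a)) * (?G y2 - ?G y1) * (z2 - z1)" by (simp add: yy)
  finally show ?thesis .
qed

text \<open>No critical value lies in the ball, so each branch can be lifted once more: on a simply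
  connected domain a function without zeros has holomorphic \<open>l\<close>-th roots.\<close>

lemma ball_inverse_branches:
  assumes l: "l \<ge> 1" and r: "r > 0" and P: "\<And>n. (unicritical l c ^^ Suc n) 0 \<notin> ball w r"
  shows "\<exists>F. finite F \<and> (\<forall>\<phi>\<in>F. \<phi> holomorphic_on ball w r \<and> (\<forall>x\<in>ball w r. (unicritical l c ^^ n) (\<phi> x) = x))
     \<and> disjoint_family_on (\<lambda>\<phi>. \<phi> ` ball w r) F
     \<and> (unicritical l (c::complex) ^^ n) -` ball w r = (\<Union>\<phi>\<in>F. \<phi> ` ball w r)"
proof (induction n)
  case 0
  show ?case by (intro exI[of _ "{id}"]) (auto simp: disjoint_family_on_def id_def)
next
  case (Suc n)
  let ?B = "ball w r" and ?f = "unicritical l c"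
  from Suc obtain F where F0: "finite F"
    "\<forall>\<phi>\<in>F. \<phi> holomorphic_on ?B \<and> (\<forall>x\<in>?B. (?f ^^ n) (\<phi> x) = x)"
    "disjoint_family_on (\<lambda>\<phi>. \<phi> ` ?B) F" "(?f ^^ n) -` ?B = (\<Union>\<phi>\<in>F. \<phi> ` ?B)"
    by (elim exE conjE)
  have F: "finite F" "\<And>\<phi>. \<phi> \<in> F \<Longrightarrow> \<phi> holomorphic_on ?B"
    "\<And>\<phi> x. \<phi> \<in> F \<Longrightarrow> x \<in> ?B \<Longrightarrow> (?f ^^ n) (\<phi> x) = x"
    "disjoint_family_on (\<lambda>\<phi>. \<phi> ` ?B) F" "(?f ^^ n) -` ?B = (\<Union>\<phi>\<in>F. \<phi> ` ?B)"
    using F0 by (simp_all only: Ball_def)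
  have ex: "\<exists>\<psi>. \<psi> holomorphic_on ?B \<and> (\<forall>x\<in>?B. \<psi> x \<noteq> 0 \<and> \<psi> x ^ l = \<phi> x - c)" if \<phi>: "\<phi> \<in> F" for \<phi>
  proof -
    have nz: "\<phi> x - c \<noteq> 0" if x: "x \<in> ?B" for x
    proof
      assume "\<phi> x - c = 0"
      moreover have "?f 0 = c" using l by (simp add: unicritical_def power_0_left)
      ultimately have "(?f ^^ n) (?f 0) = x" using F(3)[OF \<phi> x] by simp
      then have "(?f ^^ Suc n) 0 = x" by (simp only: unicritical_iterate_Suc)
      then show False using P x by blast
    qed
    have hd: "(\<lambda>x. \<phi> x - c) holomorphic_on ?B" using F(2)[OF \<phi>] by (intro holomorphic_intros)
    obtain g where g: "g holomorphic_on ?B" "\<And>x. x \<in> ?B \<Longrightarrow> \<phi> x - c = exp (g x)"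
      by (rule contractible_imp_holomorphic_log[OF hd convex_imp_contractible[OF convex_ball] nz]) blast+
    have "(exp (g x / l)) ^ l = exp (g x)" for x
      using l by (simp flip: exp_of_nat_mult)
    then show ?thesis using l g
      by (intro exI[of _ "\<lambda>x. exp (g x / l)"]) (auto intro!: holomorphic_intros)
  qed
  define q where "q \<phi> = (SOME \<psi>. \<psi> holomorphic_on ?B \<and> (\<forall>x\<in>?B. \<psi> x \<noteq> 0 \<and> \<psi> x ^ l = \<phi> x - c))" for \<phi>
  have q: "q \<phi> holomorphic_on ?B" "x \<in> ?B \<Longrightarrow> q \<phi> x \<noteq> 0" "x \<in> ?B \<Longrightarrow> q \<phi> x ^ l = \<phi> x - c" if "\<phi> \<in> F" for \<phi> x
    using someI_ex[OF ex[OF that]] unfolding q_def by blast+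
  define Z where "Z = {\<zeta>::complex. \<zeta> ^ l = 1}"
  \<comment> \<open>One root \<open>q \<phi>\<close> is fixed; multiplying it by the
    \<open>l\<close>-th roots of unity gives all lifts of \<open>\<phi>\<close>.\<close>
  define G where "G = (\<lambda>(\<phi>,\<zeta>). (\<lambda>x. \<zeta> * q \<phi> x)) ` (F \<times> Z)"
  have finG: "finite G" unfolding G_def Z_def using F(1) l by (intro finite_imageI finite_cartesian_product finite_nth_roots) auto
  have fG: "?f (\<zeta> * q \<phi> x) = \<phi> x" if "\<phi> \<in> F" "\<zeta> \<in> Z" "x \<in> ?B" for \<phi> \<zeta> x
    using q(3)[OF that(1,3)] that(2) by (simp add: unicritical_def Z_def power_mult_distrib)
  have 1: "g holomorphic_on ?B \<and> (\<forall>x\<in>?B. (?f ^^ Suc n) (g x) = x)" if "g \<in> G" for g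
  proof -
    from that obtain \<phi> \<zeta> where g: "\<phi> \<in> F" "\<zeta> \<in> Z" "g = (\<lambda>x. \<zeta> * q \<phi> x)" by (auto simp: G_def)
    have "(?f ^^ Suc n) (g x) = x" if "x \<in> ?B" for x
      unfolding unicritical_iterate_Suc g(3) fG[OF g(1,2) that] by (rule F(3)[OF g(1) that])
    moreover have "g holomorphic_on ?B" unfolding g(3) by (intro holomorphic_intros q(1)[OF g(1)])
    ultimately show ?thesis by blast
  qed
  have 2: "disjoint_family_on (\<lambda>\<phi>. \<phi> ` ?B) G"
    unfolding disjoint_family_on_def
  proof (intro ballI impI, rule ccontr)
    fix g h assume gh: "g \<in> G" "h \<in> G" "g \<noteq> h" "g ` ?B \<inter> h ` ?B \<noteq> {}"
    then obtain x y where xy: "x \<in> ?B" "y \<in> ?B" "g x = h y" by blast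
    obtain \<phi> \<zeta> where g: "\<phi> \<in> F" "\<zeta> \<in> Z" "g = (\<lambda>x. \<zeta> * q \<phi> x)" using gh(1) by (auto simp: G_def)
    obtain \<psi> \<xi> where h: "\<psi> \<in> F" "\<xi> \<in> Z" "h = (\<lambda>x. \<xi> * q \<psi> x)" using gh(2) by (auto simp: G_def)
    have "x = y" using 1[OF gh(1)] 1[OF gh(2)] xy by metis
    have "\<phi> x = \<psi> y" using fG[OF g(1,2) xy(1)] fG[OF h(1,2) xy(2)] xy(3) g(3) h(3) by metis
    then have "\<phi> = \<psi>" using F(4) g(1) h(1) xy unfolding disjoint_family_on_def by blast
    then have "\<zeta> = \<xi>" using xy(3) q(2)[OF g(1) xy(1)] \<open>x = y\<close> g(3) h(3) by simp
    then show False using \<open>\<phi> = \<psi>\<close> g(3) h(3) gh(3) by simp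
  qed
  have 3: "(?f ^^ Suc n) -` ?B = (\<Union>\<phi>\<in>G. \<phi> ` ?B)"
  proof
    show "(\<Union>\<phi>\<in>G. \<phi> ` ?B) \<subseteq> (?f ^^ Suc n) -` ?B" 
    proof
      fix z assume "z \<in> (\<Union>\<phi>\<in>G. \<phi> ` ?B)"
      then obtain g x where "g \<in> G" "x \<in> ?B" "z = g x" by blast
      then have "(?f ^^ Suc n) z = x" using 1 by blast
      then show "z \<in> (?f ^^ Suc n) -` ?B" using \<open>x \<in> ?B\<close> unfolding vimage_def by blast
    qed
    show "(?f ^^ Suc n) -` ?B \<subseteq> (\<Union>\<phi>\<in>G. \<phi> ` ?B)"
    proof
      fix z assume "z \<in> (?f ^^ Suc n) -` ?B"
      then have "?f z \<in> (?f ^^ n) -` ?B" by (simp add: unicritical_iterate_Suc del: funpow.simps)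
      then obtain \<phi> x where x: "\<phi> \<in> F" "x \<in> ?B" "?f z = \<phi> x" using F(5) by blast
      define \<zeta> where "\<zeta> = z / q \<phi> x"
      have "z ^ l = q \<phi> x ^ l" using x(3) q(3)[OF x(1,2)] by (metis unicritical_def add_diff_cancel_right')
      then have "\<zeta> \<in> Z" using q(2)[OF x(1,2)] by (simp add: \<zeta>_def Z_def power_divide)
      moreover have "z = \<zeta> * q \<phi> x" using q(2)[OF x(1,2)] by (simp add: \<zeta>_def)
      moreover have "(\<lambda>x. \<zeta> * q \<phi> x) \<in> G" if "\<zeta> \<in> Z" using x(1) that unfolding G_def by force
      ultimately show "z \<in> (\<Union>\<phi>\<in>G. \<phi> ` ?B)" using x(2) by blast
    qed
  qed
  show ?case by (intro exI[of _ G] conjI ballI) (use finG 1 2 3 in \<open>simp_all add: o_def\<close>)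
qed

section \<open>Conformal measures and invariant measures\<close>

text \<open>The argument is continuous off the closed negative half-axis and is set to
  \<open>pi\<close> on it, which makes it Borel and keeps the polar form correct there.\<close>

lemma measurable_root:
  assumes "l > 0"
  obtains g :: "complex \<Rightarrow> complex" where "g \<in> borel_measurable borel" "\<And>z. g z ^ l = z"
proof -
  define h :: "complex \<Rightarrow> real" where "h = (\<lambda>z. if z \<in> \<real>\<^sub>\<le>\<^sub>0 then pi else Im (Ln z))"
  define g where "g = (\<lambda>z. complex_of_real (root l (norm z)) * cis (h z / l))"
  have [measurable]: "h \<in> borel_measurable borel" unfolding h_def
    by (rule borel_measurable_continuous_on_if)
      (auto intro!: continuous_intros simp: closed_nonpos_Reals_complex)
  have l0: "real l \<noteq> 0" using assms by simp
  have "(\<lambda>z::complex. root l (norm z)) \<in> borel_measurable borel"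
    by (intro borel_measurable_continuous_onI continuous_intros)
  moreover have "(\<lambda>x. cis (x / l)) \<in> borel_measurable borel"
    using l0 by (intro borel_measurable_continuous_onI continuous_intros) auto
  then have "(\<lambda>z. cis (h z / l)) \<in> borel_measurable borel"
    by (rule measurable_compose[rotated]) measurable
  ultimately have "g \<in> borel_measurable borel" unfolding g_def by measurable
  moreover have "g z ^ l = z" for z
  proof -
    have "cis (h z / l) ^ l = cis (h z)" unfolding Complex.DeMoivre using assms by simp
    then have *: "g z ^ l = of_real (norm z) * cis (h z)"
      using assms by (simp add: g_def power_mult_distrib flip: of_real_power)
    show ?thesis
    proof (cases "z \<in> \<real>\<^sub>\<le>\<^sub>0")
      case True
      then show ?thesis using * by (auto simp: h_def elim!: nonpos_Reals_cases)
    next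
      case False
      then have "z \<noteq> 0" by auto
      then have "z = exp (Ln z)" by simp
      also have "\<dots> = of_real (norm z) * cis (Im (Ln z))"
        using \<open>z \<noteq> 0\<close> by (subst exp_eq_polar) simp
      finally show ?thesis using * False by (simp add: h_def)
    qed
  qed
  ultimately show ?thesis by (rule that)
qed

lemma continuous_unicritical_measurable [measurable]:
  "(unicritical l (c::complex) ^^ n) \<in> borel_measurable borel"
  by (intro borel_measurable_continuous_onI unicritical_iterate_continuous)

lemma orbit_deriv_measurable [measurable]:
  "orbit_deriv l (c::complex) n \<in> borel_measurable borel"
  unfolding orbit_deriv_def
  by (intro borel_measurable_continuous_onI continuous_intros unicritical_iterate_continuous)

context unicritical_map
begin

text \<open>The pieces are the images of the Borel branches of the \<open>l\<close>-th root.\<close>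

lemma injective_pieces:
  obtains \<S> where "finite \<S>" "\<Union>\<S> = UNIV" "\<S> \<subseteq> sets borel" "\<And>S. S \<in> \<S> \<Longrightarrow> inj_on f S"
    "\<And>S A. S \<in> \<S> \<Longrightarrow> A \<in> sets borel \<Longrightarrow> f ` (A \<inter> S) \<in> sets borel"
proof -
  have l0: "l > 0" using l_ge_2 by simp
  obtain g :: "complex \<Rightarrow> complex" where g[measurable]: "g \<in> borel_measurable borel" and gl: "\<And>z. g z ^ l = z"
    using measurable_root[OF l0] by blast
  define Z where "Z = {\<zeta>::complex. \<zeta> ^ l = 1}"
  define S where "S \<zeta> = {z. \<zeta> * g (z ^ l) = z}" for \<zeta>
  have finZ: "finite Z" unfolding Z_def using l0 by (rule finite_nth_roots)
  have cov: "\<exists>\<zeta>\<in>Z. z \<in> S \<zeta>" for z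
  proof (cases "z = 0")
    case True
    have "g 0 = 0" using gl[of 0] l0 by (metis power_eq_0_iff)
    then show ?thesis using True l0 by (intro bexI[of _ 1]) (auto simp: S_def Z_def power_0_left)
  next
    case False
    have "g (z ^ l) \<noteq> 0" using gl[of "z^l"] False l0 by (metis power_eq_0_iff)
    then show ?thesis using gl[of "z^l"] False
      by (intro bexI[of _ "z / g (z ^ l)"]) (auto simp: S_def Z_def power_divide)
  qed
  have Sb: "S \<zeta> \<in> sets borel" for \<zeta>
  proof -
    have "(\<lambda>z. g (z ^ l)) \<in> borel_measurable borel"
      by (rule measurable_compose[OF _ g]) measurable
    then have "{z \<in> space borel. \<zeta> * g (z ^ l) = z} \<in> sets borel" by measurable
    then show ?thesis by (simp add: S_def)
  qed
  have inj: "inj_on f (S \<zeta>)" for \<zeta>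
  proof (rule inj_onI)
    fix x y assume "x \<in> S \<zeta>" "y \<in> S \<zeta>" "f x = f y"
    then show "x = y" unfolding S_def unicritical_def by (metis (mono_tags) add_right_cancel mem_Collect_eq)
  qed
  have img: "f ` (A \<inter> S \<zeta>) \<in> sets borel" if "\<zeta> \<in> Z" "A \<in> sets borel" for \<zeta> A
  proof -
    define h where "h w = \<zeta> * g (w - c)" for w
    have [measurable]: "h \<in> borel_measurable borel"
    proof -
      have "(\<lambda>w. g (w - c)) \<in> borel_measurable borel"
        by (rule measurable_compose[OF _ g]) measurable
      then show ?thesis unfolding h_def by measurable
    qed
    have hl: "h w ^ l = w - c" for w using that(1) gl by (simp add: h_def Z_def power_mult_distrib)
    have "f ` (A \<inter> S \<zeta>) = h -` A"
    proof (intro set_eqI iffI)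
      fix w assume "w \<in> f ` (A \<inter> S \<zeta>)"
      then obtain z where z: "z \<in> A" "z \<in> S \<zeta>" "w = f z" by blast
      then have "h w = z" by (simp add: h_def S_def unicritical_def)
      then show "w \<in> h -` A" using z by simp
    next
      fix w assume w: "w \<in> h -` A"
      have "h w \<in> S \<zeta>" using hl[of w] by (simp add: S_def) (simp add: h_def)
      moreover have "f (h w) = w" using hl[of w] by (simp add: unicritical_def)
      ultimately show "w \<in> f ` (A \<inter> S \<zeta>)" using w by (metis IntI image_eqI vimage_eq)
    qed
    also have "\<dots> \<in> sets borel" using measurable_sets[of h borel borel A] that(2) by simp
    finally show ?thesis .
  qed
  show ?thesis
    by (rule that[of "S ` Z"]) (use finZ cov Sb inj img in auto)
qed

lemma image_borel: assumes "A \<in> sets borel" shows "f ` A \<in> sets borel"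
proof -
  obtain \<S> where S: "finite \<S>" "\<Union>\<S> = UNIV" "\<And>S A. S \<in> \<S> \<Longrightarrow> A \<in> sets borel \<Longrightarrow> f ` (A \<inter> S) \<in> sets borel"
    using injective_pieces by metis
  have "f ` A = (\<Union>S\<in>\<S>. f ` (A \<inter> S))" using S(2) by blast
  also have "\<dots> \<in> sets borel" using S assms by (intro sets.finite_UN) auto
  finally show ?thesis .
qed

lemma image_iterate_borel: assumes "A \<in> sets borel" shows "(f ^^ n) ` A \<in> sets borel"
proof (induction n)
  case (Suc n)
  have "(f ^^ Suc n) ` A = f ` (f ^^ n) ` A" by (simp add: image_comp)
  then show ?case using image_borel[OF Suc] by simp
qed (use assms in simp)

lemma image_iterate_open_connected:
  assumes "open U" "connected U"
  shows "open ((f ^^ n) ` U) \<and> connected ((f ^^ n) ` U)"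
proof (induction n)
  case (Suc n)
  let ?V = "(f ^^ n) ` U"
  have "open (f ` ?V)"
  proof (cases "?V = {}")
    case False
    show ?thesis
    proof (rule open_mapping_thm[of f ?V ?V])
      show "f holomorphic_on ?V" by (rule unicritical_holomorphic)
      show "\<not> f constant_on ?V" by (rule f_not_constant[OF _ False]) (use Suc in blast)
    qed (use Suc in simp_all)
  qed simp
  moreover have "connected (f ` ?V)"
    by (rule connected_continuous_image[OF unicritical_continuous]) (use Suc in blast)
  moreover have "(f ^^ Suc n) ` U = f ` ?V" by (simp add: image_comp)
  ultimately show ?case by simp
qed (use assms in simp)

end

text \<open>Otherwise there are sets of \<open>m\<close>-measure below \<open>(1/2) ^ n\<close> and
  of \<open>\<mu>\<close>-measure at least \<open>e\<close>. By Borel-Cantelli their upper limit is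
  \<open>m\<close>-null, but \<open>\<mu>\<close> gives it at least \<open>e\<close>.\<close>

lemma absolutely_continuous_uniform:
  assumes "finite_measure m" "finite_measure \<mu>" "sets \<mu> = sets m" "absolutely_continuous m \<mu>" "e > 0"
  shows "\<exists>d>0. \<forall>A\<in>sets m. measure m A < d \<longrightarrow> measure \<mu> A < e"
proof (rule ccontr)
  assume neg: "\<not> ?thesis"
  interpret m: finite_measure m by fact
  interpret mu: finite_measure \<mu> by fact
  have "\<exists>A\<in>sets m. measure m A < (1/2) ^ n \<and> measure \<mu> A \<ge> e" for n :: nat
    using neg by (metis not_le zero_less_divide_1_iff zero_less_numeral zero_less_power)
  then obtain A where A: "\<And>n. A n \<in> sets m" "\<And>n::nat. measure m (A n) < (1/2) ^ n" "\<And>n. measure \<mu> (A n) \<ge> e"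
    by metis
  have "summable (\<lambda>n. measure m (A n))"
  proof (rule summable_comparison_test')
    show "summable (\<lambda>n. (1/2::real) ^ n)" by (rule summable_geometric) simp
    show "norm (measure m (A n)) \<le> (1/2) ^ n" for n using A(2)[of n] by (simp add: less_imp_le)
  qed
  then have "limsup A \<in> null_sets m"
    by (intro borel_cantelli_limsup1) (auto simp: A m.emeasure_eq_measure)
  then have nul: "limsup A \<in> null_sets \<mu>" using assms(4) by (auto simp: absolutely_continuous_def)
  define B where "B n = (\<Union>k\<in>{n..}. A k)" for n
  have Bs: "range B \<subseteq> sets \<mu>" unfolding B_def using A(1) assms(3) by auto
  have dec: "decseq B" unfolding B_def by (intro antimonoI UN_mono) auto
  have "(\<lambda>n. measure \<mu> (B n)) \<longlonglongrightarrow> measure \<mu> (\<Inter>n. B n)"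
    by (rule mu.finite_Lim_measure_decseq[OF Bs dec])
  moreover have "(\<Inter>n. B n) = limsup A" unfolding B_def limsup_INF_SUP by simp
  moreover have "measure \<mu> (limsup A) = 0" using nul by (simp add: null_sets_def measure_def)
  moreover have "measure \<mu> (B n) \<ge> e" for n
  proof -
    have "measure \<mu> (A n) \<le> measure \<mu> (B n)"
      by (rule mu.finite_measure_mono) (use Bs in \<open>auto simp: B_def\<close>)
    then show ?thesis using A(3)[of n] by linarith
  qed
  ultimately show False using LIMSEQ_le_const[of "\<lambda>n. measure \<mu> (B n)" 0 e] assms(5) by auto
qed

section \<open>Conformal measures along iterates\<close>

locale conformal = unicritical_map +
  fixes \<delta> :: real and m :: "complex measure"
  assumes delta_pos: "\<delta> > 0" and conf: "conformal_measure f \<delta> m" and c_nonzero: "c \<noteq> 0"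
begin

sublocale prob_space m using conf by (simp add: conformal_measure_def)

lemma sets_m [measurable_cong, simp]: "sets m = sets borel" using conf by (simp add: conformal_measure_def)
lemma space_m [simp]: "space m = UNIV" using sets_eq_imp_space_eq[OF sets_m] by simp

lemma deriv_f: "deriv f z = orbit_deriv l c 1 z"
  using deriv_iterate[where n=1] by simp

lemma conformal_inj:
  assumes "A \<in> sets borel" "inj_on f A"
  shows "emeasure m (f ` A) = (\<integral>\<^sup>+z\<in>A. ennreal (norm (orbit_deriv l c 1 z) powr \<delta>) \<partial>m)"
  using conf assms by (simp add: conformal_measure_def deriv_f)

text \<open>Conformality speaks of sets. It says that pushing the weighted restriction to
  \<open>A\<close> forward gives the restriction to the image of \<open>A\<close>, and equal
  measures have equal integrals.\<close>

lemma conformal_change_of_variables: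
  assumes A: "A \<in> sets borel" and inj: "inj_on f A" and u[measurable]: "u \<in> borel_measurable borel"
  shows "(\<integral>\<^sup>+w\<in>f ` A. u w \<partial>m) = (\<integral>\<^sup>+z\<in>A. u (f z) * ennreal (norm (orbit_deriv l c 1 z) powr \<delta>) \<partial>m)"
proof -
  let ?d = "\<lambda>z. ennreal (norm (orbit_deriv l c 1 z) powr \<delta>)"
  have [measurable]: "A \<in> sets m" "f ` A \<in> sets m" using A image_borel[OF A] by simp_all
  have [measurable]: "f \<in> measurable m borel" using continuous_unicritical_measurable[where n=1] by simp
  have "distr (density m (\<lambda>z. ?d z * indicator A z)) borel f = density m (indicator (f ` A))" (is "?L = ?R")
  proof (rule measure_eqI)
    fix E assume "E \<in> sets ?L"
    then have E[measurable]: "E \<in> sets borel" by simp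
    have "emeasure ?L E = emeasure (density m (\<lambda>z. ?d z * indicator A z)) (f -` E \<inter> UNIV)"
      by (subst emeasure_distr) auto
    also have "\<dots> = (\<integral>\<^sup>+z. ?d z * indicator A z * indicator (f -` E) z \<partial>m)"
      by (subst emeasure_density) (use measurable_sets[of f m borel E] in auto)
    also have "\<dots> = (\<integral>\<^sup>+z\<in>A \<inter> f -` E. ?d z \<partial>m)"
      by (intro nn_integral_cong) (auto split: split_indicator)
    also have "\<dots> = emeasure m (f ` (A \<inter> f -` E))"
      by (rule conformal_inj[symmetric])
        (use A measurable_sets[of f m borel E] inj in \<open>auto intro: inj_on_subset\<close>)
    also have "f ` (A \<inter> f -` E) = f ` A \<inter> E" by auto
    also have "emeasure m (f ` A \<inter> E) = emeasure ?R E"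
    proof -
      have [measurable]: "E \<in> sets m" by simp
      show ?thesis by (subst emeasure_density) (auto simp flip: indicator_inter_arith)
    qed
    finally show "emeasure ?L E = emeasure ?R E" .
  qed simp
  then have "(\<integral>\<^sup>+w. u w \<partial>?L) = (\<integral>\<^sup>+w. u w \<partial>?R)" by simp
  moreover have "(\<integral>\<^sup>+w. u w \<partial>?L) = (\<integral>\<^sup>+z\<in>A. u (f z) * ?d z \<partial>m)"
    by (subst nn_integral_distr, simp, simp, subst nn_integral_density)
      (auto intro!: nn_integral_cong split: split_indicator simp: mult_ac)
  moreover have "(\<integral>\<^sup>+w. u w \<partial>?R) = (\<integral>\<^sup>+w\<in>f ` A. u w \<partial>m)"
    by (subst nn_integral_density) (auto intro!: nn_integral_cong simp: mult_ac)
  ultimately show ?thesis by simp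
qed

lemma conformal_iterate:
  assumes "A \<in> sets borel" "inj_on (f ^^ n) A"
  shows "emeasure m ((f ^^ n) ` A) = (\<integral>\<^sup>+z\<in>A. ennreal (norm (orbit_deriv l c n z) powr \<delta>) \<partial>m)"
  using assms
proof (induction n arbitrary: A)
  case 0
  then show ?case by (simp add: orbit_deriv_def)
next
  case (Suc n)
  have eq: "(f ^^ Suc n) = (f ^^ n) \<circ> f" by (rule funpow_Suc_right)
  have inj: "inj_on f A" "inj_on (f ^^ n) (f ` A)"
    using Suc.prems(2) unfolding eq by (auto dest: inj_on_imageI inj_on_imageI2 simp: comp_inj_on_iff inj_on_def)
  have "emeasure m ((f ^^ Suc n) ` A) = emeasure m ((f ^^ n) ` f ` A)" by (simp add: eq image_comp del: funpow.simps)
  also have "\<dots> = (\<integral>\<^sup>+z\<in>f ` A. ennreal (norm (orbit_deriv l c n z) powr \<delta>) \<partial>m)"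
    by (rule Suc.IH[OF image_borel[OF Suc.prems(1)] inj(2)])
  also have "\<dots> = (\<integral>\<^sup>+z\<in>A. ennreal (norm (orbit_deriv l c n (f z)) powr \<delta>) * ennreal (norm (orbit_deriv l c 1 z) powr \<delta>) \<partial>m)"
    by (rule conformal_change_of_variables[OF Suc.prems(1) inj(1)]) measurable
  also have "\<dots> = (\<integral>\<^sup>+z\<in>A. ennreal (norm (orbit_deriv l c (Suc n) z) powr \<delta>) \<partial>m)"
  proof (intro nn_integral_cong arg_cong2[where f="(*)"] refl)
    fix z
    have "orbit_deriv l c (Suc n) z = orbit_deriv l c 1 z * orbit_deriv l c n (f z)"
      unfolding orbit_deriv_def prod.lessThan_Suc_shift
      by (simp add: unicritical_iterate_Suc del: funpow.simps)
    then show "ennreal (norm (orbit_deriv l c n (f z)) powr \<delta>) * ennreal (norm (orbit_deriv l c 1 z) powr \<delta>)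
       = ennreal (norm (orbit_deriv l c (Suc n) z) powr \<delta>)"
      by (simp add: norm_mult powr_mult ennreal_mult mult.commute)
  qed
  finally show ?case .
qed

lemma measure_iterate_le:
  assumes A: "A \<in> sets borel" "inj_on (f ^^ n) A" and M: "\<And>z. z \<in> A \<Longrightarrow> norm (orbit_deriv l c n z) \<le> M" "M \<ge> 0"
  shows "measure m ((f ^^ n) ` A) \<le> M powr \<delta> * measure m A"
proof -
  have "emeasure m ((f ^^ n) ` A) \<le> (\<integral>\<^sup>+z. ennreal (M powr \<delta>) * indicator A z \<partial>m)"
    unfolding conformal_iterate[OF A]
    using M delta_pos by (intro nn_integral_mono) (auto split: split_indicator intro!: ennreal_leI powr_mono2)
  also have "\<dots> = ennreal (M powr \<delta>) * emeasure m A" using A by (subst nn_integral_cmult_indicator) auto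
  finally have "emeasure m ((f ^^ n) ` A) \<le> ennreal (M powr \<delta> * measure m A)"
    by (simp add: emeasure_eq_measure ennreal_mult)
  then show ?thesis by (simp add: emeasure_eq_measure)
qed

lemma measure_iterate_ge:
  assumes A: "A \<in> sets borel" "inj_on (f ^^ n) A" and M: "\<And>z. z \<in> A \<Longrightarrow> norm (orbit_deriv l c n z) \<ge> M" "M \<ge> 0"
  shows "measure m ((f ^^ n) ` A) \<ge> M powr \<delta> * measure m A"
proof -
  have "ennreal (M powr \<delta>) * emeasure m A = (\<integral>\<^sup>+z. ennreal (M powr \<delta>) * indicator A z \<partial>m)"
    using A by (subst nn_integral_cmult_indicator) auto
  also have "\<dots> \<le> emeasure m ((f ^^ n) ` A)"
    unfolding conformal_iterate[OF A]
    using M delta_pos by (intro nn_integral_mono) (auto split: split_indicator intro!: ennreal_leI powr_mono2)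
  finally have "ennreal (M powr \<delta> * measure m A) \<le> emeasure m ((f ^^ n) ` A)"
    by (simp add: emeasure_eq_measure ennreal_mult)
  then show ?thesis by (simp add: emeasure_eq_measure)
qed

lemma measure_outside_julia: assumes "A \<in> sets borel" "A \<inter> julia_set f = {}" shows "measure m A = 0"
proof -
  have J: "julia_set f \<in> sets m" using julia_closed by simp
  have "measure m (julia_set f) = 1" using conf by (simp add: conformal_measure_def measure_def)
  moreover have "measure m (A \<union> julia_set f) = measure m A + measure m (julia_set f)"
    using assms J by (intro finite_measure_Union) auto
  moreover have "measure m (A \<union> julia_set f) \<le> 1" by (rule prob_le_1)
  ultimately show ?thesis using measure_nonneg[of m A] by linarith
qed

text \<open>The derivative is bounded only on \<open>K\<close>, but what lies off \<open>K\<close>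
  is sent off the Julia set, where there is no mass. On \<open>K\<close> the finitely many injective
  pieces each contribute the bound for the derivative.\<close>

lemma image_measure_bound:
  obtains C where "C > 0" "\<And>A. A \<in> sets borel \<Longrightarrow> measure m (f ` A) \<le> C * measure m A"
proof -
  obtain \<S> where S: "finite \<S>" "\<Union>\<S> = UNIV" "\<S> \<subseteq> sets borel" "\<And>S. S \<in> \<S> \<Longrightarrow> inj_on f S"
    "\<And>S A. S \<in> \<S> \<Longrightarrow> A \<in> sets borel \<Longrightarrow> f ` (A \<inter> S) \<in> sets borel"
    using injective_pieces by metis
  define L where "L = l * R ^ (l - 1)"
  have L0: "L \<ge> 0" using R_pos by (simp add: L_def)
  define C where "C = card \<S> * L powr \<delta> + 1"
  have "measure m (f ` A) \<le> C * measure m A" if A: "A \<in> sets borel" for A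
  proof -
    let ?A = "A \<inter> K"
    have KB: "K \<in> sets borel" using filled_closed by simp
    have KA: "?A \<in> sets borel" using A KB by simp
    have "f ` A = f ` ?A \<union> f ` (A - K)" by blast
    moreover have "measure m (f ` (A - K)) = 0"
    proof (rule measure_outside_julia)
      show "f ` (A - K) \<in> sets borel" using A KB by (intro image_borel) simp
      show "f ` (A - K) \<inter> julia_set f = {}" using julia_subset f_in_filled_iff by blast
    qed
    ultimately have "measure m (f ` A) \<le> measure m (f ` ?A)"
      using measure_Un_le[of "f ` ?A" m "f ` (A - K)"] image_borel[OF KA] image_borel[of "A - K"] A KB by auto
    also have "f ` ?A = (\<Union>S\<in>\<S>. f ` (?A \<inter> S))" using S(2) by blast
    also have "measure m \<dots> \<le> (\<Sum>S\<in>\<S>. measure m (f ` (?A \<inter> S)))"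
      using S(1,5) KA by (intro measure_UNION_le) auto
    also have "\<dots> \<le> (\<Sum>S\<in>\<S>. L powr \<delta> * measure m A)"
    proof (rule sum_mono)
      fix S assume SS: "S \<in> \<S>"
      have "measure m ((f ^^ 1) ` (?A \<inter> S)) \<le> L powr \<delta> * measure m (?A \<inter> S)"
      proof (rule measure_iterate_le)
        show "norm (orbit_deriv l c 1 z) \<le> L" if "z \<in> ?A \<inter> S" for z
          using that filled_subset_ball unfolding L_def
          by (auto simp: orbit_deriv_def norm_mult norm_power intro!: mult_left_mono power_mono)
      qed (use SS S KA L0 in \<open>auto intro: inj_on_subset\<close>)
      also have "\<dots> \<le> L powr \<delta> * measure m A"
        using A by (intro mult_left_mono finite_measure_mono) auto
      finally show "measure m (f ` (?A \<inter> S)) \<le> L powr \<delta> * measure m A" by simp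
    qed
    also have "\<dots> = card \<S> * L powr \<delta> * measure m A" by simp
    also have "\<dots> \<le> C * measure m A" unfolding C_def by (intro mult_right_mono) auto
    finally show ?thesis .
  qed
  moreover have "C > 0" unfolding C_def by (intro add_nonneg_pos) auto
  ultimately show ?thesis using that by blast
qed

lemma image_iterate_measure_bound:
  obtains C where "C > 0" "\<And>A. A \<in> sets borel \<Longrightarrow> measure m ((f ^^ n) ` A) \<le> C * measure m A"
proof -
  obtain C where C: "C > 0" "\<And>A. A \<in> sets borel \<Longrightarrow> measure m (f ` A) \<le> C * measure m A"
    using image_measure_bound by blast
  have "measure m ((f ^^ n) ` A) \<le> C ^ n * measure m A" if A: "A \<in> sets borel" for A
  proof (induction n)
    case (Suc n)
    have "measure m ((f ^^ Suc n) ` A) = measure m (f ` (f ^^ n) ` A)" by (simp add: image_comp)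
    also have "\<dots> \<le> C * measure m ((f ^^ n) ` A)" by (rule C(2)[OF image_iterate_borel[OF A]])
    also have "\<dots> \<le> C * (C ^ n * measure m A)" using Suc C(1) by (intro mult_left_mono) auto
    finally show ?case by simp
  qed simp
  then show ?thesis using that[of "C ^ n"] C(1) by simp
qed

text \<open>If the ball were null, so would be all its images, and by blow-up these cover the
  plane.\<close>

lemma measure_ball_pos:
  assumes "z \<in> julia_set f" "r > 0" shows "measure m (ball z r) > 0"
proof (rule ccontr)
  assume "\<not> ?thesis"
  then have z: "measure m (ball z r) = 0" using measure_nonneg[of m "ball z r"] by linarith
  have "(f ^^ n) ` ball z r \<in> null_sets m" for n
  proof -
    obtain C where "measure m ((f ^^ n) ` ball z r) \<le> C * measure m (ball z r)"
      using image_iterate_measure_bound[of n] by (metis borel_open open_ball)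
    then have "measure m ((f ^^ n) ` ball z r) = 0" using z measure_nonneg[of m "(f ^^ n) ` ball z r"] by simp
    then show ?thesis using image_iterate_borel[of "ball z r" n] by (simp add: null_sets_def emeasure_eq_measure)
  qed
  then have "(\<Union>n. (f ^^ n) ` ball z r) \<in> null_sets m" by (rule null_sets_UN)
  moreover have "(\<Union>n. (f ^^ n) ` ball z r) = UNIV" using julia_blowup[OF assms c_nonzero] by blast
  ultimately have "emeasure m (space m) = 0" by (simp add: null_sets_def)
  then show False using emeasure_space_1 by simp
qed

text \<open>Bounded distortion turns a lower bound for the measure of the preimages of a ball off the
  postcritical set into one for the preimages of each of its Borel subsets.\<close>

lemma preimage_measure_lower_bound:
  assumes r: "r > 0" and P: "\<And>n. (f ^^ Suc n) 0 \<notin> ball w (2 * r)"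
    and W: "W \<in> sets borel" "W \<subseteq> ball w r"
  shows "measure m ((f ^^ n) -` W) \<ge> (1 / exp (2 * koebe) powr \<delta>) ^ 2 * measure m W * measure m ((f ^^ n) -` ball w r)"
proof -
  define k where "k = exp (2 * koebe)"
  have k: "k > 0" by (simp add: k_def)
  let ?B = "ball w r" and ?D = "ball w (2 * r)"
  have "\<exists>F. finite F \<and> (\<forall>\<phi>\<in>F. \<phi> holomorphic_on ?D \<and> (\<forall>x\<in>?D. (f ^^ n) (\<phi> x) = x))
     \<and> disjoint_family_on (\<lambda>\<phi>. \<phi> ` ?D) F \<and> (f ^^ n) -` ?D = (\<Union>\<phi>\<in>F. \<phi> ` ?D)"
    by (rule ball_inverse_branches) (use l_ge_2 r P in simp_all)
  then obtain F where F0: "finite F"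
    "\<forall>\<phi>\<in>F. \<phi> holomorphic_on ?D \<and> (\<forall>x\<in>?D. (f ^^ n) (\<phi> x) = x)"
    "disjoint_family_on (\<lambda>\<phi>. \<phi> ` ?D) F" "(f ^^ n) -` ?D = (\<Union>\<phi>\<in>F. \<phi> ` ?D)"
    by (elim exE conjE)
  have hol: "\<phi> holomorphic_on ?D" and inv: "x \<in> ?D \<Longrightarrow> (f ^^ n) (\<phi> x) = x" if "\<phi> \<in> F" for \<phi> x
    using F0(2) that by blast+
  have BD: "?B \<subseteq> ?D" using r by (intro subset_ball) simp
  have pre: "(f ^^ n) -` V = (\<Union>\<phi>\<in>F. \<phi> ` V)" if V: "V \<subseteq> ?D" for V
  proof
    show "(\<Union>\<phi>\<in>F. \<phi> ` V) \<subseteq> (f ^^ n) -` V"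
    proof
      fix z assume "z \<in> (\<Union>\<phi>\<in>F. \<phi> ` V)"
      then obtain \<phi> x where x: "\<phi> \<in> F" "x \<in> V" "z = \<phi> x" by blast
      then have "(f ^^ n) z = x" using inv[OF x(1)] V by blast
      then show "z \<in> (f ^^ n) -` V" using x(2) by simp
    qed
    show "(f ^^ n) -` V \<subseteq> (\<Union>\<phi>\<in>F. \<phi> ` V)"
    proof
      fix z assume z: "z \<in> (f ^^ n) -` V"
      then have "z \<in> (f ^^ n) -` ?D" using V by (simp only: vimage_def mem_Collect_eq subsetD)
      then have "z \<in> (\<Union>\<phi>\<in>F. \<phi> ` ?D)" by (simp only: F0(4))
      then obtain \<phi> x where x: "\<phi> \<in> F" "x \<in> ?D" "z = \<phi> x" by blast
      then show "z \<in> (\<Union>\<phi>\<in>F. \<phi> ` V)" using z inv[OF x(1,2)] by auto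
    qed
  qed
  have inj: "inj_on \<phi> ?D" if "\<phi> \<in> F" for \<phi> using inv[OF that] by (metis inj_onI)
  have bor: "\<phi> ` V \<in> sets borel" if "\<phi> \<in> F" "V \<subseteq> ?D" "V \<in> sets borel" for \<phi> V
  proof -
    have "\<phi> ` V = (f ^^ n) -` V \<inter> \<phi> ` ?D"
    proof (intro set_eqI iffI)
      fix z assume "z \<in> \<phi> ` V"
      then obtain x where x: "x \<in> V" "z = \<phi> x" by blast
      then show "z \<in> (f ^^ n) -` V \<inter> \<phi> ` ?D" using inv[OF that(1), of x] that(2) by auto
    next
      fix z assume "z \<in> (f ^^ n) -` V \<inter> \<phi> ` ?D"
      then obtain x where x: "x \<in> ?D" "z = \<phi> x" "(f ^^ n) z \<in> V" by blast
      then show "z \<in> \<phi> ` V" using inv[OF that(1), of x] by auto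
    qed
    moreover have "open (\<phi> ` ?D)" by (rule open_mapping_thm3[OF hol[OF that(1)] open_ball inj[OF that(1)]])
    moreover have "(f ^^ n) -` V \<in> sets borel"
      using measurable_sets[OF continuous_unicritical_measurable that(3)] by simp
    ultimately show ?thesis by simp
  qed
  have main: "measure m (\<phi> ` W) \<ge> (1 / k powr \<delta>) ^ 2 * measure m W * measure m (\<phi> ` ?B)" if \<phi>: "\<phi> \<in> F" for \<phi>
  proof -
    define q where "q = norm (deriv \<phi> w)"
    have D1: "norm (orbit_deriv l c n (\<phi> x)) * norm (deriv \<phi> x) = 1" if "x \<in> ?D" for x
      using inverse_branch_deriv[OF hol[OF \<phi>] open_ball inv[OF \<phi>] that] by (metis norm_mult norm_one)
    have wB: "w \<in> ?B" using r by simp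
    have q: "q > 0" using D1[of w] r by (auto simp: q_def)
    have dist: "norm (deriv \<phi> x) \<le> k * norm (deriv \<phi> y)" if xy: "x \<in> ?B" "y \<in> ?B" for x y
    proof -
      have "norm (deriv \<phi> x) \<le> exp (koebe / r * norm (x - y)) * norm (deriv \<phi> y)"
      proof (rule univalent_distortion[OF hol[OF \<phi>] open_ball convex_ball inj[OF \<phi>] convex_ball[of w r] r])
        show "ball z r \<subseteq> ?D" if "z \<in> ?B" for z
        proof
          fix v assume "v \<in> ball z r"
          then have "dist w v < r + r" using that dist_triangle[of w v z] by simp
          then show "v \<in> ?D" by simp
        qed
      qed (use xy in auto)
      also have "koebe / r * norm (x - y) \<le> koebe / r * (2 * r)"
      proof (rule mult_left_mono)
        have "dist x y < r + r" using xy dist_triangle2[of x y w] by (simp add: dist_commute)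
        then show "norm (x - y) \<le> 2 * r" by (simp add: dist_norm)
      qed (use koebe_pos r in simp)
      then have "exp (koebe / r * norm (x - y)) * norm (deriv \<phi> y) \<le> k * norm (deriv \<phi> y)"
        using r by (intro mult_right_mono) (auto simp: k_def)
      finally show ?thesis .
    qed
    have injn: "inj_on (f ^^ n) (\<phi> ` V)" if "V \<subseteq> ?D" for V
    proof (rule inj_onI)
      fix x y assume "x \<in> \<phi> ` V" "y \<in> \<phi> ` V" and eq: "(f ^^ n) x = (f ^^ n) y"
      then obtain a b where "a \<in> V" "x = \<phi> a" "b \<in> V" "y = \<phi> b" by blast
      moreover have "a \<in> ?D" "b \<in> ?D" using calculation that by blast+
      ultimately show "x = y" using eq inv[OF \<phi>, of a] inv[OF \<phi>, of b] by simp
    qed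
    have fwd: "(f ^^ n) ` \<phi> ` V = V" if "V \<subseteq> ?D" for V
    proof -
      have "(f ^^ n) (\<phi> x) = x" if "x \<in> V" for x using inv[OF \<phi>] that \<open>V \<subseteq> ?D\<close> by blast
      then show ?thesis unfolding image_image by simp
    qed
    have up: "norm (orbit_deriv l c n z) \<le> k / q" if "z \<in> \<phi> ` W" for z
    proof -
      obtain x where "x \<in> W" "z = \<phi> x" using \<open>z \<in> \<phi> ` W\<close> by blast
      then have x: "x \<in> ?B" "z = \<phi> x" using W by blast+
      have "q * norm (orbit_deriv l c n z) \<le> k * (norm (deriv \<phi> x) * norm (orbit_deriv l c n z))"
        using mult_right_mono[OF dist[OF wB x(1)] norm_ge_zero[of "orbit_deriv l c n z"]] by (simp add: q_def mult.assoc)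
      also have "\<dots> = k" using D1[of x] x BD by (simp add: mult.commute subset_iff)
      finally show ?thesis using q by (simp add: field_simps)
    qed
    have lo: "norm (orbit_deriv l c n z) \<ge> 1 / (k * q)" if "z \<in> \<phi> ` ?B" for z
    proof -
      obtain x where x: "x \<in> ?B" "z = \<phi> x" using \<open>z \<in> \<phi> ` ?B\<close> by blast
      have "1 = norm (deriv \<phi> x) * norm (orbit_deriv l c n z)" using D1[of x] x BD by (simp add: mult.commute subset_iff)
      also have "\<dots> \<le> k * q * norm (orbit_deriv l c n z)"
        using mult_right_mono[OF dist[OF x(1) wB] norm_ge_zero[of "orbit_deriv l c n z"]] by (simp add: q_def)
      finally show ?thesis using q k by (simp add: field_simps)
    qed
    have WD: "W \<subseteq> ?D" using W BD by blast
    have "measure m ((f ^^ n) ` \<phi> ` W) \<le> (k / q) powr \<delta> * measure m (\<phi> ` W)"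
      by (rule measure_iterate_le[OF bor[OF \<phi> WD W(1)] injn[OF WD] up]) (use k q in auto)
    then have a: "measure m W \<le> (k / q) powr \<delta> * measure m (\<phi> ` W)" by (simp add: fwd[OF WD])
    have "measure m ((f ^^ n) ` \<phi> ` ?B) \<ge> (1 / (k * q)) powr \<delta> * measure m (\<phi> ` ?B)"
      by (rule measure_iterate_ge[OF bor[OF \<phi> BD] injn[OF BD] lo]) (use k q in auto)
    \<comment> \<open>The factor for the branch size \<open>q\<close> cancels between this estimate
      and the preceding one. Here the image of the ball enters only through its mass, which is at
      most 1.\<close>
    then have b: "(1 / (k * q)) powr \<delta> * measure m (\<phi> ` ?B) \<le> 1"
      using prob_le_1[of ?B] by (simp add: fwd[OF BD] order_trans)
    have "measure m W * measure m (\<phi> ` ?B) \<le> ((k / q) powr \<delta> * measure m (\<phi> ` W)) * ((k * q) powr \<delta>)"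
    proof (rule mult_mono[OF a])
      show "measure m (\<phi> ` ?B) \<le> (k * q) powr \<delta>"
        using b k q by (simp add: powr_divide field_simps)
    qed auto
    also have "\<dots> = (k powr \<delta>) ^ 2 * measure m (\<phi> ` W)"
      using k q by (simp add: powr_divide powr_mult power2_eq_square field_simps)
    finally show ?thesis using k by (simp add: power_divide field_simps)
  qed
  have sumW: "measure m ((f ^^ n) -` V) = (\<Sum>\<phi>\<in>F. measure m (\<phi> ` V))" if V: "V \<subseteq> ?D" "V \<in> sets borel" for V
  proof -
    have "disjoint_family_on (\<lambda>\<phi>. \<phi> ` V) F" using F0(3) V(1) unfolding disjoint_family_on_def by blast
    then show ?thesis unfolding pre[OF V(1)] using F0(1) bor V
      by (intro finite_measure_finite_Union) auto
  qed
  have "(1 / k powr \<delta>) ^ 2 * measure m W * measure m ((f ^^ n) -` ?B) = (\<Sum>\<phi>\<in>F. (1 / k powr \<delta>) ^ 2 * measure m W * measure m (\<phi> ` ?B))"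
    by (simp add: sumW[OF BD] sum_distrib_left)
  also have "\<dots> \<le> (\<Sum>\<phi>\<in>F. measure m (\<phi> ` W))" by (intro sum_mono main)
  also have "\<dots> = measure m ((f ^^ n) -` W)" using W BD by (intro sumW[symmetric]) auto
  finally show ?thesis by (simp add: k_def)
qed

text \<open>The sets \<open>W\<close> follow the postcritical set for the time \<open>T\<close>; hence pieces \<open>W'\<close> of a ball off
  the postcritical set that are sent into \<open>W\<close> do not return to the ball for a long time. Their
  preimages of suitable orders are then disjoint and all of comparable measure.\<close>

lemma acip_null_off_postcritical:
  assumes acip: "acip f m \<mu>" and r: "r > 0" and P: "\<And>n. (f ^^ n) 0 \<in> P" "ball w (2 * r) \<inter> P = {}"
    and gates: "\<And>\<epsilon> M. \<epsilon> > 0 \<Longrightarrow> \<exists>W T. W \<in> sets borel \<and> W \<subseteq> ball 0 \<epsilon> \<and>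
       (\<forall>z\<in>W. \<forall>i\<le>T. \<exists>p\<in>P. dist ((f ^^ i) z) p < \<epsilon>) \<and> real T * measure m W \<ge> M"
  shows "measure \<mu> (ball w r) = 0"
proof (rule ccontr)
  assume "measure \<mu> (ball w r) \<noteq> 0"
  then have pos: "measure \<mu> (ball w r) > 0" using measure_nonneg[of \<mu> "ball w r"] by linarith
  let ?B = "ball w r"
  interpret mu: prob_space \<mu> using acip by (simp add: acip_def)
  have sets_mu [simp]: "sets \<mu> = sets borel" using acip by (simp add: acip_def invariant_measure_def)
  have dis: "distr \<mu> borel f = \<mu>" using acip by (simp add: acip_def invariant_measure_def)
  have ac: "absolutely_continuous m \<mu>" using acip by (simp add: acip_def)
  have [simp]: "space \<mu> = UNIV" using sets_eq_imp_space_eq[OF sets_mu] by simp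
  have fm: "f \<in> measurable \<mu> borel"
    using continuous_unicritical_measurable[where n=1] by (simp add: measurable_def)
  have fn: "(f ^^ n) -` A \<in> sets borel" if "A \<in> sets borel" for n A
    using measurable_sets[OF continuous_unicritical_measurable that] by simp
  have inv: "measure \<mu> ((f ^^ n) -` A) = measure \<mu> A" if A: "A \<in> sets borel" for n A
  proof (induction n)
    case (Suc n)
    have "measure \<mu> ((f ^^ n) -` A) = measure (distr \<mu> borel f) ((f ^^ n) -` A)" by (simp add: dis)
    also have "\<dots> = measure \<mu> (f -` (f ^^ n) -` A)" by (subst measure_distr[OF fm fn[OF A]]) simp
    also have "f -` (f ^^ n) -` A = (f ^^ Suc n) -` A" by (simp add: vimage_comp flip: funpow_Suc_right)
    finally show ?case using Suc by (simp only:)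
  qed simp
  obtain d where d: "d > 0" "\<And>A. A \<in> sets m \<Longrightarrow> measure m A < d \<Longrightarrow> measure \<mu> A < measure \<mu> ?B"
    using absolutely_continuous_uniform[OF finite_measure_axioms mu.finite_measure_axioms _ ac pos] by auto
  \<comment> \<open>Invariance gives all preimages of the ball the same positive
    \<open>\<mu>\<close>-measure, and uniform absolute continuity turns this into one lower bound
    \<open>d\<close> for their conformal measures.\<close>
  have eta: "measure m ((f ^^ n) -` ?B) \<ge> d" for n
  proof (rule ccontr)
    assume "\<not> ?thesis"
    then have "measure \<mu> ((f ^^ n) -` ?B) < measure \<mu> ?B" using fn[of ?B n] by (intro d(2)) auto
    then show False using inv[of ?B n] by simp
  qed
  have "?B \<inter> julia_set f \<noteq> {}"
  proof
    assume "?B \<inter> julia_set f = {}"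
    then have "measure m ?B = 0" by (intro measure_outside_julia) auto
    then show False using eta[of 0] d(1) by simp
  qed
  then obtain z0 where z0: "z0 \<in> ?B" "z0 \<in> julia_set f" by blast
  obtain e where e: "e > 0" "ball z0 e \<subseteq> ?B" using z0(1) by (meson open_ball open_contains_ball)
  \<comment> \<open>The ball meets the Julia set, so a fixed number \<open>j\<close> of iterates
    carries it over a neighbourhood of \<open>0\<close>. The small sets \<open>W\<close> can
    therefore be pulled back into the ball.\<close>
  obtain j where "0 \<in> (f ^^ j) ` ball z0 e" using julia_blowup[OF z0(2) e(1) c_nonzero] by blast
  then have "0 \<in> (f ^^ j) ` ?B" using e(2) by blast
  moreover have "open ((f ^^ j) ` ?B)" using image_iterate_open_connected[of ?B j] by simp
  ultimately obtain e1 where e1: "e1 > 0" "ball 0 e1 \<subseteq> (f ^^ j) ` ?B" by (meson open_contains_ball)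
  obtain C where C: "C > 0" "\<And>A. A \<in> sets borel \<Longrightarrow> measure m ((f ^^ j) ` A) \<le> C * measure m A"
    using image_iterate_measure_bound[of j] by blast
  define h where "h = (1 / exp (2 * koebe) powr \<delta>) ^ 2"
  have h: "h > 0" by (simp add: h_def)
  \<comment> \<open>This exceeds by 1 the bound for \<open>T\<close> times the measure of
    \<open>W\<close> which the count of disjoint preimages gives at the end.\<close>
  define M where "M = (Suc j) * C / (h * d) + 1"
  obtain W T where W: "W \<in> sets borel" "W \<subseteq> ball 0 (min e1 r)"
    "\<And>z i. z \<in> W \<Longrightarrow> i \<le> T \<Longrightarrow> \<exists>p\<in>P. dist ((f ^^ i) z) p < min e1 r" "real T * measure m W \<ge> M"
    using gates[of "min e1 r" M] e1(1) r by (metis min_less_iff_conj)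
  define W' where "W' = ?B \<inter> (f ^^ j) -` W"
  have W'b: "W' \<in> sets borel" using fn[OF W(1)] by (simp add: W'_def)
  have "(f ^^ j) ` W' = W"
  proof
    show "W \<subseteq> (f ^^ j) ` W'"
    proof
      fix x assume x: "x \<in> W"
      then have "x \<in> ball 0 e1" using W(2) by auto
      then obtain y where "y \<in> ?B" "x = (f ^^ j) y" using e1(2) by blast
      then show "x \<in> (f ^^ j) ` W'" using x unfolding W'_def by blast
    qed
  qed (auto simp: W'_def)
  then have mW: "measure m W \<le> C * measure m W'" using C(2)[OF W'b] by simp
  \<comment> \<open>The orders used are multiples of \<open>Suc j\<close>, which leaves room for the
    \<open>j\<close> iterates from \<open>W'\<close> to \<open>W\<close>. The \<open>+ 1\<close>
    makes \<open>q * Suc j\<close> exceed \<open>T\<close>.\<close>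
  define q where "q = T div Suc j + 1"
  define A where "A i = (f ^^ (i * Suc j)) -` W'" for i
  have Ab: "A i \<in> sets borel" for i unfolding A_def by (rule fn[OF W'b])
  have Alow: "measure m (A i) \<ge> h * measure m W' * d" for i
  proof -
    have "(f ^^ Suc n) 0 \<notin> ball w (2 * r)" for n using P by blast
    then have "measure m (A i) \<ge> h * measure m W' * measure m ((f ^^ (i * Suc j)) -` ?B)"
      unfolding A_def h_def by (intro preimage_measure_lower_bound[OF r _ W'b]) (auto simp: W'_def)
    moreover have "h * measure m W' * measure m ((f ^^ (i * Suc j)) -` ?B) \<ge> h * measure m W' * d"
      using eta h by (intro mult_left_mono) auto
    ultimately show ?thesis by linarith
  qed
  have disj0: "A i \<inter> A i' = {}" if "i < i'" "i' < q" for i i'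
  proof (rule ccontr)
    assume "A i \<inter> A i' \<noteq> {}"
    then obtain z where z: "(f ^^ (i * Suc j)) z \<in> W'" "(f ^^ (i' * Suc j)) z \<in> W'" by (auto simp: A_def)
    define y where "y = (f ^^ (i * Suc j)) z"
    \<comment> \<open>This is the time from \<open>W\<close> back to the ball. As it is at most
      \<open>T\<close>, the returning point is within \<open>r\<close> of \<open>P\<close>, which is
      impossible in \<open>ball w r\<close> since the ball of twice the radius misses
      \<open>P\<close>.\<close>
    define t where "t = (i' - i) * Suc j - j"
    have t1: "i' * Suc j = t + j + i * Suc j"
    proof -
      have "(i' - i) * Suc j \<ge> 1 * Suc j" using that by (intro mult_right_mono) auto
      moreover have "i' * Suc j = (i' - i) * Suc j + i * Suc j" using that by (simp flip: add_mult_distrib)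
      ultimately show ?thesis by (simp add: t_def)
    qed
    have t2: "t \<le> T"
    proof -
      have "(i' - i) * Suc j \<le> (T div Suc j) * Suc j" using that by (intro mult_right_mono) (auto simp: q_def)
      also have "\<dots> \<le> T" by (rule div_times_less_eq_dividend)
      finally show ?thesis by (simp add: t_def)
    qed
    have "(f ^^ j) y \<in> W" using z(1) by (simp add: W'_def y_def)
    then obtain p where p: "p \<in> P" "dist ((f ^^ t) ((f ^^ j) y)) p < r" using W(3)[OF _ t2] by force
    have "(f ^^ t) ((f ^^ j) y) = (f ^^ (i' * Suc j)) z" unfolding t1 y_def by (simp add: funpow_add)
    then have "dist w p < r + r"
      using p(2) z(2) dist_triangle[of w p "(f ^^ (i' * Suc j)) z"] by (simp add: W'_def)
    then show False using P(2) p(1) by auto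
  qed
  have "disjoint_family_on A {..<q}"
    unfolding disjoint_family_on_def
  proof (intro ballI impI)
    fix i i' assume "i \<in> {..<q}" "i' \<in> {..<q}" "i \<noteq> i'"
    then show "A i \<inter> A i' = {}" using disj0[of i i'] disj0[of i' i] by (cases "i < i'") auto
  qed
  then have "(\<Sum>i<q. measure m (A i)) = measure m (\<Union>i<q. A i)"
    by (intro finite_measure_finite_Union[symmetric]) (auto simp: Ab)
  also have "\<dots> \<le> 1" by (rule prob_le_1)
  finally have "(\<Sum>i<q. h * measure m W' * d) \<le> 1"
    using sum_mono[of "{..<q}" "\<lambda>i. h * measure m W' * d" "\<lambda>i. measure m (A i)"] Alow by fastforce
  then have le1: "q * (h * measure m W' * d) \<le> 1" by simp
  have "T < q * Suc j" unfolding q_def using dividend_less_div_times[of "Suc j" T] by (simp only: add_mult_distrib mult_1) simp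
  then have "real T \<le> q * Suc j" by (metis less_imp_le of_nat_mono)
  then have "real T * measure m W \<le> (q * Suc j) * (C * measure m W')"
    using mW by (intro mult_mono) auto
  also have "\<dots> = (Suc j) * C / (h * d) * (q * (h * measure m W' * d))"
    using h d(1) by (simp add: field_simps)
  also have "\<dots> \<le> (Suc j) * C / (h * d) * 1"
    using le1 C(1) h d(1) by (intro mult_left_mono) auto
  finally show False using W(4) by (simp add: M_def)
qed

end

section \<open>The real family and its almost parabolic gates\<close>

locale even_degree =
  fixes l :: nat
  assumes even_l: "even l" and l2: "l \<ge> 2"
begin

abbreviation g :: "real \<Rightarrow> real \<Rightarrow> real" where "g a \<equiv> unicritical l (a - a ^ l)"

text \<open>Write \<open>B = a ^ l - a\<close>, so that the critical value is \<open>-B\<close>. The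
  last condition is \<open>g a B \<le> B\<close>, which makes \<open>[-B, B]\<close> invariant;
  \<open>B \<ge> 1\<close> keeps \<open>a\<close> at most -1/2 and makes it repelling.\<close>

definition good :: "real \<Rightarrow> bool" where
  "good a \<longleftrightarrow> a < 0 \<and> 1 \<le> a ^ l - a \<and> (a ^ l - a) ^ (l - 1) \<le> 2"

definition L :: real where "L = l * 2 ^ (l - 1)"

lemma L_ge1: "L \<ge> 1"
proof -
  have "1 * 1 \<le> real l * 2 ^ (l - 1)" using l2 by (intro mult_mono) auto
  then show ?thesis by (simp add: L_def)
qed

lemma g_fix [simp]: "g a a = a" by (simp add: unicritical_def)
lemma g_minus: "g a (- y) = g a y" using even_l by (simp add: unicritical_def)
lemma iterate_fix [simp]: "(g a ^^ n) a = a" by (induction n) simp_all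
lemma iterate_minus: "n \<ge> 1 \<Longrightarrow> (g a ^^ n) (- y) = (g a ^^ n) y"
  by (cases n) (simp_all add: unicritical_iterate_Suc g_minus del: funpow.simps)

lemma continuous_on_family [continuous_intros]:
  assumes "continuous_on S A" "continuous_on S Y"
  shows "continuous_on S (\<lambda>t. (g (A t) ^^ n) (Y t))"
proof (induction n)
  case (Suc n)
  then show ?case using assms by (auto simp: unicritical_def intro!: continuous_intros)
qed (use assms in simp)

lemma good_bounds:
  assumes "good a"
  shows "-1 \<le> a" "a \<le> -1/2" "a ^ l - a \<le> 2" "a ^ l > 0"
proof -
  have a: "a < 0" "1 \<le> a ^ l - a" "(a ^ l - a) ^ (l - 1) \<le> 2" using assms by (auto simp: good_def)
  show al: "a ^ l > 0" using a(1) even_l by (simp add: zero_less_power_eq)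
  show B: "a ^ l - a \<le> 2"
  proof -
    have "(a ^ l - a) ^ 1 \<le> (a ^ l - a) ^ (l - 1)" using a(2) l2 by (intro power_increasing) auto
    then show ?thesis using a(3) by simp
  qed
  have abs: "a ^ l = \<bar>a\<bar> ^ l" using even_l by (simp add: power_even_abs)
  show m1: "-1 \<le> a"
  proof (rule ccontr)
    assume "\<not> ?thesis"
    then have "\<bar>a\<bar> > 1" by simp
    then have "\<bar>a\<bar> ^ l \<ge> 1" by (simp add: one_le_power)
    then show False using B unfolding abs using \<open>\<bar>a\<bar> > 1\<close> a(1) by linarith
  qed
  have "\<bar>a\<bar> ^ l \<le> \<bar>a\<bar> ^ 1" using m1 a(1) l2 by (intro power_decreasing) auto
  then show "a \<le> -1/2" using abs a(1,2) by simp
qed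

lemma good_neg: "good a \<Longrightarrow> a < 0" by (simp add: good_def)

lemma g_le: assumes "a \<le> y" "y \<le> - a" shows "g a y \<le> a"
proof -
  have "\<bar>y\<bar> ^ l \<le> \<bar>a\<bar> ^ l" using assms by (intro power_mono) auto
  then show ?thesis using even_l by (simp add: unicritical_def power_even_abs)
qed

lemma g_invariant: assumes "good a" "\<bar>y\<bar> \<le> a ^ l - a" shows "\<bar>g a y\<bar> \<le> a ^ l - a"
proof -
  define B where "B = a ^ l - a"
  have B: "B \<ge> 1" "B ^ (l - 1) \<le> 2" using assms(1) by (auto simp: good_def B_def)
  have "y ^ l = \<bar>y\<bar> ^ l" using even_l by (simp add: power_even_abs)
  also have "\<dots> \<le> B ^ l" using assms(2) by (intro power_mono) (auto simp: B_def)
  also have "\<dots> = B * B ^ (l - 1)" using l2 by (cases l) auto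
  also have "\<dots> \<le> B * 2" using B by (intro mult_left_mono) auto
  finally have "y ^ l - B \<le> B" by simp
  moreover have "y ^ l - B \<ge> - B" using even_l by (simp add: zero_le_even_power)
  ultimately show ?thesis by (simp add: unicritical_def B_def abs_le_iff)
qed

lemma iterate_bounded: assumes "good a" "\<bar>y\<bar> \<le> a ^ l - a" shows "\<bar>(g a ^^ n) y\<bar> \<le> a ^ l - a"
  by (induction n) (use assms g_invariant in auto)

lemma g_lipschitz: assumes "\<bar>y\<bar> \<le> 2" "\<bar>z\<bar> \<le> 2" shows "\<bar>g a y - g a z\<bar> \<le> L * \<bar>y - z\<bar>"
proof -
  have "norm (y ^ l - z ^ l) \<le> L * norm (y - z)"
  proof (rule field_differentiable_bound[of "{-2..2}"])
    show "((\<lambda>y. y ^ l) has_field_derivative l * u ^ (l - 1)) (at u within {-2..2})" for u :: real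
      by (auto intro!: derivative_eq_intros)
    show "norm (l * u ^ (l - 1)) \<le> L" if "u \<in> {-2..2}" for u :: real
    proof -
      have "\<bar>u\<bar> ^ (l - 1) \<le> 2 ^ (l - 1)" using that by (intro power_mono) auto
      then have "real l * \<bar>u\<bar> ^ (l - 1) \<le> real l * 2 ^ (l - 1)" by (intro mult_left_mono) auto
      then show ?thesis by (simp add: L_def abs_mult power_abs)
    qed
  qed (use assms in auto)
  then show ?thesis by (simp add: unicritical_def)
qed

lemma iterate_lipschitz:
  assumes a: "good a" and y: "\<bar>y\<bar> \<le> a ^ l - a" and z: "\<bar>z\<bar> \<le> a ^ l - a"
  shows "\<bar>(g a ^^ n) y - (g a ^^ n) z\<bar> \<le> L ^ n * \<bar>y - z\<bar>"
proof (induction n)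
  case (Suc n)
  have "\<bar>(g a ^^ Suc n) y - (g a ^^ Suc n) z\<bar> \<le> L * \<bar>(g a ^^ n) y - (g a ^^ n) z\<bar>"
    using iterate_bounded[OF a y, of n] iterate_bounded[OF a z, of n] good_bounds(3)[OF a]
    by (simp add: g_lipschitz)
  also have "\<dots> \<le> L * (L ^ n * \<bar>y - z\<bar>)" using Suc L_ge1 by (intro mult_left_mono) auto
  finally show ?case by simp
qed simp

lemma g_neg_decreasing: assumes "y < z" "z \<le> 0" shows "g a z < g a y"
proof -
  have "\<bar>z\<bar> ^ l < \<bar>y\<bar> ^ l" using assms l2 by (intro power_strict_mono) auto
  then show ?thesis using even_l by (simp add: unicritical_def power_even_abs)
qed

lemma g_pos_increasing: assumes "y < z" "0 \<le> y" shows "g a y < g a z"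
  using g_neg_decreasing[of "-z" "-y" a] assms by (simp add: g_minus)

lemma g2_increasing: assumes "good a" "a \<le> y" "y < z" "z \<le> 0" shows "(g a ^^ 2) y < (g a ^^ 2) z"
proof -
  have "g a z < g a y" using assms by (intro g_neg_decreasing) auto
  moreover have "g a y \<le> a" using assms by (intro g_le) auto
  ultimately show ?thesis using good_neg[OF assms(1)] by (simp add: numeral_2_eq_2 g_neg_decreasing)
qed

lemma g2_mono: assumes "good a" "a \<le> y" "y \<le> z" "z \<le> 0" shows "(g a ^^ 2) y \<le> (g a ^^ 2) z"
  using g2_increasing[OF assms(1,2)] assms by (cases "y = z") (auto simp: less_le)

text \<open>Were the multiplier at most 1 in modulus,
  \<open>\<bar>a\<bar> ^ l + \<bar>a\<bar> \<ge> 1\<close> would force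
  \<open>\<bar>a\<bar> \<ge> l / (l + 1)\<close>, and Bernoulli's inequality then gives a multiplier
  of at least \<open>2 * l / (l + 1) > 1\<close>.\<close>

lemma good_repelling: assumes "good a" shows "real l * \<bar>a\<bar> ^ (l - 1) > 1"
proof (rule ccontr)
  assume neg: "\<not> ?thesis"
  define A where "A = \<bar>a\<bar>"
  have A: "A > 0" "A ^ l + A \<ge> 1" using assms even_l by (auto simp: good_def A_def power_even_abs)
  have l0: "real l > 0" using l2 by simp
  have Al: "A ^ l = A * A ^ (l - 1)" using l2 by (cases l) auto
  have "real l * A ^ l = A * (l * A ^ (l - 1))" by (simp add: Al)
  also have "\<dots> \<le> A * 1" using neg A(1) by (intro mult_left_mono) (auto simp: A_def)
  finally have "real l * A ^ l \<le> A" by simp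
  then have "real l * 1 \<le> A + l * A" using A(2) l0 mult_left_mono[OF A(2), of "real l"] by (simp add: distrib_left)
  then have "real l \<le> (real l + 1) * A" by (simp add: algebra_simps)
  then have lower: "1 + - (1 / (real l + 1)) \<le> A" using l0 by (simp add: field_simps)
  have "1 + real (l - 1) * (- (1 / (real l + 1))) \<le> (1 + - (1 / (real l + 1))) ^ (l - 1)"
    using l0 by (intro Bernoulli_inequality) (simp add: field_simps)
  also have "\<dots> \<le> A ^ (l - 1)" using lower l0 by (intro power_mono) (simp_all add: field_simps)
  finally have "2 / (real l + 1) \<le> A ^ (l - 1)" using l0 l2 by (simp add: field_simps of_nat_diff)
  then have "real l * (2 / (real l + 1)) \<le> real l * A ^ (l - 1)" using l0 by (intro mult_left_mono) auto
  also have "\<dots> \<le> 1" using neg by (simp add: A_def)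
  finally have "real l * (2 / (real l + 1)) \<le> 1" .
  then have "2 * real l \<le> real l + 1" using l0 by (simp add: field_simps)
  then show False using l2 by simp
qed

text \<open>The derivative of \<open>g\<^sup>2\<close> is a power of the concave function \<open>z (B - z\<^sup>l)\<close>, so that
  \<open>g\<^sup>2 y - y\<close> increases and then decreases on \<open>[a, 0]\<close>.\<close>

lemma g2_above_diagonal:
  assumes a: "good a" and g20: "(g a ^^ 2) 0 > 0" and y: "a < y" "y \<le> 0"
  shows "(g a ^^ 2) y > y"
proof (rule ccontr)
  assume neg: "\<not> ?thesis"
  then have y0: "y < 0" using g20 y by (cases "y = 0") auto
  define B where "B = a ^ l - a"
  define k where "k z = z * (B - z ^ l)" for z :: real
  have an: "a < 0" using a good_neg by blast
  have l0: "l \<noteq> 0" using l2 by simp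
  have der: "orbit_deriv l (a - a ^ l) 2 (- z) = (l * l) * k z ^ (l - 1)" for z
  proof -
    have "orbit_deriv l (a - a ^ l) 2 (- z) = (l * (- z) ^ (l - 1)) * (l * (z ^ l - B) ^ (l - 1))"
      using even_l by (simp add: orbit_deriv_def numeral_2_eq_2 unicritical_def B_def algebra_simps)
    also have "(- z) ^ (l - 1) * (z ^ l - B) ^ (l - 1) = k z ^ (l - 1)"
      unfolding k_def power_mult_distrib[symmetric] by (simp add: algebra_simps)
    then have "(l * (- z) ^ (l - 1)) * (l * (z ^ l - B) ^ (l - 1)) = (l * l) * k z ^ (l - 1)"
      by (simp add: mult_ac)
    finally show ?thesis .
  qed
  \<comment> \<open>If \<open>y\<close> were not moved up, the mean slope would be at most 1 on
    \<open>[a, y]\<close> and larger than 1 on \<open>[y, 0]\<close>; it is larger than 1 at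
    \<open>a\<close> as well. A power of a concave function cannot dip between \<open>a\<close> and
    \<open>z2\<close> like this.\<close>
  obtain z1 where z1: "a < z1" "z1 < y" "(g a ^^ 2) y - (g a ^^ 2) a = (y - a) * orbit_deriv l (a - a ^ l) 2 z1"
    using iterate_MVT[OF y(1)] by blast
  obtain z2 where z2: "y < z2" "z2 < 0" "(g a ^^ 2) 0 - (g a ^^ 2) y = (0 - y) * orbit_deriv l (a - a ^ l) 2 z2"
    using iterate_MVT[OF y0] by blast
  have d1: "orbit_deriv l (a - a ^ l) 2 z1 \<le> 1"
  proof -
    have "(y - a) * orbit_deriv l (a - a ^ l) 2 z1 \<le> (y - a) * 1" using z1(3) neg by (simp del: One_nat_def)
    then show ?thesis using y(1) by (simp add: mult_le_cancel_left)
  qed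
  have d2: "orbit_deriv l (a - a ^ l) 2 z2 > 1"
  proof -
    have "(- y) * orbit_deriv l (a - a ^ l) 2 z2 > (- y) * 1" using z2(3) neg g20 by simp
    then show ?thesis using y0 by (simp add: mult_less_cancel_left)
  qed
  have d3: "orbit_deriv l (a - a ^ l) 2 a > 1"
  proof -
    have "k (- a) = \<bar>a\<bar> * \<bar>a\<bar>" using even_l an by (simp add: k_def B_def)
    then have "k (- a) ^ (l - 1) = \<bar>a\<bar> ^ (l - 1) * \<bar>a\<bar> ^ (l - 1)" by (simp only: power_mult_distrib)
    then have "orbit_deriv l (a - a ^ l) 2 a = (l * \<bar>a\<bar> ^ (l - 1)) * (l * \<bar>a\<bar> ^ (l - 1))"
      using der[of "- a"] by simp
    also have "\<dots> > 1" by (rule less_1_mult[OF good_repelling[OF a] good_repelling[OF a]])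
    finally show ?thesis .
  qed
  have kpos: "k z > 0" if "0 < z" "z \<le> - a" for z
  proof -
    have "z ^ l \<le> (- a) ^ l" using that by (intro power_mono) auto
    then have "z ^ l < B" using even_l an by (simp add: B_def)
    then show ?thesis using that by (simp add: k_def)
  qed
  have "concave_on {0..} k"
  proof (rule f''_le0_imp_concave)
    show "(k has_real_derivative B - (real l + 1) * z ^ l) (at z)" for z
    proof -
      have "z * (l * z ^ (l - 1)) = l * z ^ l" using l0 by (cases l) auto
      then show ?thesis unfolding k_def by (auto intro!: derivative_eq_intros simp: algebra_simps)
    qed
    show "((\<lambda>z. B - (real l + 1) * z ^ l) has_real_derivative - ((real l + 1) * (l * z ^ (l - 1)))) (at z)" for z :: real
      by (auto intro!: derivative_eq_intros)
    show "- ((real l + 1) * (l * z ^ (l - 1))) \<le> 0" if "z \<in> {0..}" for z :: real using that by simp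
  qed auto
  define t where "t = (- z1 - (- z2)) / (- a - (- z2))"
  have t: "0 \<le> t" "t \<le> 1" using z1 z2 y0 an by (simp_all add: t_def field_simps)
  have tz: "(1 - t) *\<^sub>R (- z2) + t *\<^sub>R (- a) = - z1"
  proof -
    have "t * (- a + z2) = z2 - z1" using z1 z2 by (simp add: t_def)
    then show ?thesis by (simp add: algebra_simps)
  qed
  have "k (- z1) \<ge> (1 - t) * k (- z2) + t * k (- a)"
    using concave_onD[OF \<open>concave_on {0..} k\<close> t, of "- z2" "- a"] z2 an unfolding tz by simp
  moreover have "(1 - t) * k (- z2) + t * k (- a) \<ge> min (k (- z2)) (k (- a))"
  proof -
    have "(1 - t) * k (- z2) + t * k (- a) \<ge> (1 - t) * min (k (- z2)) (k (- a)) + t * min (k (- z2)) (k (- a))"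
      using t by (intro add_mono mult_left_mono) auto
    then show ?thesis by (simp add: algebra_simps)
  qed
  ultimately have "k (- z1) \<ge> k (- z2) \<or> k (- z1) \<ge> k (- a)" by linarith
  then have "k (- z1) ^ (l - 1) \<ge> k (- z2) ^ (l - 1) \<or> k (- z1) ^ (l - 1) \<ge> k (- a) ^ (l - 1)"
    using kpos[of "- z2"] kpos[of "- a"] z1 z2 y an by (auto intro: power_mono)
  then have "orbit_deriv l (a - a ^ l) 2 z1 \<ge> orbit_deriv l (a - a ^ l) 2 z2 \<or> orbit_deriv l (a - a ^ l) 2 z1 \<ge> orbit_deriv l (a - a ^ l) 2 a"
    using der[of "- z1"] der[of "- z2"] der[of "- a"] by (auto intro!: mult_left_mono)
  then show False using d1 d2 d3 by linarith
qed

text \<open>\<open>[j1, j2]\<close> grows onto \<open>[a, -a]\<close>, and the middle half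
  \<open>[y1, y2]\<close> has Koebe space in it. Up to time \<open>N0\<close> the whole interval
  shadows the critical orbit within \<epsilon>. The same \<kappa> is the exponent and the bound, so
  that letting it grow settles every \<delta> and every constant at once.\<close>

definition gate :: "real \<Rightarrow> real \<Rightarrow> real \<Rightarrow> nat \<Rightarrow> bool" where
  "gate a x \<epsilon> \<kappa> \<longleftrightarrow> (\<exists>j1 j2 y1 y2 N0 N1. x \<le> j1 \<and> j1 < y1 \<and> y1 < y2 \<and> y2 < j2 \<and> j2 < 0 \<and> N0 \<le> N1 \<and>
     (g a ^^ N1) j1 = a \<and> (g a ^^ N1) j2 = - a \<and> (g a ^^ N1) y1 = a / 2 \<and> (g a ^^ N1) y2 = - a / 2 \<and>
     strict_mono_on {j1..j2} (g a ^^ N1) \<and> (\<forall>i<N1. \<forall>y\<in>{j1..j2}. (g a ^^ i) y \<noteq> 0) \<and>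
     (\<forall>i\<le>N0. \<exists>n. \<forall>y\<in>{j1..j2}. \<bar>(g a ^^ i) y - (g a ^^ n) 0\<bar> \<le> \<epsilon>) \<and>
     real N0 * (y2 - y1) ^ \<kappa> \<ge> real \<kappa>)"

end

text \<open>\<open>cond\<close> is the invariant from which long branches follow: an intermediate
  image of \<open>[x, 0]\<close> either avoids \<open>(a, -a)\<close> or is negative with increasing
  iterate. \<open>g2x\<close> ensures that \<open>g^2\<close> maps a part of \<open>[a, x]\<close>
  onto \<open>[a, -a]\<close>, which is how the passage is finished.\<close>

locale branch = even_degree +
  fixes a x :: real and m :: nat
  assumes good: "good a" and ax: "a < x" and x0: "x \<le> 0" and m1: "m \<ge> 1"
    and Fx: "(g a ^^ m) x = a" and Fmono: "strict_mono_on {x..0} (g a ^^ m)"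
    and F0: "a \<le> (g a ^^ m) 0" "(g a ^^ m) 0 \<le> 0"
    and g2x: "(g a ^^ 2) x \<ge> - a"
    and cond: "\<And>i. 1 \<le> i \<Longrightarrow> i < m \<Longrightarrow> (\<forall>y\<in>{x..0}. \<bar>(g a ^^ i) y\<bar> \<ge> \<bar>a\<bar>) \<or>
       (strict_mono_on {x..0} (g a ^^ i) \<and> (\<forall>y\<in>{x..0}. (g a ^^ i) y < 0))"
begin

abbreviation F :: "real \<Rightarrow> real" where "F \<equiv> g a ^^ m"

lemma a_neg: "a < 0" using good good_neg by blast

lemma F_funpow: "(F ^^ n) = g a ^^ (m * n)" by (rule funpow_mult)

lemma F_range: assumes "y \<in> {x..0}" shows "F y \<in> {a..0}"
proof -
  have "F x \<le> F y" "F y \<le> F 0" using assms x0 Fmono by (auto intro: strict_mono_on_leD)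
  then show ?thesis using Fx F0 by simp
qed

lemma F_strict: "y \<in> {x..0} \<Longrightarrow> z \<in> {x..0} \<Longrightarrow> y < z \<Longrightarrow> F y < F z"
  using Fmono by (rule strict_mono_onD)

lemma F_le: "y \<in> {x..0} \<Longrightarrow> z \<in> {x..0} \<Longrightarrow> y \<le> z \<Longrightarrow> F y \<le> F z"
  using Fmono by (rule strict_mono_on_leD)

lemma orbit_bounded: assumes "a \<le> y" "y \<le> 0" shows "\<bar>y\<bar> \<le> a ^ l - a"
  using assms good_bounds(4)[OF good] by simp

lemma lipschitz: assumes "y \<in> {a..0}" "z \<in> {a..0}" shows "\<bar>(g a ^^ n) y - (g a ^^ n) z\<bar> \<le> L ^ n * \<bar>y - z\<bar>"
  by (rule iterate_lipschitz[OF good orbit_bounded orbit_bounded]) (use assms in auto)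

lemma continuous_F: "continuous_on S (F ^^ n)"
  unfolding F_funpow by (rule unicritical_iterate_continuous_real)

lemma nonzero: assumes "1 \<le> i" "i < m" "y \<in> {x..0}" shows "(g a ^^ i) y \<noteq> 0"
  using cond[OF assms(1,2)] assms(3) a_neg by fastforce

text \<open>The points of index \<open>0\<close> to \<open>n - 1\<close> lie in the domain
  \<open>[x, 0]\<close> of the branch, while the \<open>n\<close>-th may be anywhere in
  \<open>[a, 0]\<close>. The point \<open>y\<close> itself is in the domain even for
  \<open>n = 0\<close>.\<close>

definition chain :: "nat \<Rightarrow> real \<Rightarrow> bool" where
  "chain n y \<longleftrightarrow> y \<in> {x..0} \<and> (\<forall>i<n. (F ^^ i) y \<in> {x..0})"

lemma chain_Suc: "chain (Suc n) y \<longleftrightarrow> chain n y \<and> (F ^^ n) y \<in> {x..0}"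
  by (auto simp: chain_def less_Suc_eq)

lemma chain_range: assumes "chain n y" shows "(F ^^ n) y \<in> {a..0}"
proof (cases n)
  case 0
  then show ?thesis using assms ax by (auto simp: chain_def)
next
  case (Suc k)
  then show ?thesis using assms F_range[of "(F ^^ k) y"] by (simp add: chain_def del: funpow.simps(2)) simp
qed

lemma chain_mono:
  assumes "chain n y" "y \<le> z" "z \<le> 0"
  shows "chain n z \<and> (F ^^ n) y \<le> (F ^^ n) z"
  using assms
proof (induction n)
  case (Suc n)
  then have IH: "chain n z" "(F ^^ n) y \<le> (F ^^ n) z" by (auto simp: chain_Suc)
  have y: "(F ^^ n) y \<in> {x..0}" using Suc.prems(1) by (simp add: chain_Suc)
  have z: "(F ^^ n) z \<in> {x..0}" using y IH chain_range[OF IH(1)] by auto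
  show ?case using IH z F_le[OF y z IH(2)] by (simp add: chain_Suc)
qed (auto simp: chain_def)

lemma chain_strict_mono:
  assumes "chain n y" "y < z" "z \<le> 0" shows "(F ^^ n) y < (F ^^ n) z"
  using assms(1)
proof (induction n)
  case (Suc n)
  then have y: "(F ^^ n) y \<in> {x..0}" and lt: "(F ^^ n) y < (F ^^ n) z" by (auto simp: chain_Suc)
  have "chain n z" using chain_mono[of n y z] Suc.prems assms by (simp add: chain_Suc)
  then have "(F ^^ n) z \<in> {x..0}" using y lt chain_range[of n z] by auto
  then show ?case using F_strict[OF y _ lt] by simp
qed (use assms in simp)

lemma chain_strict_mono_on: assumes "chain n y" shows "strict_mono_on {y..0} (F ^^ n)"
proof (rule strict_mono_onI)
  fix u v assume "u \<in> {y..0}" "v \<in> {y..0}" "u < v"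
  then show "(F ^^ n) u < (F ^^ n) v" using chain_mono[OF assms, of u] by (intro chain_strict_mono) auto
qed

lemma chain_le: "chain n y \<Longrightarrow> k \<le> n \<Longrightarrow> chain k y"
  by (auto simp: chain_def)

lemma chain_shift: assumes "chain (Suc n) y" "n \<ge> 1" shows "chain n (F y)"
proof -
  have *: "(F ^^ i) y \<in> {x..0}" if "i < Suc n" for i using assms(1) that by (auto simp: chain_def)
  have "(F ^^ i) (F y) = (F ^^ Suc i) y" for i by (simp add: funpow_Suc_right del: funpow.simps)
  then show ?thesis unfolding chain_def using *[of 1] *[of "Suc _"] assms(2) by auto
qed

lemma chainI: assumes "y \<in> {x..0}" "\<And>i. i < k \<Longrightarrow> x \<le> (F ^^ i) y" shows "chain k y"
  using assms
proof (induction k)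
  case (Suc k)
  then have "chain k y" by auto
  then show ?case using Suc.prems(2)[of k] chain_range[of k y] by (auto simp: chain_Suc)
qed (simp add: chain_def)

text \<open>Induction by the intermediate value theorem: a point sent to \<open>x\<close> is sent to
  \<open>a\<close> by one more \<open>F\<close>, so a preimage of \<open>x\<close> of the next order
  lies between it and \<open>0\<close>.\<close>

lemma chain_pullback_0:
  assumes "chain n 0" "(F ^^ n) 0 \<ge> x"
  shows "\<exists>y. chain n y \<and> (F ^^ n) y = x"
  using assms
proof (induction n)
  case 0
  then show ?case using x0 by (intro exI[of _ x]) (auto simp: chain_def)
next
  case (Suc n)
  then obtain y where y: "chain n y" "(F ^^ n) y = x" by (auto simp: chain_Suc)
  have y0: "y \<le> 0" using y by (auto simp: chain_def)
  have "\<exists>z\<ge>y. z \<le> 0 \<and> (F ^^ Suc n) z = x"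
  proof (rule IVT')
    show "continuous_on {y..0} (F ^^ Suc n)" by (rule continuous_F)
  qed (use y y0 Fx ax Suc.prems in auto)
  then obtain z where z: "y \<le> z" "z \<le> 0" "(F ^^ Suc n) z = x" by blast
  have "chain n z" "x \<le> (F ^^ n) z" using chain_mono[OF y(1) z(1,2)] y(2) by auto
  then have "chain (Suc n) z" using chain_range[of n z] by (auto simp: chain_Suc)
  then show ?case using z by blast
qed

lemma pullback_unique:
  assumes "chain n y" "chain n z" "(F ^^ n) y = (F ^^ n) z" shows "y = z"
  using chain_strict_mono[of n y z] chain_strict_mono[of n z y] assms by (force simp: chain_def not_less_iff_gr_or_eq)

lemma iterate_split: "(g a ^^ (m * t + r)) y = (g a ^^ r) ((F ^^ t) y)"
  by (simp add: F_funpow funpow_add add.commute[of "m * t"])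

text \<open>Split the time as \<open>m * j + r\<close>. For \<open>r = 0\<close> the iterate is a
  power of \<open>F\<close>, increasing on the chain; otherwise \<open>cond\<close> at time
  \<open>r\<close> is composed with the increasing \<open>F ^^ j\<close>.\<close>

lemma chain_cond:
  assumes ch: "chain t y" and neg: "\<And>j z. 1 \<le> j \<Longrightarrow> j < t \<Longrightarrow> z \<in> {y..0} \<Longrightarrow> (F ^^ j) z < 0"
    and i: "1 \<le> i" "i < m * t"
  shows "(\<forall>z\<in>{y..0}. \<bar>(g a ^^ i) z\<bar> \<ge> \<bar>a\<bar>) \<or>
       (strict_mono_on {y..0} (g a ^^ i) \<and> (\<forall>z\<in>{y..0}. (g a ^^ i) z < 0))"
proof -
  define j r where "j = i div m" and "r = i mod m"
  have ir: "i = m * j + r" "r < m" using m1 by (simp_all add: j_def r_def)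
  have jt: "j < t" using i(2) ir m1 by (metis div_less_iff_less_mult j_def mult.commute less_le_trans zero_less_one)
  have chj: "chain j y" using ch jt by (auto simp: chain_def)
  have im: "(F ^^ j) z \<in> {x..0}" if "z \<in> {y..0}" for z
  proof -
    have "chain t z" using chain_mono[OF ch, of z] that by auto
    then show ?thesis using jt by (auto simp: chain_def)
  qed
  have mj: "strict_mono_on {y..0} (F ^^ j)" by (rule chain_strict_mono_on[OF chj])
  have e: "(g a ^^ i) z = (g a ^^ r) ((F ^^ j) z)" for z unfolding ir(1) by (rule iterate_split)
  show ?thesis
  proof (cases "r = 0")
    case True
    then have "1 \<le> j" using i(1) ir by (cases j) auto
    then have "\<forall>z\<in>{y..0}. (g a ^^ i) z < 0" using neg[OF _ jt] e True by simp
    moreover have "strict_mono_on {y..0} (g a ^^ i)" using mj e True by (simp add: strict_mono_on_def)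
    ultimately show ?thesis by blast
  next
    case False
    then have "1 \<le> r" by simp
    from cond[OF this ir(2)] show ?thesis
    proof
      assume "\<forall>y\<in>{x..0}. \<bar>(g a ^^ r) y\<bar> \<ge> \<bar>a\<bar>"
      then show ?thesis using im e by simp
    next
      assume *: "strict_mono_on {x..0} (g a ^^ r) \<and> (\<forall>y\<in>{x..0}. (g a ^^ r) y < 0)"
      have "strict_mono_on {y..0} (g a ^^ i)"
      proof (rule strict_mono_onI)
        fix u v assume uv: "u \<in> {y..0}" "v \<in> {y..0}" "u < v"
        then show "(g a ^^ i) u < (g a ^^ i) v" unfolding e
          using * im strict_mono_onD[OF mj uv] by (intro strict_mono_onD[of "{x..0}" "g a ^^ r"]) auto
      qed
      then show ?thesis using * im e by simp
    qed
  qed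
qed

lemma g2_power_facts:
  assumes w: "a \<le> w" "w \<le> 0" and neg: "\<And>j. j < q \<Longrightarrow> (g a ^^ (2 * j)) w < 0" and top: "(g a ^^ (2 * q)) w \<le> 0"
    and j: "j \<le> q"
  shows "strict_mono_on {a..w} (g a ^^ (2 * j)) \<and> (\<forall>y\<in>{a..w}. a \<le> (g a ^^ (2 * j)) y \<and> (g a ^^ (2 * j)) y \<le> (g a ^^ (2 * j)) w)"
  using j
proof (induction j)
  case 0
  then show ?case by (auto simp: strict_mono_on_def)
next
  case (Suc j)
  then have IH: "strict_mono_on {a..w} (g a ^^ (2 * j))"
    "\<And>y. y \<in> {a..w} \<Longrightarrow> a \<le> (g a ^^ (2 * j)) y \<and> (g a ^^ (2 * j)) y \<le> (g a ^^ (2 * j)) w" by auto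
  have n: "(g a ^^ (2 * j)) w \<le> 0" using neg[of j] Suc.prems by simp
  have e: "(g a ^^ (2 * Suc j)) y = (g a ^^ 2) ((g a ^^ (2 * j)) y)" for y
  proof -
    have "2 * Suc j = 2 + 2 * j" by simp
    then show ?thesis by (simp only: funpow_add o_apply)
  qed
  have sm: "strict_mono_on {a..w} (g a ^^ (2 * Suc j))"
  proof (rule strict_mono_onI)
    fix u v assume uv: "u \<in> {a..w}" "v \<in> {a..w}" "u < v"
    then show "(g a ^^ (2 * Suc j)) u < (g a ^^ (2 * Suc j)) v" unfolding e
      using strict_mono_onD[OF IH(1) uv] IH(2)[OF uv(1)] IH(2)[OF uv(2)] n by (intro g2_increasing[OF good]) auto
  qed
  moreover have "a \<le> (g a ^^ (2 * Suc j)) y" if "y \<in> {a..w}" for y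
    using strict_mono_on_leD[OF sm _ that, of a] that w by simp
  moreover have "(g a ^^ (2 * Suc j)) y \<le> (g a ^^ (2 * Suc j)) w" if "y \<in> {a..w}" for y
    using strict_mono_on_leD[OF sm that, of w] that w by simp
  ultimately show ?case by blast
qed

text \<open>After \<open>Suc t\<close> iterates of \<open>F\<close> the image of
  \<open>[x', 0]\<close> begins at the fixed point \<open>a\<close>, and \<open>g^2\<close> pushes
  its upper end away from \<open>a\<close> for \<open>q\<close> more rounds. At the even times in
  between the image is negative and the iterate increasing; at the odd times the image lies below
  \<open>a\<close>. So \<open>cond\<close> is passed on.\<close>

lemma next_branch:
  assumes t: "t \<ge> 1" and x': "chain t x'" "(F ^^ t) x' = x"
    and neg: "\<And>j. 1 \<le> j \<Longrightarrow> j \<le> t \<Longrightarrow> (F ^^ j) 0 < 0"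
    and Ole: "(F ^^ Suc t) 0 \<le> 0"
    and q: "\<And>j. j < q \<Longrightarrow> (g a ^^ (2 * j)) ((F ^^ Suc t) 0) < 0" "(g a ^^ (2 * q)) ((F ^^ Suc t) 0) \<le> 0"
  shows "branch l a x' (m * Suc t + 2 * q)"
proof
  let ?O = "(F ^^ Suc t) 0"
  have x'b: "x \<le> x'" "x' \<le> 0" using x'(1) by (auto simp: chain_def)
  have ch: "chain (Suc t) x'" using x' x0 by (simp add: chain_Suc)
  have aO: "a \<le> ?O" using chain_mono[OF ch x'b(2)] x' Fx by simp
  show "good a" by (rule good)
  show "a < x'" "x' \<le> 0" using x'b ax by auto
  show "m * Suc t + 2 * q \<ge> 1" using m1 by simp
  have e: "(g a ^^ (m * Suc t + r)) y = (g a ^^ r) ((F ^^ Suc t) y)" for r y by (rule iterate_split)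
  have facts: "strict_mono_on {a..?O} (g a ^^ (2 * j)) \<and> (\<forall>y\<in>{a..?O}. a \<le> (g a ^^ (2 * j)) y \<and> (g a ^^ (2 * j)) y \<le> (g a ^^ (2 * j)) ?O)"
    if "j \<le> q" for j
    using g2_power_facts[OF aO Ole, of q j] q that by blast
  have im: "(F ^^ Suc t) y \<in> {a..?O}" if "y \<in> {x'..0}" for y
    using chain_mono[OF ch, of y] chain_mono[OF chain_mono[OF ch, of y, THEN conjunct1], of 0] chain_range[of "Suc t" y] that by auto
  have sm: "strict_mono_on {x'..0} (F ^^ Suc t)" by (rule chain_strict_mono_on[OF ch])
  have smj: "strict_mono_on {x'..0} (g a ^^ (m * Suc t + 2 * j))" if "j \<le> q" for j
  proof (rule strict_mono_onI)
    fix u v assume uv: "u \<in> {x'..0}" "v \<in> {x'..0}" "u < v"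
    then show "(g a ^^ (m * Suc t + 2 * j)) u < (g a ^^ (m * Suc t + 2 * j)) v" unfolding e
      using facts[OF that] im strict_mono_onD[OF sm uv] by (intro strict_mono_onD[of "{a..?O}" "g a ^^ (2 * j)"]) auto
  qed
  show "(g a ^^ (m * Suc t + 2 * q)) x' = a" unfolding e using x' Fx by simp
  show "strict_mono_on {x'..0} (g a ^^ (m * Suc t + 2 * q))" by (rule smj) simp
  show "a \<le> (g a ^^ (m * Suc t + 2 * q)) 0" "(g a ^^ (m * Suc t + 2 * q)) 0 \<le> 0"
    unfolding e using facts[of q] q(2) aO by auto
  show "- a \<le> (g a ^^ 2) x'" using g2_mono[OF good, of x x'] g2x ax x'b by linarith
  fix i assume i: "1 \<le> i" "i < m * Suc t + 2 * q"
  show "(\<forall>y\<in>{x'..0}. \<bar>a\<bar> \<le> \<bar>(g a ^^ i) y\<bar>) \<or> strict_mono_on {x'..0} (g a ^^ i) \<and> (\<forall>y\<in>{x'..0}. (g a ^^ i) y < 0)"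
  proof (cases "i < m * Suc t")
    case True
    show ?thesis
    proof (rule chain_cond[OF ch _ i(1) True])
      fix j z assume jz: "1 \<le> j" "j < Suc t" "z \<in> {x'..0}"
      have "chain (Suc t) z" using chain_mono[OF ch, of z] jz(3) by auto
      then have "chain j z" using jz(2) by (auto simp: chain_def)
      then have "(F ^^ j) z \<le> (F ^^ j) 0" using chain_mono[of j z 0] jz(3) by auto
      then show "(F ^^ j) z < 0" using neg[of j] jz by simp
    qed
  next
    case False
    define k where "k = i - m * Suc t"
    have k: "i = m * Suc t + k" "k < 2 * q" using False i(2) by (auto simp: k_def)
    show ?thesis
    proof (cases "even k")
      case True
      then obtain j where j: "k = 2 * j" by blast
      then have "j < q" using k by simp
      then have "(g a ^^ i) y < 0" if "y \<in> {x'..0}" for y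
        unfolding k(1) e j using facts[of j] im[OF that] q(1)[of j] by force
      then show ?thesis using smj[of j] \<open>j < q\<close> unfolding k(1) j by auto
    next
      case False
      then obtain j where j: "k = Suc (2 * j)" by (metis oddE Suc_eq_plus1)
      then have "j < q" using k by simp
      have "\<bar>a\<bar> \<le> \<bar>(g a ^^ i) y\<bar>" if "y \<in> {x'..0}" for y
      proof -
        have "a \<le> (g a ^^ (2 * j)) ((F ^^ Suc t) y)" "(g a ^^ (2 * j)) ((F ^^ Suc t) y) < 0"
          using facts[of j] im[OF that] q(1)[of j] \<open>j < q\<close> by force+
        then have "g a ((g a ^^ (2 * j)) ((F ^^ Suc t) y)) \<le> a" using a_neg by (intro g_le) auto
        then show ?thesis unfolding k(1) e j using a_neg by simp
      qed
      then show ?thesis by blast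
    qed
  qed
qed

text \<open>The fundamental intervals \<open>[e, F\<inverse> e]\<close> of \<open>F\<close> are
  transported from the entrance, just below \<open>y0\<close>, to the exit, just above \<open>q0\<close>, with bounded
  distortion. Here \<open>I\<close> is a lower bound for the time of passage, on which the lower bound for the
  length of the entering interval does not depend.\<close>

lemma gate_passage:
  assumes H: "\<And>y. y \<in> {x..0} \<Longrightarrow> F y < y"
    and y0: "x < q0" "q0 < y0" "y0 < 0" "y0 \<le> F 0"
    and s: "s \<ge> 1" "\<exists>i\<le>s. (F ^^ i) q0 < x"
    and tau: "\<tau> > 0" "\<And>y. y \<in> {F y0..y0} \<Longrightarrow> y - F y \<ge> \<tau>"
    and I: "\<And>i. i \<le> I \<Longrightarrow> (F ^^ i) (F y0) > x" "I > s"
    and small: "L ^ m * (y0 - q0) \<le> \<epsilon>"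
    and D: "D = \<tau> * (1 / (2 * L ^ (m * (s + 1) + 2))) / exp (koebe * L ^ (m * (s + 2) + 2))"
    and big: "real (I - s) * D ^ \<kappa> \<ge> real \<kappa>"
  shows "gate a x \<epsilon> \<kappa>"
proof -
  have H': "(F ^^ Suc i) y < (F ^^ i) y" if "chain (Suc i) y" for i y
    using H[of "(F ^^ i) y"] that by (simp add: chain_Suc)
  have below: "chain i y \<Longrightarrow> 1 \<le> i \<Longrightarrow> (F ^^ i) y < y" for i y
  proof (induction i)
    case (Suc i)
    then show ?case using H'[of i y] by (cases "i = 0") (auto simp: chain_Suc)
  qed simp
  have exit: "\<exists>n. \<not> chain n y" if y: "y \<in> {x..0}" for y
  proof (rule ccontr)
    assume "\<not> ?thesis"
    then have ch: "chain n y" for n by blast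
    have dec: "decseq (\<lambda>n. (F ^^ n) y)"
      by (rule decseq_SucI) (use H' ch less_imp_le in blast)
    have bd: "(F ^^ n) y \<in> {x..0}" for n using ch[of "Suc n"] by (simp add: chain_Suc)
    obtain z where z: "(\<lambda>n. (F ^^ n) y) \<longlonglongrightarrow> z"
      using decseq_convergent[OF dec, of x] bd by (metis atLeastAtMost_iff)
    have zx: "z \<in> {x..0}" using z bd by (meson closed_atLeastAtMost closed_sequentially)
    have "(\<lambda>n. F ((F ^^ n) y)) \<longlonglongrightarrow> F z"
      by (rule continuous_on_tendsto_compose[of UNIV F]) (use z continuous_F[of UNIV 1] in auto)
    moreover have "(\<lambda>n. F ((F ^^ n) y)) \<longlonglongrightarrow> z" using LIMSEQ_Suc[OF z] by simp
    ultimately have "F z = z" using LIMSEQ_unique by blast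
    then show False using H[OF zx] by simp
  qed
  let ?y1 = "F y0"
  have y0x: "y0 \<in> {x..0}" using y0 by simp
  have y1x: "x < ?y1" using I(1)[of 0] by simp
  have y10: "?y1 < y0" using H[OF y0x] .
  have chI: "chain (Suc I) ?y1"
  proof (rule chainI)
    show "?y1 \<in> {x..0}" using y1x y10 y0 by simp
    show "x \<le> (F ^^ i) ?y1" if "i < Suc I" for i using I(1)[of i] that by simp
  qed
  \<comment> \<open>The last index for which the orbit of \<open>F y0\<close> is still in
    \<open>[x, 0]\<close>: \<open>chain (Suc n)\<close> concerns the indices up to
    \<open>n\<close>.\<close>
  define n where "n = (LEAST n. \<not> chain (Suc (Suc n)) ?y1)"
  have ex: "\<exists>n. \<not> chain (Suc (Suc n)) ?y1"
  proof -
    obtain k where "\<not> chain k ?y1" using exit[of ?y1] y1x y10 y0 by auto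
    then have "\<not> chain (Suc (Suc k)) ?y1" using chain_le[of "Suc (Suc k)" ?y1 k] by auto
    then show ?thesis by blast
  qed
  have n1: "\<not> chain (Suc (Suc n)) ?y1" unfolding n_def by (rule LeastI_ex[OF ex])
  have nI: "n \<ge> I"
  proof (rule ccontr)
    assume "\<not> n \<ge> I"
    then have "chain (Suc (Suc n)) ?y1" using chI by (auto simp: chain_def)
    then show False using n1 by simp
  qed
  have chn: "chain (Suc n) ?y1"
  proof (cases "n = 0")
    case True
    then show ?thesis using chI by (auto simp: chain_def)
  next
    case False
    have "chain (Suc (Suc (n - 1))) ?y1" using not_less_Least[of "n - 1" "\<lambda>n. \<not> chain (Suc (Suc n)) ?y1"] False
      unfolding n_def[symmetric] by auto
    then show ?thesis using False by simp
  qed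
  have Fy1n: "(F ^^ Suc n) ?y1 < x"
    using n1 chn chain_range[OF chn] by (auto simp: chain_Suc[of "Suc n"])
  have y1n: "(F ^^ n) ?y1 \<ge> x" using chn by (auto simp: chain_Suc)
  let ?y2 = "F ?y1"
  have y2x: "?y2 < ?y1" using H[of ?y1] y1x y10 y0 by auto
  have n0: "n \<ge> 1" using nI I(2) s(1) by simp
  have chy2: "chain n ?y2" by (rule chain_shift[OF chn n0])
  \<comment> \<open>\<open>e\<close> hits \<open>x\<close> exactly at time \<open>n\<close>. With
    its preimages \<open>e'\<close> and \<open>e''\<close> it bounds the entering fundamental
    interval \<open>[e, e']\<close> and, together with \<open>F e\<close>, its two
    neighbours.\<close>
  obtain e where e: "?y2 < e" "e \<le> ?y1" "(F ^^ n) e = x"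
  proof -
    have "(F ^^ n) ?y2 < x" using Fy1n by (simp add: funpow_Suc_right del: funpow.simps)
    then obtain e where "?y2 \<le> e" "e \<le> ?y1" "(F ^^ n) e = x"
      using IVT'[of "F ^^ n" ?y2 x ?y1] y1n y2x continuous_F by auto
    moreover have "e \<noteq> ?y2" using calculation(3) \<open>(F ^^ n) ?y2 < x\<close> by auto
    ultimately show ?thesis using that by force
  qed
  have e0: "e < 0" using e y10 y0 by linarith
  have che: "chain n e" using chain_mono[OF chy2, of e] e e0 by auto
  have xe: "x \<le> e" using che by (auto simp: chain_def)
  obtain e' where e': "?y1 < e'" "e' \<le> y0" "F e' = e"
  proof -
    obtain z where "?y1 \<le> z" "z \<le> y0" "F z = e"
      using IVT'[of F ?y1 e y0] e y10 continuous_F[of _ 1] by auto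
    moreover have "z \<noteq> ?y1" using calculation(3) e by auto
    ultimately show ?thesis using that by force
  qed
  obtain e'' where e'': "y0 \<le> e''" "e'' \<le> 0" "F e'' = e'"
  proof -
    obtain z where "y0 \<le> z" "z \<le> 0" "F z = e'"
      using IVT'[of F y0 e' 0] e' y0 y10 continuous_F[of _ 1] y0 by (auto simp: less_imp_le)
    then show ?thesis using that by blast
  qed
  have e'0: "e' < 0" using e' y0 by linarith
  have xe': "x \<le> e'" using e' y1x by linarith
  have ee': "e < e'" using H[of e'] e' e'0 xe' by auto
  have Feu: "F e < e" using H[of e] xe e0 by auto
  have xe'': "x \<le> e''" using e'' y0 by linarith
  have e'e'': "e' < e''" using H[of e''] e'' xe'' by auto
  have che2: "chain (Suc n) e" using che e(3) x0 by (simp add: chain_Suc)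
  have shift: "(F ^^ Suc i) z = (F ^^ i) (F z)" for i z by (simp add: funpow_Suc_right del: funpow.simps)
  have Fne': "(F ^^ Suc n) e' = x" unfolding shift e' by (rule e)
  have Fne'': "(F ^^ (n + 2)) e'' = x"
  proof -
    have "(F ^^ (n + 2)) e'' = (F ^^ Suc (Suc n)) e''" by simp
    also have "\<dots> = (F ^^ Suc n) e'" unfolding shift[of "Suc n"] e'' ..
    finally show ?thesis using Fne' by simp
  qed
  \<comment> \<open>A point below \<open>q0\<close> falls below \<open>x\<close> within
    \<open>s\<close> iterates. As \<open>e\<close> reaches \<open>x\<close> only at time
    \<open>n\<close>, its orbit is still above \<open>q0\<close> at time
    \<open>n - s\<close>.\<close>
  define T where "T = n - s"
  have nT: "n = T + s" "T \<ge> I - s" using nI I(2) by (auto simp: T_def)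
  have FnT: "(F ^^ s) ((F ^^ T) z) = (F ^^ n) z" for z unfolding nT(1) by (simp only: add.commute[of T s] funpow_add o_apply)
  have chT: "chain s ((F ^^ T) e)"
  proof (rule chainI)
    show "(F ^^ T) e \<in> {x..0}" using che nT s(1) by (auto simp: chain_def)
    show "x \<le> (F ^^ i) ((F ^^ T) e)" if "i < s" for i
    proof -
      have "(F ^^ i) ((F ^^ T) e) = (F ^^ (T + i)) e" by (simp add: funpow_add add.commute[of T])
      then show ?thesis using che that nT by (auto simp: chain_def)
    qed
  qed
  have q0e: "q0 \<le> (F ^^ T) e"
  proof (rule ccontr)
    assume "\<not> ?thesis"
    then have lt: "(F ^^ T) e \<le> q0" by simp
    obtain i where i: "i \<le> s" "(F ^^ i) q0 < x" using s(2) by blast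
    have "(F ^^ i) ((F ^^ T) e) \<le> (F ^^ i) q0"
      using chain_mono[OF chain_le[OF chT i(1)] lt] y0 by simp
    moreover have "x \<le> (F ^^ i) ((F ^^ T) e)"
      using chT i(1) FnT[of e] e(3) by (cases "i = s") (auto simp: chain_def)
    ultimately show False using i(2) by linarith
  qed
  have region: "(F ^^ t) y \<in> {q0..y0}" if t: "t \<le> T" and y: "y \<in> {e..e'}" for t y
  proof -
    have ct: "chain t e" using che t nT by (intro chain_le[OF che]) simp
    have cy: "chain t y" "(F ^^ t) e \<le> (F ^^ t) y" using chain_mono[OF ct, of y] y e'0 by auto
    have "(F ^^ t) y \<le> y" using below[OF cy(1)] by (cases "t = 0") auto
    moreover have "(F ^^ T) e \<le> (F ^^ t) e"
    proof -
      have cte: "chain (T - t) ((F ^^ t) e)"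
      proof (rule chainI)
        show "(F ^^ t) e \<in> {x..0}" using che2 t nT by (auto simp: chain_def)
        show "x \<le> (F ^^ i) ((F ^^ t) e)" if "i < T - t" for i
        proof -
          have "(F ^^ i) ((F ^^ t) e) = (F ^^ (t + i)) e" by (simp add: funpow_add add.commute[of t])
          then show ?thesis using che that nT by (auto simp: chain_def)
        qed
      qed
      have "(F ^^ (T - t)) ((F ^^ t) e) = (F ^^ T) e"
        using t by (metis funpow_add le_add_diff_inverse2 o_apply)
      then show ?thesis using below[OF cte] by (cases "T - t = 0") auto
    qed
    ultimately show ?thesis using q0e cy y e' by auto
  qed
  \<comment> \<open>The first point of the critical orbit below \<open>y0\<close> lies in the window
    too. It serves as the companion for all times of the passage, so closeness is just the width of
    the window times the Lipschitz constant.\<close>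
  obtain k where k: "(F ^^ k) 0 \<in> {q0..y0}"
  proof -
    obtain i where "\<not> chain i 0" using exit[of 0] x0 by auto
    moreover have "0 \<in> {x..0}" using x0 by simp
    ultimately obtain i' where "(F ^^ i') 0 < x" using chainI[of 0 i] by (meson not_le)
    then have ex0: "\<exists>i. (F ^^ i) 0 < y0" using y0 by (intro exI[of _ i']) linarith
    define k where "k = (LEAST i. (F ^^ i) 0 < y0)"
    have k1: "(F ^^ k) 0 < y0" unfolding k_def by (rule LeastI_ex[OF ex0])
    have kl: "(F ^^ i) 0 \<ge> y0" if "i < k" for i using not_less_Least[of i "\<lambda>i. (F ^^ i) 0 < y0"] that by (simp add: k_def)
    have "k \<noteq> 0" using k1 y0 by (metis funpow_0 less_asym)
    then obtain k' where k': "k = Suc k'" by (cases k) auto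
    have "chain k 0" by (rule chainI) (use kl y0 x0 in force)+
    then have r: "(F ^^ k') 0 \<in> {x..0}" by (simp add: k' chain_Suc)
    have "F y0 \<le> (F ^^ k) 0" using F_le[OF y0x r] kl[of k'] k' by simp
    moreover have "q0 \<le> e" using region[of 0 e] ee' by simp
    ultimately show ?thesis using that[of k] k1 e by simp
  qed
  \<comment> \<open>\<open>[a, x0']\<close> is mapped onto \<open>[a, -a]\<close> by
    \<open>g^2\<close>; its preimage in \<open>[e, e']\<close> becomes the interval of the gate,
    with left end \<open>e\<close>.\<close>
  obtain x0' where x0': "a \<le> x0'" "x0' \<le> x" "(g a ^^ 2) x0' = - a"
    using IVT'[of "g a ^^ 2" a "- a" x] g2x ax a_neg unicritical_iterate_continuous_real
    by (auto simp del: One_nat_def)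
  have x0'0: "x0' < 0" using x0' y0 by linarith
  have Fne: "(F ^^ Suc n) e = a" using e(3) Fx by simp
  obtain j2 where j2: "e \<le> j2" "j2 \<le> e'" "(F ^^ Suc n) j2 = x0'"
    using IVT'[OF _ _ _ continuous_F[where n="Suc n"], of e x0' e'] Fne Fne' x0' ee' by (auto simp del: funpow.simps)
  have j20: "j2 < 0" using j2 e'0 by linarith
  define N1 where "N1 = m * Suc n + 2"
  have gN1: "(g a ^^ N1) y = (g a ^^ 2) ((F ^^ Suc n) y)" for y unfolding N1_def by (rule iterate_split)
  have sm: "strict_mono_on {e..0} (F ^^ Suc n)" by (rule chain_strict_mono_on[OF che2])
  have Fr: "(F ^^ Suc n) y \<in> {a..x0'}" if "y \<in> {e..j2}" for y
    using strict_mono_on_leD[OF sm, of e y] strict_mono_on_leD[OF sm, of y j2] that j20 Fne j2 e0 by auto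
  have smN: "strict_mono_on {e..j2} (g a ^^ N1)"
  proof (rule strict_mono_onI)
    fix u v assume uv: "u \<in> {e..j2}" "v \<in> {e..j2}" "u < v"
    have "(F ^^ Suc n) u < (F ^^ Suc n) v" by (rule strict_mono_onD[OF sm]) (use uv j20 in auto)
    then show "(g a ^^ N1) u < (g a ^^ N1) v" unfolding gN1
      using Fr[OF uv(1)] Fr[OF uv(2)] x0'0 by (intro g2_increasing[OF good]) auto
  qed
  have ends: "(g a ^^ N1) e = a" "(g a ^^ N1) j2 = - a" unfolding gN1 Fne j2(3) x0'(3) by simp_all
  obtain y1 where y1: "e \<le> y1" "y1 \<le> j2" "(g a ^^ N1) y1 = a / 2"
    using IVT'[of "g a ^^ N1" e "a/2" j2] ends a_neg j2 unicritical_iterate_continuous_real by auto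
  obtain y2 where y2: "e \<le> y2" "y2 \<le> j2" "(g a ^^ N1) y2 = - a / 2"
    using IVT'[of "g a ^^ N1" e "-a/2" j2] ends a_neg j2 unicritical_iterate_continuous_real by auto
  have o1: "e < y1" using y1 ends a_neg by (cases "e = y1") auto
  have o3: "y2 < j2" using y2 ends a_neg by (cases "y2 = j2") auto
  have o2: "y1 < y2"
  proof (rule ccontr)
    assume "\<not> y1 < y2"
    then have "(g a ^^ N1) y2 \<le> (g a ^^ N1) y1" using strict_mono_on_leD[OF smN, of y2 y1] y1 y2 by auto
    then show False using y1 y2 a_neg by simp
  qed
  have nz: "(g a ^^ i) y \<noteq> 0" if i: "i < N1" and y: "y \<in> {e..j2}" for i y
  proof (cases "i < m * Suc n")
    case True
    define t r where "t = i div m" and "r = i mod m"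
    have ir: "i = m * t + r" "r < m" using m1 by (simp_all add: t_def r_def)
    have tn: "t < Suc n" using True ir m1 by (metis div_less_iff_less_mult t_def mult.commute less_le_trans zero_less_one)
    have cy: "chain (Suc n) y" using chain_mono[OF che2, of y] y j20 by auto
    have Ft: "(F ^^ t) y \<in> {x..0}" using cy tn by (auto simp: chain_def)
    have "(F ^^ t) y \<le> y" using below[of t y] cy tn by (cases "t = 0") (auto simp: chain_def)
    then have "(F ^^ t) y < 0" using y j20 by auto
    then show ?thesis unfolding ir(1) iterate_split using nonzero[OF _ ir(2) Ft] by (cases "r = 0") auto
  next
    case False
    then have "i = m * Suc n + 0 \<or> i = m * Suc n + 1" using i by (auto simp: N1_def)
    then show ?thesis
    proof
      assume "i = m * Suc n + 0"
      then show ?thesis using Fr[OF y] x0'0 unfolding iterate_split by (simp only: iterate_split) auto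
    next
      assume i1: "i = m * Suc n + 1"
      have "g a ((F ^^ Suc n) y) \<le> a" using Fr[OF y] x0'0 a_neg by (intro g_le) auto
      then show ?thesis unfolding i1 iterate_split using a_neg by simp
    qed
  qed
  define N0 where "N0 = m * T"
  have N01: "N0 \<le> N1" unfolding N0_def N1_def nT(1) by (simp add: add_mult_distrib2)
  have Lp: "L ^ i \<ge> 1" for i using L_ge1 by (rule one_le_power)
  have close: "\<exists>n. \<forall>y\<in>{e..j2}. \<bar>(g a ^^ i) y - (g a ^^ n) 0\<bar> \<le> \<epsilon>" if i: "i \<le> N0" for i
  proof -
    define t r where "t = i div m" and "r = i mod m"
    have ir: "i = m * t + r" "r < m" using m1 by (simp_all add: t_def r_def)
    have tT: "t \<le> T"
    proof -
      have "m * t \<le> m * T" using i ir unfolding N0_def by linarith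
      then show ?thesis using m1 by simp
    qed
    have "\<bar>(g a ^^ i) y - (g a ^^ (m * k + r)) 0\<bar> \<le> \<epsilon>" if y: "y \<in> {e..j2}" for y
    proof -
      have Ft: "(F ^^ t) y \<in> {q0..y0}" by (rule region[OF tT]) (use y j2 in auto)
      have "\<bar>(g a ^^ i) y - (g a ^^ (m * k + r)) 0\<bar> \<le> L ^ r * \<bar>(F ^^ t) y - (F ^^ k) 0\<bar>"
        unfolding ir(1) iterate_split using Ft k y0 ax by (intro lipschitz) auto
      also have "\<dots> \<le> L ^ m * (y0 - q0)"
      proof (rule mult_mono)
        show "L ^ r \<le> L ^ m" using ir L_ge1 by (intro power_increasing) auto
        show "\<bar>(F ^^ t) y - (F ^^ k) 0\<bar> \<le> y0 - q0" using Ft k by auto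
      qed (use Lp[of m] in auto)
      finally show ?thesis using small by linarith
    qed
    then show ?thesis by blast
  qed
  \<comment> \<open>At most \<open>s + 2\<close> further iterates of \<open>F\<close> send the
    images of the two neighbours onto \<open>[a, x]\<close>, which has length at least
    \<open>1 / L ^ 2\<close> because \<open>g^2\<close> stretches it to length at least 1. The
    Lipschitz bound then gives length at least \<sigma>, whatever \<open>T\<close> is.\<close>
  define \<sigma> where "\<sigma> = 1 / L ^ (m * (s + 2) + 2)"
  have sp: "\<sigma> > 0" using L_ge1 by (simp add: \<sigma>_def)
  have xa: "1 \<le> L ^ 2 * (x - a)"
  proof -
    have "(g a ^^ 2) x - (g a ^^ 2) a \<le> \<bar>(g a ^^ 2) x - (g a ^^ 2) a\<bar>" by simp
    also have "\<dots> \<le> L ^ 2 * \<bar>x - a\<bar>" using ax x0 by (intro lipschitz) auto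
    finally have "- a - a \<le> L ^ 2 * (x - a)" using g2x ax by simp
    then show ?thesis using good_bounds(2)[OF good] by linarith
  qed
  have gap: "p - q \<ge> \<sigma>" if "i \<le> s + 2" "p \<in> {a..0}" "q \<in> {a..0}" "(F ^^ i) p = x" "(F ^^ i) q = a" "q \<le> p" for i p q
  proof -
    have "x - a \<le> L ^ (m * i) * (p - q)"
      using lipschitz[OF that(2,3), of "m * i"] that(4-6) ax by (simp add: F_funpow)
    also have "\<dots> \<le> L ^ (m * (s + 2)) * (p - q)"
    proof (intro mult_right_mono power_increasing)
      show "m * i \<le> m * (s + 2)" using that(1) by (rule mult_le_mono2)
    qed (use L_ge1 that in auto)
    finally have "L ^ 2 * (x - a) \<le> L ^ 2 * (L ^ (m * (s + 2)) * (p - q))" using L_ge1 by (intro mult_left_mono) auto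
    then have "1 \<le> L ^ (m * (s + 2) + 2) * (p - q)" using xa by (simp only: power_add mult_ac)
    then show ?thesis using Lp[of "m * (s + 2) + 2"] by (simp add: \<sigma>_def divide_le_eq mult.commute)
  qed
  have n2: "chain (n - 1) (F e)" if "n \<ge> 2" using chain_shift[of "n - 1" e] che that by simp
  have chTu: "chain T (F e)"
  proof (cases "T = 0")
    case False
    then have "n \<ge> 2" "T \<le> n - 1" using nT s(1) by auto
    then show ?thesis using n2 chain_le by blast
  next
    case True
    have "F e \<in> {x..0}" using che n0 e Feu e0 xe nT(2) I(2) True by simp
    then show ?thesis using True by (simp add: chain_def)
  qed
  have FT: "(F ^^ T) z \<in> {a..0}" if "z \<in> {F e..0}" for z
    using chain_mono[OF chTu, of z] chain_range[of T z] that by auto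
  have smT: "strict_mono_on {F e..0} (F ^^ T)" by (rule chain_strict_mono_on[OF chTu])
  have leT: "(F ^^ T) y \<le> (F ^^ T) z" if "F e \<le> y" "y \<le> z" "z \<le> 0" for y z
    using strict_mono_on_leD[OF smT, of y z] that by auto
  have g1: "(F ^^ T) e - (F ^^ T) (F e) \<ge> \<sigma>"
  proof (rule gap[of s])
    show "(F ^^ s) ((F ^^ T) e) = x" unfolding FnT by (rule e)
    show "(F ^^ s) ((F ^^ T) (F e)) = a" unfolding FnT using Fne by (simp only: shift)
  qed (use FT Feu e0 leT in auto)
  have g2: "(F ^^ T) e'' - (F ^^ T) e' \<ge> \<sigma>"
  proof (rule gap[of "s + 2"])
    have *: "(F ^^ (s + 2)) ((F ^^ T) z) = (F ^^ (n + 2)) z" for z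
    proof -
      have "n + 2 = s + 2 + T" using nT by simp
      then show ?thesis by (simp only: funpow_add o_apply)
    qed
    show "(F ^^ (s + 2)) ((F ^^ T) e'') = x" unfolding * by (rule Fne'')
    show "(F ^^ (s + 2)) ((F ^^ T) e') = a" unfolding * using Fne' Fx by simp
  qed (use FT Feu e0 leT ee' e'0 e'e'' e'' in auto)
  \<comment> \<open>The entering interval and \<open>[y1, y2]\<close> inside it are compared under
    \<open>F ^^ T\<close>. The neighbours \<open>[F e, e]\<close> and \<open>[e', e'']\<close>
    supply Koebe space \<sigma> on both sides.\<close>
  have "(e' - e) * ((g a ^^ (m * T)) y2 - (g a ^^ (m * T)) y1) \<le>
     exp (koebe / \<sigma> * ((F ^^ T) e'' - (F ^^ T) (F e))) * ((g a ^^ (m * T)) e' - (g a ^^ (m * T)) e) * (y2 - y1)"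
  proof (rule real_koebe_lengths[OF even_l l2 _ _ _ sp, where u="F e" and v="e''"])
    show "strict_mono_on {F e<..<e''} (g a ^^ (m * T))"
      unfolding F_funpow[symmetric]
    proof (rule strict_mono_onI)
      fix y z assume "y \<in> {F e<..<e''}" "z \<in> {F e<..<e''}" "y < z"
      then show "(F ^^ T) y < (F ^^ T) z" using e'' by (intro strict_mono_onD[OF smT]) auto
    qed
    show "{(F ^^ T) (F e)<..<(F ^^ T) e''} \<subseteq> (g a ^^ (m * T)) ` {F e<..<e''}"
    proof
      fix w assume w: "w \<in> {(F ^^ T) (F e)<..<(F ^^ T) e''}"
      then obtain z where z: "F e \<le> z" "z \<le> e''" "(F ^^ T) z = w"
        using IVT'[of "F ^^ T" "F e" w e''] Feu ee' e'e'' continuous_F by (auto simp: less_imp_le)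
      moreover have "z \<noteq> F e" "z \<noteq> e''" using w z by auto
      ultimately show "w \<in> (g a ^^ (m * T)) ` {F e<..<e''}"
        unfolding F_funpow[symmetric] by (intro image_eqI[of _ _ z]) auto
    qed
    show "(g a ^^ i) y \<noteq> 0" if i: "i < m * T" and y: "y \<in> {F e<..<e''}" for i y
    proof -
      define t r where "t = i div m" and "r = i mod m"
      have ir: "i = m * t + r" "r < m" using m1 by (simp_all add: t_def r_def)
      have tT: "t < T" using i ir m1 by (metis div_less_iff_less_mult t_def mult.commute less_le_trans zero_less_one)
      have cy: "chain T y" using chain_mono[OF chTu, of y] y e'' by auto
      have Ft: "(F ^^ t) y \<in> {x..0}" using cy tT by (auto simp: chain_def)
      have "(F ^^ t) y \<le> y" using below[of t y] chain_le[OF cy] tT by (cases "t = 0") auto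
      then have "(F ^^ t) y < 0" using y e'' by auto
      then show ?thesis unfolding ir(1) iterate_split using nonzero[OF _ ir(2) Ft] by (cases "r = 0") auto
    qed
    show "(F ^^ T) (F e) + \<sigma> \<le> (g a ^^ (m * T)) e" using g1 by (simp add: F_funpow)
    show "(g a ^^ (m * T)) e' \<le> (F ^^ T) e'' - \<sigma>" using g2 by (simp add: F_funpow)
    show "(F ^^ T) (F e) + \<sigma> \<le> (g a ^^ (m * T)) y1"
      using g1 leT[of e y1] Feu o1 o2 y2 j20 by (simp add: F_funpow)
    show "(g a ^^ (m * T)) y2 \<le> (F ^^ T) e'' - \<sigma>"
      using g2 leT[of y2 e'] Feu o1 o2 o3 j2 e'0 by (simp add: F_funpow)
  qed (use Feu ee' e'e'' o1 o2 o3 j2 in auto)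
  then have K: "(e' - e) * ((F ^^ T) y2 - (F ^^ T) y1) \<le>
     exp (koebe / \<sigma> * ((F ^^ T) e'' - (F ^^ T) (F e))) * ((F ^^ T) e' - (F ^^ T) e) * (y2 - y1)"
    by (simp add: F_funpow)
  have k1: "e' - e \<ge> \<tau>" using tau(2)[of e'] e' by auto
  \<comment> \<open>The remaining iterates, whose number does not involve \<open>T\<close>, stretch
    this image to \<open>[a / 2, - a / 2]\<close>, of length at least 1/2.\<close>
  have k2: "(F ^^ T) y2 - (F ^^ T) y1 \<ge> 1 / (2 * L ^ (m * (s + 1) + 2))"
  proof -
    have N: "N1 = m * (s + 1) + 2 + m * T" using nT by (simp add: N1_def algebra_simps)
    have *: "(g a ^^ N1) z = (g a ^^ (m * (s + 1) + 2)) ((F ^^ T) z)" for z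
      unfolding N F_funpow by (simp add: funpow_add)
    have m12: "(F ^^ T) y1 \<le> (F ^^ T) y2" using leT[of y1 y2] Feu o1 o2 y2 j20 by simp
    have "- a = (g a ^^ N1) y2 - (g a ^^ N1) y1" using y1 y2 by simp
    also have "\<dots> \<le> L ^ (m * (s + 1) + 2) * ((F ^^ T) y2 - (F ^^ T) y1)"
      unfolding * using lipschitz[OF FT[of y2] FT[of y1], of "m * (s + 1) + 2"] Feu o1 o2 o3 j20 m12 by (simp add: abs_le_iff)
    finally have "1 / 2 \<le> L ^ (m * (s + 1) + 2) * ((F ^^ T) y2 - (F ^^ T) y1)" using good_bounds(2)[OF good] by linarith
    then show ?thesis using Lp[of "m * (s + 1) + 2"] by (simp add: divide_le_eq mult_ac)
  qed
  have k3: "exp (koebe / \<sigma> * ((F ^^ T) e'' - (F ^^ T) (F e))) \<le> exp (koebe * L ^ (m * (s + 2) + 2))"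
  proof -
    have "(F ^^ T) e'' - (F ^^ T) (F e) \<le> 1"
      using FT[of e''] FT[of "F e"] good_bounds(1)[OF good] Feu e0 ee' e'e'' e'' by auto
    then have "koebe / \<sigma> * ((F ^^ T) e'' - (F ^^ T) (F e)) \<le> koebe / \<sigma> * 1"
      using koebe_pos sp by (intro mult_left_mono) auto
    then show ?thesis by (simp add: \<sigma>_def)
  qed
  have k4: "(F ^^ T) e' - (F ^^ T) e \<le> 1" using FT[of e'] FT[of e] good_bounds(1)[OF good] Feu e0 ee' e'0 by auto
  have "\<tau> * (1 / (2 * L ^ (m * (s + 1) + 2))) \<le> (e' - e) * ((F ^^ T) y2 - (F ^^ T) y1)"
    using k1 k2 tau(1) L_ge1 by (intro mult_mono) auto
  also have "\<dots> \<le> exp (koebe / \<sigma> * ((F ^^ T) e'' - (F ^^ T) (F e))) * ((F ^^ T) e' - (F ^^ T) e) * (y2 - y1)" by (rule K)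
  also have "\<dots> \<le> exp (koebe * L ^ (m * (s + 2) + 2)) * 1 * (y2 - y1)"
    using k3 k4 o2 leT[of e e'] Feu ee' e'0 by (intro mult_right_mono mult_mono) auto
  finally have Dm: "\<tau> * (1 / (2 * L ^ (m * (s + 1) + 2))) \<le> (y2 - y1) * exp (koebe * L ^ (m * (s + 2) + 2))"
    by (simp only: mult_1_right mult.commute)
  have Dle: "D \<le> y2 - y1" unfolding D by (simp only: pos_divide_le_eq[OF exp_gt_zero] Dm)
  have D0: "D \<ge> 0" unfolding D using tau(1) L_ge1 by simp
  have "real \<kappa> \<le> real (I - s) * D ^ \<kappa>" by (rule big)
  also have "\<dots> \<le> real N0 * (y2 - y1) ^ \<kappa>"
  proof (rule mult_mono)
    have "1 * T \<le> m * T" using m1 by (intro mult_right_mono) auto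
    then have "I - s \<le> N0" using nT(2) unfolding N0_def mult_1 by (rule order_trans[rotated])
    then show "real (I - s) \<le> real N0" by (rule of_nat_mono)
    show "D ^ \<kappa> \<le> (y2 - y1) ^ \<kappa>" using Dle D0 by (intro power_mono)
  qed (use D0 in auto)
  finally have last: "real N0 * (y2 - y1) ^ \<kappa> \<ge> real \<kappa>" .
  have "\<forall>i<N1. \<forall>y\<in>{e..j2}. (g a ^^ i) y \<noteq> 0" using nz by blast
  moreover have "\<forall>i\<le>N0. \<exists>n. \<forall>y\<in>{e..j2}. \<bar>(g a ^^ i) y - (g a ^^ n) 0\<bar> \<le> \<epsilon>" using close by blast
  ultimately have "x \<le> e \<and> e < y1 \<and> y1 < y2 \<and> y2 < j2 \<and> j2 < 0 \<and> N0 \<le> N1 \<and>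
     (g a ^^ N1) e = a \<and> (g a ^^ N1) j2 = - a \<and> (g a ^^ N1) y1 = a / 2 \<and> (g a ^^ N1) y2 = - a / 2 \<and>
     strict_mono_on {e..j2} (g a ^^ N1) \<and> (\<forall>i<N1. \<forall>y\<in>{e..j2}. (g a ^^ i) y \<noteq> 0) \<and>
     (\<forall>i\<le>N0. \<exists>n. \<forall>y\<in>{e..j2}. \<bar>(g a ^^ i) y - (g a ^^ n) 0\<bar> \<le> \<epsilon>) \<and>
     real N0 * (y2 - y1) ^ \<kappa> \<ge> real \<kappa>"
    using xe o1 o2 o3 j20 N01 ends y1(3) y2(3) smN last by (intro conjI)
  then show ?thesis unfolding gate_def
    by (intro exI[of _ e] exI[of _ j2] exI[of _ y1] exI[of _ y2] exI[of _ N0] exI[of _ N1])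
qed

end

section \<open>Opening a gate\<close>

lemma right_neighbourhood:
  fixes h :: "real \<Rightarrow> real"
  assumes "continuous_on {s..t} h" "s \<le> a" "a < t" "h a > 0"
  obtains b where "a < b" "b \<le> t" "\<And>u. a \<le> u \<Longrightarrow> u \<le> b \<Longrightarrow> h u > 0"
proof -
  have "a \<in> {s..t}" using assms by simp
  then obtain d where d: "d > 0" "\<And>u. u \<in> {s..t} \<Longrightarrow> dist u a < d \<Longrightarrow> dist (h u) (h a) < h a"
    using assms(1,4) unfolding continuous_on_iff by metis
  define b where "b = min t (a + d / 2)"
  have "h u > 0" if "a \<le> u" "u \<le> b" for u
  proof -
    have "u \<in> {s..t}" "dist u a < d" using that assms d(1) by (auto simp: b_def dist_real_def)
    then show ?thesis using d(2)[of u] by (simp add: dist_real_def abs_if split: if_splits)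
  qed
  then show ?thesis using that[of b] assms d(1) by (auto simp: b_def)
qed

lemma polynomial_iterate: "\<exists>P. \<forall>y. poly P y = (unicritical l (c::real) ^^ n) y"
proof (induction n)
  case 0
  then show ?case by (intro exI[of _ "[:0, 1:]"]) simp
next
  case (Suc n)
  then obtain P where "\<forall>y. poly P y = (unicritical l c ^^ n) y" by blast
  then have "poly (P ^ l + [:c:]) y = (unicritical l c ^^ Suc n) y" for y by (simp add: unicritical_def[of l c "_ y"])
  then show ?case by blast
qed

lemma decseq_fixed_point:
  fixes h :: "real \<Rightarrow> real"
  assumes "continuous_on UNIV h" "\<And>n. (h ^^ Suc n) y \<le> (h ^^ n) y" "\<And>n. b \<le> (h ^^ n) y"
  obtains z where "h z = z" "b \<le> z" "z \<le> y"
proof -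
  have dec: "decseq (\<lambda>n. (h ^^ n) y)" by (rule decseq_SucI) (rule assms(2))
  obtain z where z: "(\<lambda>n. (h ^^ n) y) \<longlonglongrightarrow> z"
    using decseq_convergent[OF dec, of b] assms(3) by metis
  have "(\<lambda>n. h ((h ^^ n) y)) \<longlonglongrightarrow> h z"
    by (rule continuous_on_tendsto_compose[OF assms(1) z]) auto
  moreover have "(\<lambda>n. h ((h ^^ n) y)) \<longlonglongrightarrow> z" using LIMSEQ_Suc[OF z] by simp
  ultimately have "h z = z" using LIMSEQ_unique by blast
  moreover have "b \<le> z" using assms(3) by (intro LIMSEQ_le_const[OF z]) auto
  moreover have "z \<le> y" using decseq_ge[OF dec z, of 0] by simp
  ultimately show ?thesis using that by blast
qed

lemma incseq_fixed_point:
  fixes h :: "real \<Rightarrow> real"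
  assumes "continuous_on UNIV h" "\<And>n. (h ^^ n) y \<le> (h ^^ Suc n) y" "\<And>n. (h ^^ n) y \<le> b"
  obtains z where "h z = z" "y \<le> z" "z \<le> b"
proof -
  have inc: "incseq (\<lambda>n. (h ^^ n) y)" by (rule incseq_SucI) (rule assms(2))
  obtain z where z: "(\<lambda>n. (h ^^ n) y) \<longlonglongrightarrow> z"
    using incseq_convergent[OF inc, of b] assms(3) by metis
  have "(\<lambda>n. h ((h ^^ n) y)) \<longlonglongrightarrow> h z"
    by (rule continuous_on_tendsto_compose[OF assms(1) z]) auto
  moreover have "(\<lambda>n. h ((h ^^ n) y)) \<longlonglongrightarrow> z" using LIMSEQ_Suc[OF z] by simp
  ultimately have "h z = z" using LIMSEQ_unique by blast
  moreover have "z \<le> b" using assms(3) by (intro LIMSEQ_le_const2[OF z]) auto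
  moreover have "y \<le> z" using incseq_le[OF inc z, of 0] by simp
  ultimately show ?thesis using that by blast
qed

context even_degree begin

text \<open>At the parameter \<open>t\<close> the fixed point is \<open>t\<close> itself, so the
  last equation says that the critical point lands on the fixed point. Continuity of
  \<open>X\<close> lets inequalities persist under small changes of the parameter.\<close>

definition stage :: "nat \<Rightarrow> real \<Rightarrow> real \<Rightarrow> (real \<Rightarrow> real) \<Rightarrow> bool" where
  "stage m s t X \<longleftrightarrow> s < t \<and> continuous_on {s..t} X \<and> (\<forall>a\<in>{s..t}. branch l a (X a) m) \<and>
     (g s ^^ m) 0 = 0 \<and> (g t ^^ m) 0 = t"

lemma iterate_grow: assumes "y \<ge> 2 + \<bar>a - a ^ l\<bar>" shows "(g a ^^ n) y \<ge> y + real n"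
proof (induction n)
  case (Suc n)
  define c where "c = a - a ^ l"
  define z where "z = (g a ^^ n) y"
  have z: "z \<ge> y + real n" using Suc by (simp add: z_def)
  then have z2: "z \<ge> 2 + \<bar>c\<bar>" using assms by (simp add: c_def)
  have "z ^ 2 \<le> z ^ l" using z2 l2 by (intro power_increasing) auto
  moreover have "2 * z \<le> z ^ 2" using z2 by (simp add: power2_eq_square mult_right_mono)
  ultimately have "z ^ l + c \<ge> z + 1" using z2 by linarith
  then have "g a z \<ge> z + 1" by (simp add: unicritical_def c_def)
  then show ?case using z by (simp add: z_def)
qed simp

text \<open>An iterate is a polynomial, and not the identity because it moves large points.
  Finiteness provides a least fixed point at the threshold and points next to it that are not
  fixed.\<close>

lemma fixed_points_finite:
  assumes "m \<ge> 1" shows "finite {y. (g a ^^ m) y = y}"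
proof -
  obtain P where P: "\<And>y. poly P y = (g a ^^ m) y" using polynomial_iterate by metis
  have "P - [:0, 1:] \<noteq> 0"
  proof
    assume "P - [:0, 1:] = 0"
    then have "poly P (2 + \<bar>a - a ^ l\<bar>) = 2 + \<bar>a - a ^ l\<bar>" by simp
    then show False using iterate_grow[of a "2 + \<bar>a - a ^ l\<bar>" m] assms P by simp
  qed
  then have "finite {y. poly (P - [:0, 1:]) y = 0}" by (rule poly_roots_finite)
  then show ?thesis by (simp add: P)
qed

end

locale stage_ctx = even_degree +
  fixes m :: nat and s t :: real and X :: "real \<Rightarrow> real"
  assumes st: "stage m s t X"
begin

lemma s_less_t: "s < t" and contX: "continuous_on {s..t} X" and F_s: "(g s ^^ m) 0 = 0" and F_t: "(g t ^^ m) 0 = t"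
  using st by (auto simp: stage_def)

lemma br: "a \<in> {s..t} \<Longrightarrow> branch l a (X a) m" using st by (auto simp: stage_def)

lemma m_ge1: "m \<ge> 1" using branch.m1[OF br[of s]] s_less_t by simp

lemma contF:
  assumes "continuous_on S Y" shows "continuous_on S (\<lambda>a. ((g a ^^ m) ^^ n) (Y a))"
  unfolding funpow_mult by (intro continuous_on_family continuous_on_id assms)

lemma contF_at: "continuous_on UNIV ((g a ^^ m) ^^ n)"
  unfolding funpow_mult by (rule unicritical_iterate_continuous_real)

abbreviation Q :: "nat \<Rightarrow> real \<Rightarrow> real" where "Q n a \<equiv> ((g a ^^ m) ^^ n) 0"

lemma contQ: "continuous_on S (Q n)" by (rule contF[OF continuous_on_const])

definition confined :: "real set" where "confined = {a\<in>{s..t}. \<forall>n. X a \<le> Q n a}"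

text \<open>The gate opens at the last parameter for which the critical orbit does not escape from \<open>[X, 0]\<close>.\<close>

definition ac :: real where "ac = Sup confined"

lemma confined_closed: "closed confined"
proof -
  have "confined = (\<Inter>n. {a\<in>{s..t}. X a \<le> Q n a})" by (auto simp: confined_def)
  moreover have "closed {a\<in>{s..t}. X a \<le> Q n a}" for n
    by (intro continuous_on_closed_Collect_le contX contQ closed_atLeastAtMost)
  ultimately show ?thesis using closed_INT[of UNIV "\<lambda>n. {a\<in>{s..t}. X a \<le> Q n a}"] by simp
qed

lemma s_confined: "s \<in> confined"
proof -
  have "Q n s = 0" for n by (induction n) (simp_all add: F_s)
  then show ?thesis using s_less_t branch.x0[OF br[of s]] by (simp add: confined_def)
qed

lemma ac_confined: "ac \<in> confined"
  unfolding ac_def using s_confined confined_closed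
  by (intro closed_contains_Sup) (auto simp: confined_def intro!: bdd_aboveI[of _ t])

lemma ac_bounds: "s \<le> ac" "ac < t"
proof -
  have "t \<notin> confined"
  proof
    assume "t \<in> confined"
    then have "X t \<le> Q 1 t" unfolding confined_def by blast
    then show False using branch.ax[OF br[of t]] s_less_t F_t by simp
  qed
  then show "s \<le> ac" "ac < t" using ac_confined by (auto simp: confined_def less_le)
qed

lemma escapes: assumes "ac < a" "a \<le> t" shows "\<exists>n. Q n a < X a"
proof (rule ccontr)
  assume "\<not> ?thesis"
  then have "a \<in> confined" using assms ac_bounds by (auto simp: confined_def not_less)
  then have "a \<le> ac" unfolding ac_def
    by (intro cSup_upper) (auto simp: confined_def intro!: bdd_aboveI[of _ t])
  then show False using assms by simp
qed

text \<open>A point with \<open>F y \<ge> y\<close> would be a barrier: by monotonicity the critical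
  orbit, starting above it, could never get below it, although past \<open>ac\<close> it must
  escape.\<close>

lemma below_diagonal:
  assumes a: "ac < a" "a \<le> t" and y: "y \<in> {X a..0}" shows "(g a ^^ m) y < y"
proof (rule ccontr)
  assume neg: "\<not> ?thesis"
  have "a \<in> {s..t}" using a ac_bounds by simp
  then interpret branch l a "X a" m by (rule br)
  have "Q n a \<in> {X a..0} \<and> Q n a \<ge> y" for n
  proof (induction n)
    case (Suc n)
    then have "F y \<le> F (Q n a)" using y by (intro F_le) auto
    then show ?case using Suc neg y F_range[of "Q n a"] by auto
  qed (use y in auto)
  then have "X a \<le> Q n a" for n by (meson atLeastAtMost_iff)
  then show False using escapes[OF a] by (meson not_le)
qed

lemma ac_in: "ac \<in> {s..t}" using ac_bounds by simp

lemma near_ac: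
  assumes "continuous_on {s..t} h" "continuous_on {s..t} k" "h ac < (k ac :: real)"
  obtains b where "ac < b" "b \<le> t" "\<And>u. ac \<le> u \<Longrightarrow> u \<le> b \<Longrightarrow> h u < k u"
proof -
  have "continuous_on {s..t} (\<lambda>u. k u - h u)" "k ac - h ac > 0" using assms by (auto intro: continuous_on_diff)
  then obtain b where "ac < b" "b \<le> t" "\<And>u. ac \<le> u \<Longrightarrow> u \<le> b \<Longrightarrow> k u - h u > 0"
    using right_neighbourhood[OF _ ac_bounds] by blast
  then show ?thesis using that[of b] by simp
qed

lemma below_diagonal_ac:
  assumes y: "y \<in> {X ac..0}" shows "(g ac ^^ m) y \<le> y"
proof (rule ccontr)
  assume neg: "\<not> ?thesis"
  interpret branch l ac "X ac" m by (rule br[OF ac_in])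
  have "y \<noteq> X ac" using neg Fx ax by auto
  then have yX: "X ac < y" using y by simp
  have cF: "continuous_on {s..t} (\<lambda>a. (g a ^^ m) y)" using contF[of "{s..t}" "\<lambda>_. y" 1] by simp
  have "y < (g ac ^^ m) y" using neg by simp
  then obtain b where b: "ac < b" "b \<le> t" "\<And>u. ac \<le> u \<Longrightarrow> u \<le> b \<Longrightarrow> y < (g u ^^ m) y"
    by (rule near_ac[OF continuous_on_const cF]) blast
  obtain b' where b': "ac < b'" "b' \<le> t" "\<And>u. ac \<le> u \<Longrightarrow> u \<le> b' \<Longrightarrow> X u < y"
    by (rule near_ac[OF contX continuous_on_const yX]) blast
  let ?u = "min b b'"
  have "(g ?u ^^ m) y < y"
  proof (rule below_diagonal)
    have "X ?u < y" by (rule b'(3)) (use b b' in auto)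
    then show "y \<in> {X ?u..0}" using y by simp
  qed (use b b' in auto)
  moreover have "y < (g ?u ^^ m) y" by (rule b(3)) (use b b' in auto)
  ultimately show False by simp
qed

text \<open>If \<open>F\<close> fixed \<open>0\<close>, its derivative there would vanish, so
  \<open>F\<close> would lie above the diagonal just left of \<open>0\<close>, against the limit of
  the previous estimate.\<close>

lemma Q1_ac_neg: "(g ac ^^ m) 0 < 0"
proof (rule ccontr)
  assume neg: "\<not> ?thesis"
  interpret branch l ac "X ac" m by (rule br[OF ac_in])
  have F00: "F 0 = 0" using neg F0 by simp
  have X0: "X ac < 0" using F00 Fx a_neg x0 by (cases "X ac = 0") auto
  have "orbit_deriv l (ac - ac ^ l) m 0 = 0"
    unfolding orbit_deriv_def using m1 l2 by (intro prod_zero) (auto intro!: bexI[of _ 0] simp: power_0_left)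
  then have "(F has_real_derivative 0) (at 0)"
    using iterate_has_derivative[where l=l and c="ac - ac ^ l" and n=m and z=0] by simp
  then have "((\<lambda>h. (F (0 + h) - F 0) / h) \<longlongrightarrow> 0) (at 0)" by (rule DERIV_D)
  then have "\<forall>\<^sub>F h in at 0. dist ((F (0 + h) - F 0) / h) 0 < 1"
    by (rule tendstoD) simp
  then obtain d where d: "d > 0" "\<And>h. h \<noteq> 0 \<Longrightarrow> \<bar>h\<bar> < d \<Longrightarrow> \<bar>F h / h\<bar> < 1"
    unfolding eventually_at by (auto simp: F00)
  define h where "h = max (- d / 2) (X ac)"
  have h: "h < 0" "\<bar>h\<bar> < d" "h \<in> {X ac..0}" using d(1) X0 by (auto simp: h_def)
  have "F h \<le> h" by (rule below_diagonal_ac[OF h(3)])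
  then have "\<bar>F h / h\<bar> \<ge> 1" using h(1) by (simp add: field_simps)
  then show False using d(2)[of h] h by auto
qed

text \<open>The order of choices matters. First come the window and the escape time \<open>k\<close>
  at the threshold, then a range of parameters with a uniform \<tau>. These determine
  \<open>D\<close>, \<open>D\<close> determines the time \<open>I\<close>, and only \<open>I\<close>
  decides how close to \<open>ac\<close> the parameter has to be.\<close>

lemma gate_near:
  assumes eps: "\<epsilon> > 0"
  shows "\<exists>b. ac < b \<and> b \<le> t \<and> (\<forall>a. ac < a \<longrightarrow> a \<le> b \<longrightarrow> gate a (X a) \<epsilon> \<kappa>)"
proof -
  interpret ac: branch l ac "X ac" m by (rule br[OF ac_in])
  let ?F = "g ac ^^ m"
  have conf: "X ac \<le> Q n ac" for n using ac_confined by (simp add: confined_def)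
  have chQ: "ac.chain n 0" for n using ac.chainI[of 0] conf ac.x0 by simp
  have Fle: "?F y \<le> y" if "y \<in> {X ac..0}" for y by (rule below_diagonal_ac[OF that])
  define Z where "Z = {y\<in>{X ac..0}. ?F y = y}"
  have finZ: "finite Z" unfolding Z_def using fixed_points_finite[OF m_ge1, of ac] by (rule rev_finite_subset) auto
  have contF1: "continuous_on UNIV ?F" using contF_at[where a=ac and n=1] by simp
  have neZ: "Z \<noteq> {}"
  proof -
    have "Q n ac \<in> {X ac..0}" for n using chQ[of "Suc n"] by (simp add: ac.chain_Suc)
    then have "Q (Suc n) ac \<le> Q n ac" for n using Fle[of "Q n ac"] by simp
    then obtain z where "?F z = z" "X ac \<le> z" "z \<le> 0"
      using decseq_fixed_point[OF contF1, of 0 "X ac"] conf by metis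
    then show ?thesis by (auto simp: Z_def)
  qed
  \<comment> \<open>Being the least fixed point, \<open>p\<close> is a one-sided barrier at the
    threshold: points below it leave \<open>[X, 0]\<close> in finitely many steps, orbits from above
    never pass it.\<close>
  define p where "p = Min Z"
  have pZ: "p \<in> Z" unfolding p_def by (rule Min_in[OF finZ neZ])
  have pmin: "p \<le> z" if "z \<in> Z" for z unfolding p_def using finZ that by simp
  have pF: "?F p = p" and pX: "p \<in> {X ac..0}" using pZ by (auto simp: Z_def)
  have Xp: "X ac < p" using pF pX ac.Fx ac.ax by (cases "p = X ac") auto
  have p0: "p < 0" using pF pX Q1_ac_neg by (cases "p = 0") auto
  have pF0: "p < ?F 0" using ac.F_strict[OF pX _ p0] pF ac.x0 by simp
  define \<eta> where "\<eta> = \<epsilon> / (2 * L ^ m)"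
  have Lp: "L ^ i \<ge> 1" for i using L_ge1 by (rule one_le_power)
  have eta: "\<eta> > 0" using eps L_ge1 by (simp add: \<eta>_def)
  \<comment> \<open>The entrance must be strictly moved, so that fundamental intervals there have
    positive length; all but finitely many points to the right of \<open>p\<close> qualify.\<close>
  obtain y0 where y0: "p < y0" "y0 < p + \<eta>" "y0 < ?F 0" "?F y0 < y0"
  proof -
    have "infinite {p<..<min (p + \<eta>) (?F 0)}" using eta pF0 by (intro infinite_Ioo) simp
    then obtain y0 where y: "y0 \<in> {p<..<min (p + \<eta>) (?F 0)}" "y0 \<notin> Z"
      using finZ by (meson finite_subset subsetI)
    have "y0 \<in> {X ac..0}" using y(1) pX Q1_ac_neg by auto
    then have "?F y0 < y0" using Fle[of y0] y(2) by (auto simp: Z_def less_le)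
    then show ?thesis using that[of y0] y(1) by auto
  qed
  have y00: "y0 < 0" using y0 Q1_ac_neg by linarith
  define q0 where "q0 = max ((X ac + p) / 2) (p - \<eta> / 2)"
  have q0: "X ac < q0" "q0 < p" "p - \<eta> < q0" using Xp eta unfolding q0_def by (auto simp: less_max_iff_disj)
  obtain k where k: "k \<ge> 1" "(?F ^^ k) q0 < X ac"
  proof -
    have "\<exists>k. (?F ^^ k) q0 < X ac"
    proof (rule ccontr)
      assume "\<not> ?thesis"
      then have ge: "X ac \<le> (?F ^^ n) q0" for n by (simp add: not_less)
      have q0X: "q0 \<in> {X ac..0}" using q0 p0 by simp
      have "ac.chain n q0" for n by (rule ac.chainI[OF q0X ge])
      then have "(?F ^^ n) q0 \<in> {X ac..0}" for n using ac.chain_Suc by blast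
      then have "(?F ^^ Suc n) q0 \<le> (?F ^^ n) q0" for n using Fle[of "(?F ^^ n) q0"] by simp
      then obtain z where "?F z = z" "X ac \<le> z" "z \<le> q0"
        using decseq_fixed_point[OF contF1, of q0 "X ac"] ge by metis
      then have "z \<in> Z" using q0 p0 by (auto simp: Z_def)
      then show False using pmin[of z] \<open>z \<le> q0\<close> q0 by simp
    qed
    then obtain k where "(?F ^^ k) q0 < X ac" by blast
    moreover have "k \<noteq> 0" using calculation q0 by (metis funpow_0 less_asym)
    ultimately show ?thesis using that[of k] by simp
  qed
  have small: "L ^ m * (y0 - q0) \<le> \<epsilon>"
  proof -
    have "L ^ m * (y0 - q0) \<le> L ^ m * (2 * \<eta>)" using y0 q0 Lp[of m] by (intro mult_left_mono) auto
    also have "\<dots> = \<epsilon>" using L_ge1 by (simp add: \<eta>_def)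
    finally show ?thesis .
  qed
  have y0X: "y0 \<in> {X ac..0}" using y0 y00 Xp by simp
  have Fy0p: "p < ?F y0" using ac.F_strict[OF pX y0X y0(1)] pF by simp
  have iter_p: "p \<le> (?F ^^ i) (?F y0)" for i
  proof -
    have chp: "ac.chain n p" for n
    proof (rule ac.chainI[OF pX])
      have "(?F ^^ i) p = p" for i by (induction i) (simp_all add: pF)
      then show "X ac \<le> (?F ^^ i) p" for i using pX by simp
    qed
    have "(?F ^^ i) p = p" by (induction i) (simp_all add: pF)
    moreover have "(?F ^^ i) p \<le> (?F ^^ i) (?F y0)"
      using ac.chain_mono[OF chp, of "?F y0" i] Fy0p y0 y00 by simp
    ultimately show ?thesis by simp
  qed
  have cF0: "continuous_on {s..t} (\<lambda>u. (g u ^^ m) 0)" using contQ[of _ 1] by simp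
  obtain b1 where b1: "ac < b1" "b1 \<le> t" "\<And>u. ac \<le> u \<Longrightarrow> u \<le> b1 \<Longrightarrow> X u < q0"
    by (rule near_ac[OF contX continuous_on_const q0(1)]) blast
  obtain b2 where b2: "ac < b2" "b2 \<le> t" "\<And>u. ac \<le> u \<Longrightarrow> u \<le> b2 \<Longrightarrow> y0 < (g u ^^ m) 0"
    by (rule near_ac[OF continuous_on_const cF0 y0(3)]) blast
  obtain b3 where b3: "ac < b3" "b3 \<le> t" "\<And>u. ac \<le> u \<Longrightarrow> u \<le> b3 \<Longrightarrow> ((g u ^^ m) ^^ k) q0 < X u"
    by (rule near_ac[OF contF[OF continuous_on_const] contX k(2)]) blast
  have cFF: "continuous_on S (\<lambda>u. ((g u ^^ m) ^^ i) ((g u ^^ m) y0))" for S i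
    using contF[OF continuous_on_const[of S y0], of "Suc i"] by (simp add: funpow_Suc_right del: funpow.simps)
  have near: "\<exists>b. ac < b \<and> b \<le> t \<and> (\<forall>u. ac \<le> u \<longrightarrow> u \<le> b \<longrightarrow> X u < ((g u ^^ m) ^^ i) ((g u ^^ m) y0))" for i
  proof -
    have "X ac < ((g ac ^^ m) ^^ i) ((g ac ^^ m) y0)" using iter_p[of i] Xp by simp
    then obtain b where "ac < b" "b \<le> t" "\<And>u. ac \<le> u \<Longrightarrow> u \<le> b \<Longrightarrow> X u < ((g u ^^ m) ^^ i) ((g u ^^ m) y0)"
      by (rule near_ac[OF contX cFF]) blast
    then show ?thesis by blast
  qed
  then have "\<forall>i. \<exists>b. ac < b \<and> b \<le> t \<and> (\<forall>u. ac \<le> u \<longrightarrow> u \<le> b \<longrightarrow> X u < ((g u ^^ m) ^^ i) ((g u ^^ m) y0))" by blast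
  then obtain bb where bb0: "\<forall>i. ac < bb i \<and> bb i \<le> t \<and> (\<forall>u. ac \<le> u \<longrightarrow> u \<le> bb i \<longrightarrow> X u < ((g u ^^ m) ^^ i) ((g u ^^ m) y0))"
    by (rule choice[THEN exE])
  have bb: "ac < bb i" "bb i \<le> t" "ac \<le> u \<Longrightarrow> u \<le> bb i \<Longrightarrow> X u < ((g u ^^ m) ^^ i) ((g u ^^ m) y0)" for i u
    using bb0 by blast+
  define b4 where "b4 = Min {b1, b2, b3, bb 0}"
  have b4: "ac < b4" "b4 \<le> t" "b4 \<le> b1" "b4 \<le> b2" "b4 \<le> b3" "b4 \<le> bb 0"
    using b1 b2 b3 bb by (auto simp: b4_def)
  have inst: "u \<in> {s..t}" if "ac \<le> u" "u \<le> b4" for u using that ac_bounds b4 by auto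
  \<comment> \<open>The displacement is a positive continuous function on a compact set of
    parameters and points which includes the threshold parameter; its minimum does not depend on the
    time of passage.\<close>
  obtain \<tau> where tau: "\<tau> > 0" "\<And>u y. ac \<le> u \<Longrightarrow> u \<le> b4 \<Longrightarrow> y \<in> {(g u ^^ m) y0..y0} \<Longrightarrow> y - (g u ^^ m) y \<ge> \<tau>"
  proof -
    define C where "C = {z :: real \<times> real. ac \<le> fst z \<and> fst z \<le> b4 \<and> (g (fst z) ^^ m) y0 \<le> snd z \<and> snd z \<le> y0}"
    have cfst: "continuous_on S (\<lambda>z :: real \<times> real. (g (fst z) ^^ m) y0)" for S
      by (intro continuous_intros)
    have "closed C" unfolding C_def
      by (intro closed_Collect_conj closed_Collect_le cfst continuous_intros)
    moreover have "C \<subseteq> cbox (ac, -1) (b4, y0)"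
    proof
      fix z assume z: "z \<in> C"
      then have u: "ac \<le> fst z" "fst z \<le> b4" by (auto simp: C_def)
      interpret u: branch l "fst z" "X (fst z)" m by (rule br[OF inst[OF u]])
      have "X (fst z) \<le> snd z" using z bb(3)[of "fst z" 0] u b4 by (auto simp: C_def)
      then have "- 1 \<le> snd z" using u.ax good_bounds(1)[OF u.good] by linarith
      then show "z \<in> cbox (ac, -1) (b4, y0)" using z by (cases z) (auto simp: C_def cbox_Pair_eq)
    qed
    ultimately have "compact C" using bounded_subset[OF bounded_cbox] compact_eq_bounded_closed by blast
    moreover have "(ac, y0) \<in> C" using b4 y0 by (auto simp: C_def)
    then have "C \<noteq> {}" by blast
    moreover have cont: "continuous_on C (\<lambda>z. snd z - (g (fst z) ^^ m) (snd z))" by (intro continuous_intros)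
    ultimately obtain z where z: "z \<in> C" "\<And>w. w \<in> C \<Longrightarrow> snd z - (g (fst z) ^^ m) (snd z) \<le> snd w - (g (fst w) ^^ m) (snd w)"
      using continuous_attains_inf[of C] by blast
    have u: "ac \<le> fst z" "fst z \<le> b4" using z(1) by (auto simp: C_def)
    interpret u: branch l "fst z" "X (fst z)" m by (rule br[OF inst[OF u]])
    have sz: "snd z \<in> {X (fst z)..0}" using z(1) bb(3)[of "fst z" 0] u b4 y00 by (auto simp: C_def)
    have "snd z - (g (fst z) ^^ m) (snd z) > 0"
    proof (cases "fst z = ac")
      case False
      then show ?thesis using below_diagonal[of "fst z" "snd z"] u b4 sz by auto
    next
      case True
      have szac: "snd z \<in> {X ac..0}" "?F y0 \<le> snd z" "snd z \<le> y0" using sz z(1) True by (auto simp: C_def)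
      have "?F (snd z) \<noteq> snd z"
      proof
        assume e: "?F (snd z) = snd z"
        have "?F (snd z) \<le> ?F y0" using ac.F_le[OF szac(1) y0X szac(3)] .
        then have "?F (snd z) = ?F y0" using e szac(2) by simp
        then have "snd z = y0" using ac.F_strict[OF szac(1) y0X] szac(3) by (cases "snd z < y0") auto
        then show False using e y0(4) by simp
      qed
      then show ?thesis using Fle[OF szac(1)] True by auto
    qed
    then show ?thesis
    proof (rule that)
      fix u y assume "ac \<le> u" "u \<le> b4" "y \<in> {(g u ^^ m) y0..y0}"
      then show "snd z - (g (fst z) ^^ m) (snd z) \<le> y - (g u ^^ m) y"
        using z(2)[of "(u, y)"] by (simp add: C_def)
    qed
  qed
  define D where "D = \<tau> * (1 / (2 * L ^ (m * (k + 1) + 2))) / exp (koebe * L ^ (m * (k + 2) + 2))"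
  have D0: "D > 0" unfolding D_def using tau(1) L_ge1 by simp
  \<comment> \<open>Large enough for \<open>gate_passage\<close>. At the threshold the orbit of
    \<open>F y0\<close> stays above \<open>p\<close> forever, so for each such \<open>I\<close>
    continuity leaves a range of parameters.\<close>
  define I where "I = k + 1 + nat \<lceil>real \<kappa> / D ^ \<kappa>\<rceil>"
  have big: "real (I - k) * D ^ \<kappa> \<ge> real \<kappa>"
  proof -
    have "real \<kappa> / D ^ \<kappa> \<le> real (I - k)" unfolding I_def by simp linarith
    then show ?thesis using D0 by (simp add: divide_le_eq)
  qed
  define b where "b = Min (insert b4 (bb ` {..I}))"
  have b: "ac < b" "b \<le> b4" using b4 bb(1) by (auto simp: b_def)
  have b_le: "b \<le> bb i" if "i \<le> I" for i unfolding b_def by (rule Min_le) (use that in auto)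
  have "gate a (X a) \<epsilon> \<kappa>" if a: "ac < a" "a \<le> b" for a
  proof -
    have ab4: "ac \<le> a" "a \<le> b4" using a b by auto
    interpret a: branch l a "X a" m by (rule br[OF inst[OF ab4]])
    show ?thesis
    proof (rule a.gate_passage[where ?q0.0=q0 and ?y0.0=y0 and s=k and \<tau>=\<tau> and I=I and D=D])
      show "(g a ^^ m) y < y" if "y \<in> {X a..0}" for y using below_diagonal[OF a(1) _ that] ab4 b4 by simp
      show "X a < q0" using b1(3)[of a] ab4 b4 by auto
      show "y0 \<le> (g a ^^ m) 0" using b2(3)[of a] ab4 b4 by auto
      show "\<exists>i\<le>k. ((g a ^^ m) ^^ i) q0 < X a" using b3(3)[of a] ab4 b4 by (intro exI[of _ k]) auto
      show "\<tau> \<le> y - (g a ^^ m) y" if "y \<in> {(g a ^^ m) y0..y0}" for y using tau(2)[OF ab4 that] .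
      show "X a < ((g a ^^ m) ^^ i) ((g a ^^ m) y0)" if "i \<le> I" for i using bb(3)[of a i] b_le[OF that] a by auto
      show "I > k" by (simp add: I_def)
    qed (use q0 y0 y00 k tau(1) small big in \<open>auto simp: D_def\<close>)
  qed
  then show ?thesis using b b4 by (intro exI[of _ b]) auto
qed

text \<open>\<open>t'\<close> is the first parameter past \<open>ac\<close> at which the critical
  orbit meets \<open>X\<close>, hence one step later the fixed point. Just before \<open>t'\<close>
  the orbit arrives slightly above \<open>a\<close> and \<open>g^2\<close> drives it up to
  \<open>0\<close>, which yields \<open>s'\<close>. As \<open>X' t' = 0\<close>, staying near
  \<open>t'\<close> makes \<open>X'\<close> small.\<close>

lemma new_stage:
  assumes b: "ac < b" "b \<le> t" and eps: "\<epsilon> > 0"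
  shows "\<exists>m' s' t' X'. m < m' \<and> ac < s' \<and> t' \<le> b \<and> stage m' s' t' X' \<and>
    (\<forall>a\<in>{s'..t'}. - \<epsilon> \<le> X' a \<and> X a \<le> (g a ^^ m) 0)"
proof -
  interpret ac: branch l ac "X ac" m by (rule br[OF ac_in])
  have sub: "u \<in> {s..t}" if "ac \<le> u" "u \<le> b" for u using that b ac_bounds by auto
  have Qac: "X ac < Q n ac" for n
  proof -
    have "X ac \<le> Q (Suc n) ac" "X ac \<le> Q n ac" using ac_confined unfolding confined_def by blast+
    moreover have "X ac \<noteq> Q n ac" using ac.Fx ac.ax calculation(1) by auto
    ultimately show ?thesis by simp
  qed
  obtain n where n: "Q n b < X b" using escapes[OF b] by blast
  define E where "E = (\<Union>i\<le>n. {a\<in>{ac..b}. Q i a \<le> X a})"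
  have E: "a \<in> E \<longleftrightarrow> ac \<le> a \<and> a \<le> b \<and> (\<exists>i\<le>n. Q i a \<le> X a)" for a by (auto simp: E_def)
  have clE: "closed E" unfolding E_def
    by (intro closed_UN finite_atMost ballI continuous_on_closed_Collect_le contQ closed_atLeastAtMost continuous_on_subset[OF contX])
      (use sub in auto)
  have bE: "b \<in> E" using n b E less_imp_le by blast
  define t' where "t' = Inf E"
  have bdd: "bdd_below E" using E by (auto intro!: bdd_belowI[of _ ac])
  have t'E: "t' \<in> E" unfolding t'_def by (rule closed_contains_Inf[OF _ bdd clE]) (use bE in auto)
  have before: "X a < Q i a" if "ac \<le> a" "a < t'" "i \<le> n" for a i
  proof (rule ccontr)
    assume "\<not> ?thesis"
    moreover have "a \<le> b" using that t'E E by force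
    ultimately have "a \<in> E" using that E by (meson not_less)
    then have "t' \<le> a" unfolding t'_def using bdd by (rule cInf_lower)
    then show False using that by simp
  qed
  have t'b: "ac \<le> t'" "t' \<le> b" using t'E E by auto
  have act': "ac < t'"
  proof -
    have "ac \<notin> E" using Qac E by (meson not_le)
    then show ?thesis using t'b t'E by (cases "ac = t'") auto
  qed
  have t'in: "t' \<in> {s..t}" using sub t'b by simp
  interpret t': branch l t' "X t'" m by (rule br[OF t'in])
  have at': "X t' \<le> Q i t'" if "i \<le> n" for i
  proof (rule ccontr)
    assume "\<not> ?thesis"
    then have neg: "X t' - Q i t' > 0" by simp
    have "continuous_on {ac..t'} (\<lambda>u. X u - Q i u)"
      by (intro continuous_on_diff contQ continuous_on_subset[OF contX]) (use sub t'b in auto)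
    moreover have "t' \<in> {ac..t'}" using act' by simp
    ultimately obtain d where d: "d > 0" "\<And>u. u \<in> {ac..t'} \<Longrightarrow> dist u t' < d \<Longrightarrow> dist (X u - Q i u) (X t' - Q i t') < X t' - Q i t'"
      using neg unfolding continuous_on_iff by metis
    define u where "u = max ac (t' - d / 2)"
    have u: "ac \<le> u" "u < t'" "u \<in> {ac..t'}" "dist u t' < d" using act' d(1) by (auto simp: u_def dist_real_def)
    have "X u - Q i u > 0" using d(2)[OF u(3,4)] by (simp add: dist_real_def abs_if split: if_splits)
    then show False using before[OF u(1,2) that] by simp
  qed
  have n1: "n \<ge> 1"
  proof (rule ccontr)
    assume "\<not> n \<ge> 1"
    then have "n = 0" by simp
    then show False using n branch.x0[OF br[OF sub[of b]]] b by simp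
  qed
  have Qn: "Q n t' = X t'"
  proof -
    obtain i where i: "i \<le> n" "Q i t' \<le> X t'" using t'E E by blast
    then have eq: "Q i t' = X t'" using at'[of i] by simp
    \<comment> \<open>Hitting \<open>X\<close> before time \<open>n\<close> would put the next point
      at \<open>a\<close>, below \<open>X\<close>, while up to time \<open>n\<close> the orbit is
      still above \<open>X\<close> at \<open>t'\<close>.\<close>
    have "i = n"
    proof (rule ccontr)
      assume "i \<noteq> n"
      then have "X t' \<le> Q (Suc i) t'" using i by (intro at') simp
      then show False using eq t'.Fx t'.ax by simp
    qed
    then show ?thesis using eq by simp
  qed
  have conf: "X a \<le> Q i a" if "ac \<le> a" "a \<le> t'" "i \<le> n" for a i
    using before[of a i] at'[of i] that by (cases "a = t'") auto
  have Qneg: "Q (Suc i) a < 0" if a: "ac < a" "a \<le> t'" and i: "i \<le> n" for a i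
    using i
  proof (induction i)
    case 0
    interpret a: branch l a "X a" m by (rule br[OF sub]) (use a t'b in auto)
    show ?case using below_diagonal[of a 0] a t'b b a.x0 by auto
  next
    case (Suc i)
    then have "Q (Suc i) a \<in> {X a..0}" using conf[of a "Suc i"] a by auto
    then have "Q (Suc (Suc i)) a < Q (Suc i) a" using below_diagonal[of a "Q (Suc i) a"] a t'b b by simp
    then show ?case using Suc by simp
  qed
  define P where "P a y \<longleftrightarrow> y \<in> {X a..0} \<and> (\<forall>i<n. ((g a ^^ m) ^^ i) y \<in> {X a..0}) \<and> ((g a ^^ m) ^^ n) y = X a" for a y
  \<comment> \<open>The point whose \<open>n\<close>-th \<open>F\<close>-image is the old
    \<open>X\<close>; monotonicity along chains makes it unique.\<close>
  define X' where "X' a = (THE y. P a y)" for a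
  have P1: "P a (X' a)" and P2: "P a y \<Longrightarrow> y = X' a" if a: "ac \<le> a" "a \<le> t'" for a y
  proof -
    interpret a: branch l a "X a" m by (rule br[OF sub]) (use a t'b in auto)
    have Pc: "P a y \<longleftrightarrow> a.chain n y \<and> ((g a ^^ m) ^^ n) y = X a" for y by (auto simp: P_def a.chain_def)
    have "a.chain n 0" by (rule a.chainI) (use conf[OF a] a.x0 in auto)
    then obtain y0 where y0: "P a y0" using a.chain_pullback_0[of n] conf[OF a, of n] Pc by auto
    have uniq: "y = z" if "P a y" "P a z" for y z using a.pullback_unique[of n y z] that Pc by simp
    show "P a (X' a)" unfolding X'_def by (rule theI[of "P a", OF y0]) (use uniq y0 in blast)
    then show "P a y \<Longrightarrow> y = X' a" using uniq by blast
  qed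
  have X'range: "X a \<le> X' a" "X' a \<le> 0" if a: "ac \<le> a" "a \<le> t'" for a using P1[OF a] by (auto simp: P_def)
  \<comment> \<open>A function with closed graph and values in a compact interval is continuous;
    uniqueness identifies the graph with a set given by closed conditions.\<close>
  have contX': "continuous_on {ac..t'} X'"
  proof -
    define Gr where "Gr = {z :: real \<times> real. fst z \<in> {ac..t'} \<and> P (fst z) (snd z)}"
    have cX: "continuous_on ({ac..t'} \<times> UNIV) (\<lambda>z :: real \<times> real. X (fst z))"
      by (rule continuous_on_compose2[OF contX continuous_on_fst[OF continuous_on_id]]) (use sub t'b in auto)
    have cG: "continuous_on S (\<lambda>z :: real \<times> real. ((g (fst z) ^^ m) ^^ i) (snd z))" for S i
      unfolding funpow_mult by (intro continuous_on_family continuous_intros)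
    have clS: "closed ({ac..t'} \<times> (UNIV :: real set))" by (intro closed_Times) auto
    have "Gr = {z \<in> {ac..t'} \<times> UNIV. X (fst z) \<le> snd z} \<inter> {z \<in> {ac..t'} \<times> UNIV. snd z \<le> 0} \<inter>
       (\<Inter>i<n. {z \<in> {ac..t'} \<times> UNIV. X (fst z) \<le> ((g (fst z) ^^ m) ^^ i) (snd z)}) \<inter>
       (\<Inter>i<n. {z \<in> {ac..t'} \<times> UNIV. ((g (fst z) ^^ m) ^^ i) (snd z) \<le> 0}) \<inter>
       {z \<in> {ac..t'} \<times> UNIV. ((g (fst z) ^^ m) ^^ n) (snd z) \<le> X (fst z)} \<inter>
       {z \<in> {ac..t'} \<times> UNIV. X (fst z) \<le> ((g (fst z) ^^ m) ^^ n) (snd z)}"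
      unfolding Gr_def P_def using n1 by (auto simp: mem_Times_iff)
    also have "closed \<dots>"
      by (intro closed_Int closed_INT ballI continuous_on_closed_Collect_le cX cG clS continuous_intros)
    finally have cl: "closed Gr" .
    have eq: "(\<lambda>u. (u, X' u)) ` {ac..t'} = Gr"
    proof (intro set_eqI iffI)
      fix z assume "z \<in> (\<lambda>u. (u, X' u)) ` {ac..t'}"
      then show "z \<in> Gr" using P1 by (auto simp: Gr_def)
    next
      fix z assume "z \<in> Gr"
      then have "fst z \<in> {ac..t'}" "snd z = X' (fst z)" using P2[of "fst z" "snd z"] by (auto simp: Gr_def)
      then show "z \<in> (\<lambda>u. (u, X' u)) ` {ac..t'}" by (intro image_eqI[of _ _ "fst z"]) (auto simp: prod_eq_iff)
    qed
    have rng: "X' \<in> {ac..t'} \<rightarrow> {-1..0}"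
    proof
      fix u assume u: "u \<in> {ac..t'}"
      interpret u: branch l u "X u" m by (rule br[OF sub]) (use u t'b in auto)
      show "X' u \<in> {-1..0}" using X'range[of u] u u.ax good_bounds(1)[OF u.good] by simp
    qed
    have "Gr \<subseteq> {ac..t'} \<times> {-1..0}" unfolding eq[symmetric] using rng by blast
    then have "closedin (top_of_set ({ac..t'} \<times> {-1..0})) ((\<lambda>u. (u, X' u)) ` {ac..t'})"
      unfolding eq using cl by (rule closed_subset)
    then show ?thesis by (simp only: continuous_closed_graph_eq[OF compact_Icc rng])
  qed
  have X't': "X' t' = 0"
  proof -
    have "P t' 0" using conf[of t'] act' t'.x0 Qn t'.chainI[of 0 n] by (auto simp: P_def t'.chain_def)
    then show ?thesis using P2[of t' 0] act' by simp
  qed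
  obtain v where v: "ac < v" "v < t'" "\<And>a. v \<le> a \<Longrightarrow> a \<le> t' \<Longrightarrow> - \<epsilon> \<le> X' a"
  proof -
    have "t' \<in> {ac..t'}" using act' by simp
    then obtain d where d: "d > 0" "\<And>u. u \<in> {ac..t'} \<Longrightarrow> dist u t' < d \<Longrightarrow> dist (X' u) (X' t') < \<epsilon>"
      using contX' eps unfolding continuous_on_iff by metis
    define v where "v = max ((ac + t') / 2) (t' - d / 2)"
    have v: "ac < v" "v < t'" using act' d(1) unfolding v_def by (auto simp: less_max_iff_disj)
    have "- \<epsilon> \<le> X' a" if "v \<le> a" "a \<le> t'" for a
    proof -
      have "dist a t' < d" using that d(1) by (auto simp: v_def dist_real_def)
      then show ?thesis using d(2)[of a] that v X't' by (simp add: dist_real_def)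
    qed
    then show ?thesis using that v by blast
  qed
  define W where "W = Q (Suc n)"
  have contW: "continuous_on S W" for S unfolding W_def by (rule contQ)
  have Wt': "W t' = t'" using Qn t'.Fx by (simp add: W_def)
  have W: "a < W a" "W a < 0" if a: "ac < a" "a < t'" for a
  proof -
    interpret a: branch l a "X a" m by (rule br[OF sub]) (use a t'b in auto)
    have "Q n a \<in> {X a..0}"
      using conf[of a n] Qneg[of a "n - 1"] a n1 by (cases n) auto
    then have "a.F (X a) < W a" unfolding W_def using before[of a n] a
      by simp (intro a.F_strict, auto simp: a.x0)
    then show "a < W a" using a.Fx by simp
    show "W a < 0" unfolding W_def using Qneg[of a n] a by simp
  qed
  have contpow: "continuous_on S (\<lambda>a. (g a ^^ i) (W a))" for S i
    by (intro continuous_on_family continuous_on_id contW)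
  \<comment> \<open>Otherwise the \<open>g^2\<close>-orbit of \<open>W v\<close> would increase in
    \<open>[v, 0]\<close> and converge to a fixed point above \<open>v\<close>, where
    \<open>g^2\<close> lies strictly above the diagonal.\<close>
  have ex: "\<exists>q. \<exists>a\<in>{v..t'}. (g a ^^ (2 * q)) (W a) \<ge> 0"
  proof (rule ccontr)
    assume neg: "\<not> ?thesis"
    interpret v: branch l v "X v" m by (rule br[OF sub]) (use v t'b in auto)
    have e2: "((g v ^^ 2) ^^ q) (W v) = (g v ^^ (2 * q)) (W v)" for q by (simp only: funpow_mult)
    have lt: "((g v ^^ 2) ^^ q) (W v) < 0" for q unfolding e2
    proof -
      have "v \<in> {v..t'}" using v by simp
      then show "(g v ^^ (2 * q)) (W v) < 0" using neg by (meson not_le)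
    qed
    have pos: "(g v ^^ 2) 0 > 0"
      using g2_mono[OF v.good, of "X v" 0] v.g2x v.ax v.x0 v.a_neg by linarith
    have gt: "v < ((g v ^^ 2) ^^ q) (W v)" for q
    proof (induction q)
      case 0
      then show ?case using W(1)[of v] v by simp
    next
      case (Suc q)
      then show ?case using g2_above_diagonal[OF v.good pos Suc] lt[of q] by (simp add: less_imp_le)
    qed
    have "((g v ^^ 2) ^^ q) (W v) \<le> ((g v ^^ 2) ^^ Suc q) (W v)" for q
      using g2_above_diagonal[OF v.good pos gt[of q]] lt[of q] by (simp add: less_imp_le)
    then obtain z where "(g v ^^ 2) z = z" "W v \<le> z" "z \<le> 0"
      using incseq_fixed_point[OF unicritical_iterate_continuous_real, where y="W v" and b=0] lt less_imp_le by metis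
    then show False using g2_above_diagonal[OF v.good pos, of z] W(1)[of v] v by simp
  qed
  \<comment> \<open>The least \<open>q\<close> for all parameters of \<open>[v, t']\<close>
    together, so that for each of them all earlier even times are negative, as
    \<open>next_branch\<close> requires.\<close>
  define q where "q = (LEAST q. \<exists>a\<in>{v..t'}. (g a ^^ (2 * q)) (W a) \<ge> 0)"
  have q1: "\<exists>a\<in>{v..t'}. (g a ^^ (2 * q)) (W a) \<ge> 0" unfolding q_def by (rule LeastI_ex[OF ex])
  have q2: "(g a ^^ (2 * j)) (W a) < 0" if "j < q" "a \<in> {v..t'}" for j a
    using not_less_Least[of j "\<lambda>q. \<exists>a\<in>{v..t'}. (g a ^^ (2 * q)) (W a) \<ge> 0"] that unfolding q_def[symmetric] by (meson not_le)
  define S where "S = {a\<in>{v..t'}. 0 \<le> (g a ^^ (2 * q)) (W a)}"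
  have clS: "closed S" unfolding S_def
    by (intro continuous_on_closed_Collect_le contpow continuous_on_const closed_atLeastAtMost)
  \<comment> \<open>Beyond this last parameter the value is negative, as it is at \<open>t'\<close>,
    where it equals \<open>t'\<close>. By continuity it vanishes at \<open>s'\<close>.\<close>
  define s' where "s' = Sup S"
  have bddS: "bdd_above S" by (auto simp: S_def intro!: bdd_aboveI[of _ t'])
  have s'S: "s' \<in> S" unfolding s'_def by (rule closed_contains_Sup[OF _ bddS clS]) (use q1 in \<open>auto simp: S_def\<close>)
  have t'neg: "(g t' ^^ (2 * q)) (W t') < 0" using t'.a_neg by (simp add: Wt')
  have s't': "v \<le> s'" "s' < t'" using s'S t'neg by (auto simp: S_def less_le)
  have after: "(g a ^^ (2 * q)) (W a) < 0" if "s' < a" "a \<le> t'" for a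
  proof (rule ccontr)
    assume "\<not> ?thesis"
    then have "a \<in> S" using that s't' by (auto simp: S_def)
    then have "a \<le> s'" unfolding s'_def using bddS by (rule cSup_upper)
    then show False using that by simp
  qed
  have s'0: "(g s' ^^ (2 * q)) (W s') = 0"
  proof (rule ccontr)
    assume "\<not> ?thesis"
    then have "(g s' ^^ (2 * q)) (W s') > 0" using s'S by (auto simp: S_def)
    then obtain w where w: "s' < w" "w \<le> t'" "\<And>u. s' \<le> u \<Longrightarrow> u \<le> w \<Longrightarrow> (g u ^^ (2 * q)) (W u) > 0"
      using right_neighbourhood[OF contpow order_refl s't'(2)] by blast
    then have "(g w ^^ (2 * q)) (W w) > 0" by (intro w(3)) auto
    then show False using after[OF w(1,2)] by linarith
  qed
  define m' where "m' = m * Suc n + 2 * q"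
  have iter: "(g a ^^ m') 0 = (g a ^^ (2 * q)) (W a)" for a
    unfolding m'_def W_def funpow_mult by (simp add: funpow_add add.commute[of "m * Suc n"] del: mult_Suc_right)
  have in_range: "ac < a" "a \<le> t'" "a \<in> {v..t'}" if "a \<in> {s'..t'}" for a using that s't' v by auto
  have "stage m' s' t' X'" unfolding stage_def
  proof (intro conjI ballI)
    show "s' < t'" by (rule s't')
    show "continuous_on {s'..t'} X'" by (rule continuous_on_subset[OF contX']) (use s't' v in auto)
    show "(g s' ^^ m') 0 = 0" unfolding iter by (rule s'0)
    show "(g t' ^^ m') 0 = t'" unfolding iter by (simp add: Wt')
    fix a assume a: "a \<in> {s'..t'}"
    note r = in_range[OF a]
    interpret a: branch l a "X a" m by (rule br[OF sub]) (use r t'b in auto)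
    show "branch l a (X' a) m'" unfolding m'_def
    proof (rule a.next_branch[OF n1])
      show "a.chain n (X' a)" "(a.F ^^ n) (X' a) = X a" using P1[of a] r by (auto simp: P_def a.chain_def)
      show "(a.F ^^ j) 0 < 0" if "1 \<le> j" "j \<le> n" for j
        using Qneg[OF r(1,2), of "j - 1"] that by (cases j) auto
      show "(a.F ^^ Suc n) 0 \<le> 0" using Qneg[OF r(1,2), of n] by simp
      show "(g a ^^ (2 * j)) ((a.F ^^ Suc n) 0) < 0" if "j < q" for j using q2[OF that r(3)] by (simp add: W_def)
      show "(g a ^^ (2 * q)) ((a.F ^^ Suc n) 0) \<le> 0"
        using after[of a] s'0 a by (cases "a = s'") (auto simp: W_def)
    qed
  qed
  moreover have "m < m'"
  proof -
    have "m * 1 < m * Suc n" using n1 m_ge1 by (intro mult_strict_left_mono) auto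
    then show ?thesis by (simp add: m'_def)
  qed
  moreover have "- \<epsilon> \<le> X' a \<and> X a \<le> (g a ^^ m) 0" if a: "a \<in> {s'..t'}" for a
    using v(3)[of a] conf[of a 1] n1 in_range[OF a] by auto
  moreover have "ac < s'" using s't' v(1) by simp
  ultimately have "m < m' \<and> ac < s' \<and> t' \<le> b \<and> stage m' s' t' X' \<and>
    (\<forall>a\<in>{s'..t'}. - \<epsilon> \<le> X' a \<and> X a \<le> (g a ^^ m) 0)" using t'b(2) by blast
  then show ?thesis by (intro exI)
qed

end

context even_degree begin

lemma stage_step:
  assumes "stage m s t X" "\<epsilon> > 0"
  shows "\<exists>m' s' t' X'. m < m' \<and> s \<le> s' \<and> t' \<le> t \<and> stage m' s' t' X' \<and>
    (\<forall>a\<in>{s'..t'}. gate a (X a) \<epsilon> \<kappa> \<and> - \<epsilon> \<le> X' a \<and> X a \<le> (g a ^^ m) 0)"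
proof -
  interpret stage_ctx l m s t X by unfold_locales (rule assms(1))
  obtain b where b: "ac < b" "b \<le> t" "\<And>a. ac < a \<Longrightarrow> a \<le> b \<Longrightarrow> gate a (X a) \<epsilon> \<kappa>"
    using gate_near[OF assms(2), of \<kappa>] by blast
  obtain m' s' t' X' where *: "m < m' \<and> ac < s' \<and> t' \<le> b \<and> stage m' s' t' X' \<and>
    (\<forall>a\<in>{s'..t'}. - \<epsilon> \<le> X' a \<and> X a \<le> (g a ^^ m) 0)"
    using new_stage[OF b(1,2) assms(2)] by (elim exE)
  have "gate a (X a) \<epsilon> \<kappa>" if "a \<in> {s'..t'}" for a by (rule b(3)) (use * that in auto)
  then have "m < m' \<and> s \<le> s' \<and> t' \<le> t \<and> stage m' s' t' X' \<and>
    (\<forall>a\<in>{s'..t'}. gate a (X a) \<epsilon> \<kappa> \<and> - \<epsilon> \<le> X' a \<and> X a \<le> (g a ^^ m) 0)"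
    using * b(2) ac_bounds by simp
  then show ?thesis by (intro exI)
qed

end

section \<open>The parameter\<close>

lemma last_zero:
  fixes h :: "real \<Rightarrow> real"
  assumes "continuous_on {p..r} h" "p \<le> r" "h p \<ge> 0" "h r < 0"
  obtains s where "p \<le> s" "s < r" "h s = 0" "\<And>a. s < a \<Longrightarrow> a \<le> r \<Longrightarrow> h a < 0"
proof -
  define S where "S = {a\<in>{p..r}. 0 \<le> h a}"
  have cl: "closed S" unfolding S_def
    by (intro continuous_on_closed_Collect_le assms(1) continuous_on_const closed_atLeastAtMost)
  have bdd: "bdd_above S" by (auto simp: S_def intro!: bdd_aboveI[of _ r])
  define s where "s = Sup S"
  have sS: "s \<in> S" unfolding s_def by (rule closed_contains_Sup[OF _ bdd cl]) (use assms in \<open>auto simp: S_def\<close>)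
  have s: "p \<le> s" "s < r" using sS assms(4) by (auto simp: S_def less_le)
  have after: "h a < 0" if "s < a" "a \<le> r" for a
  proof (rule ccontr)
    assume "\<not> ?thesis"
    then have "a \<in> S" using that s by (auto simp: S_def)
    then have "a \<le> s" unfolding s_def using bdd by (rule cSup_upper)
    then show False using that by simp
  qed
  have "h s = 0"
  proof (rule ccontr)
    assume "\<not> ?thesis"
    then have pos: "h s > 0" using sS by (auto simp: S_def)
    obtain w where w: "s < w" "w \<le> r" "\<And>u. s \<le> u \<Longrightarrow> u \<le> w \<Longrightarrow> h u > 0"
      by (rule right_neighbourhood[OF continuous_on_subset[OF assms(1)] order_refl s(2) pos]) (use s in auto)
    have "h w > 0" by (rule w(3)) (use w in auto)
    then show False using after[OF w(1,2)] by linarith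
  qed
  then show ?thesis using that s after by blast
qed

lemma first_zero:
  fixes h :: "real \<Rightarrow> real"
  assumes "continuous_on {p..r} h" "p \<le> r" "h p > 0" "h r \<le> 0"
  obtains t where "p < t" "t \<le> r" "h t = 0" "\<And>a. p \<le> a \<Longrightarrow> a < t \<Longrightarrow> h a > 0"
proof -
  have c: "continuous_on {p..r} (\<lambda>a. - h (p + r - a))"
    by (intro continuous_on_minus continuous_on_compose2[OF assms(1)] continuous_intros) auto
  obtain s where s: "p \<le> s" "s < r" "- h (p + r - s) = 0" "\<And>a. s < a \<Longrightarrow> a \<le> r \<Longrightarrow> - h (p + r - a) < 0"
    by (rule last_zero[OF c assms(2)]) (use assms in auto)
  have "h a > 0" if "p \<le> a" "a < p + r - s" for a using s(4)[of "p + r - a"] that by simp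
  then show ?thesis using that[of "p + r - s"] s by simp
qed

context even_degree begin

text \<open>At \<open>p\<close> the second iterate of \<open>0\<close> is the fixed point
  \<open>B = p ^ l - p\<close>; at \<open>r\<close> the critical point has period two. In between
  \<open>a ^ l - a\<close> is decreasing.\<close>

lemma good_interval:
  obtains p r where "p < r" "\<And>a. a \<in> {p..r} \<Longrightarrow> good a" "(p ^ l - p) ^ (l - 1) = 2" "r ^ l - r = 1"
proof -
  have c: "continuous_on S (\<lambda>a. a ^ l - a)" for S :: "real set" by (intro continuous_intros)
  have l1: "l - 1 \<noteq> 0" using l2 by simp
  obtain p :: real where p: "-1 \<le> p" "p \<le> 0" "(p ^ l - p) ^ (l - 1) = 2"
  proof -
    have "2 ^ 1 \<le> (2::real) ^ (l - 1)" using l2 by (intro power_increasing) auto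
    then have "\<exists>x\<ge>-1. x \<le> 0 \<and> (x ^ l - x) ^ (l - 1) = (2::real)"
      using even_l l2 l1 by (intro IVT2' continuous_intros) (auto simp: power_0_left)
    then show ?thesis using that by blast
  qed
  have anti: "b ^ l - b < a ^ l - a" if "a < b" "b \<le> 0" for a b :: real
  proof -
    have "\<bar>b\<bar> ^ l \<le> \<bar>a\<bar> ^ l" using that by (intro power_mono) auto
    then show ?thesis using that even_l by (simp add: power_even_abs)
  qed
  have p1: "p ^ l - p \<ge> 1"
  proof (rule ccontr)
    assume neg: "\<not> ?thesis"
    have "0 \<le> p ^ l - p" using p(2) zero_le_even_power[OF even_l, of p] by linarith
    then have "(p ^ l - p) ^ (l - 1) \<le> 1" using neg by (intro power_le_one) auto
    then show False using p(3) by simp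
  qed
  obtain r where r: "p \<le> r" "r \<le> 0" "r ^ l - r = 1"
    using IVT2'[of "\<lambda>a. a ^ l - a" 0 1 p] p p1 c l2 by (auto simp: power_0_left)
  have r0: "r < 0" using r l2 by (cases "r = 0") (auto simp: power_0_left)
  have pr: "p \<noteq> r"
  proof
    assume "p = r"
    then have "(p ^ l - p) ^ (l - 1) = 1" using r by simp
    then show False using p(3) by simp
  qed
  have "good a" if a: "a \<in> {p..r}" for a
  proof -
    have "1 \<le> a ^ l - a" using anti[of a r] a r by (cases "a = r") auto
    moreover have "a ^ l - a \<le> p ^ l - p" using anti[of p a] a r by (cases "a = p") auto
    then have "(a ^ l - a) ^ (l - 1) \<le> (p ^ l - p) ^ (l - 1)" using calculation by (intro power_mono) auto
    ultimately show ?thesis using a r0 p(3) by (simp add: good_def)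
  qed
  then show ?thesis using that[of p r] r pr p(3) by simp
qed

text \<open>On \<open>[x, 0]\<close> the first iterate is at most \<open>a\<close> and the second at
  least \<open>-a\<close>. So both intermediate times avoid \<open>(a, -a)\<close>, and the third
  application of \<open>g\<close> takes place where \<open>g\<close> increases.\<close>

lemma base_branch:
  assumes a: "good a" and F0: "a \<le> (g a ^^ 3) 0" "(g a ^^ 3) 0 \<le> 0"
    and x: "a \<le> x" "x \<le> 0" "(g a ^^ 2) x = - a"
  shows "branch l a x 3"
proof
  have an: "a < 0" using a good_neg by blast
  have e3: "(g a ^^ 3) y = g a ((g a ^^ 2) y)" for y by (simp add: numeral_3_eq_3 numeral_2_eq_2)
  show "good a" "x \<le> 0" "(3::nat) \<ge> 1" "a \<le> (g a ^^ 3) 0" "(g a ^^ 3) 0 \<le> 0" by (use assms in simp_all)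
  show ax: "a < x" using x an by (cases "a = x") auto
  show "(g a ^^ 3) x = a" by (simp add: e3 x(3) g_minus)
  have ge: "- a \<le> (g a ^^ 2) y" if "y \<in> {x..0}" for y
    using g2_mono[OF a x(1), of y] that x(3) by simp
  show "strict_mono_on {x..0} (g a ^^ 3)"
  proof (rule strict_mono_onI)
    fix y z assume yz: "y \<in> {x..0}" "z \<in> {x..0}" "y < z"
    then have "(g a ^^ 2) y < (g a ^^ 2) z" using x by (intro g2_increasing[OF a]) auto
    then show "(g a ^^ 3) y < (g a ^^ 3) z" unfolding e3 using ge[OF yz(1)] an by (intro g_pos_increasing) auto
  qed
  show "- a \<le> (g a ^^ 2) x" using x(3) by simp
  fix i assume "1 \<le> i" "i < (3::nat)"
  then have "i = 1 \<or> i = 2" by auto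
  then have "\<forall>y\<in>{x..0}. \<bar>a\<bar> \<le> \<bar>(g a ^^ i) y\<bar>"
  proof
    assume i: "i = 1"
    show ?thesis
    proof
      fix y assume "y \<in> {x..0}"
      then have "g a y \<le> a" using x an by (intro g_le) auto
      then show "\<bar>a\<bar> \<le> \<bar>(g a ^^ i) y\<bar>" using i an by simp
    qed
  next
    assume i: "i = 2"
    show ?thesis
    proof
      fix y assume "y \<in> {x..0}"
      then show "\<bar>a\<bar> \<le> \<bar>(g a ^^ i) y\<bar>" using ge[of y] i an by simp
    qed
  qed
  then show "(\<forall>y\<in>{x..0}. \<bar>a\<bar> \<le> \<bar>(g a ^^ i) y\<bar>) \<or> strict_mono_on {x..0} (g a ^^ i) \<and> (\<forall>y\<in>{x..0}. (g a ^^ i) y < 0)" ..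
qed

lemma base_stage: "\<exists>s t X. stage 3 s t X"
proof -
  obtain p r where pr: "p < r" "\<And>a. a \<in> {p..r} \<Longrightarrow> good a" "(p ^ l - p) ^ (l - 1) = 2" "r ^ l - r = 1"
    using good_interval by blast
  define h where "h a = (g a ^^ 3) 0" for a
  have ch: "continuous_on S h" for S unfolding h_def by (intro continuous_on_family continuous_intros)
  have h3: "h a = ((a ^ l - a) ^ l - (a ^ l - a)) ^ l - (a ^ l - a)" for a
  proof -
    define B where "B = a ^ l - a"
    have e: "a - a ^ l = - B" by (simp add: B_def)
    have "h a = ((- B) ^ l + - B) ^ l + - B"
      unfolding h_def e using l2 by (simp add: numeral_3_eq_3 unicritical_def power_0_left)
    then show ?thesis using even_l by (simp flip: B_def)
  qed
  have hp: "h p > 0"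
  proof -
    define B where "B = p ^ l - p"
    have "B \<ge> 1" using pr(1) pr(2)[of p] by (simp add: good_def B_def)
    have "B ^ l = B * B ^ (l - 1)" using l2 by (cases l) auto
    then have "B ^ l = 2 * B" using pr(3) by (simp add: B_def)
    then have "h p = B" by (simp add: h3 flip: B_def)
    then show ?thesis using \<open>B \<ge> 1\<close> by simp
  qed
  have hr: "h r = -1" using l2 by (simp add: h3 pr(4) power_0_left)
  have r1: "r > -1"
  proof -
    have "r \<ge> -1" using good_bounds(1)[OF pr(2)[of r]] pr(1) by simp
    moreover have "r \<noteq> -1" using pr(4) even_l by auto
    ultimately show ?thesis by simp
  qed
  \<comment> \<open>\<open>h\<close> is positive at \<open>p\<close> and equals -1 at
    \<open>r\<close>. Its last zero, followed by the first parameter with \<open>h a = a\<close>,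
    keeps \<open>h\<close> between \<open>a\<close> and \<open>0\<close> on the whole
    interval.\<close>
  obtain s where s: "p \<le> s" "s < r" "h s = 0" "\<And>a. s < a \<Longrightarrow> a \<le> r \<Longrightarrow> h a < 0"
    by (rule last_zero[OF ch[of "{p..r}"]]) (use pr(1) hp hr in auto)
  have s0: "s < 0" using good_neg[OF pr(2)[of s]] s by simp
  have ch2: "continuous_on {s..r} (\<lambda>a. h a - a)" by (intro continuous_on_diff ch continuous_on_id)
  obtain t where t: "s < t" "t \<le> r" "h t - t = 0" "\<And>a. s \<le> a \<Longrightarrow> a < t \<Longrightarrow> h a - a > 0"
    by (rule first_zero[OF ch2]) (use s hr r1 s0 in auto)
  have ga: "good a" if "a \<in> {s..t}" for a using pr(2)[of a] that s t by auto
  have hb: "a \<le> h a" "h a \<le> 0" if "a \<in> {s..t}" for a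
  proof -
    show "a \<le> h a" using t(3) t(4)[of a] that by (cases "a = t") auto
    show "h a \<le> 0" using s(3) s(4)[of a] that t(2) by (cases "a = s") auto
  qed
  have g20: "(g a ^^ 2) 0 \<ge> - a" if a: "a \<in> {s..t}" for a
  proof -
    define z where "z = (g a ^^ 2) 0"
    have "g a z = h a" by (simp add: z_def h_def numeral_3_eq_3 numeral_2_eq_2)
    then have "\<bar>a\<bar> ^ l \<le> \<bar>z\<bar> ^ l" using hb(1)[OF a] even_l by (simp add: unicritical_def power_even_abs)
    then have "\<bar>a\<bar> \<le> \<bar>z\<bar>" using l2 by (metis abs_ge_zero less_le_trans pos2 power_mono_iff)
    moreover have "z \<ge> 0"
    proof -
      define B where "B = a ^ l - a"
      have B1: "B \<ge> 1" using ga[OF a] by (simp add: good_def B_def)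
      have "B ^ 1 \<le> B ^ l" using B1 l2 by (intro power_increasing) auto
      moreover have "z = B ^ l - B"
      proof -
        have e: "a - a ^ l = - B" by (simp add: B_def)
        have "z = (- B) ^ l + - B"
          unfolding z_def e using l2 by (simp add: numeral_2_eq_2 unicritical_def power_0_left)
        then show ?thesis using even_l by simp
      qed
      ultimately show ?thesis by simp
    qed
    ultimately show ?thesis unfolding z_def[symmetric] using good_neg[OF ga[OF a]] by simp
  qed
  define P where "P a x \<longleftrightarrow> a \<le> x \<and> x \<le> 0 \<and> (g a ^^ 2) x = - a" for a x
  define X where "X a = (THE x. P a x)" for a
  have P1: "P a (X a)" and P2: "P a x \<Longrightarrow> x = X a" if a: "a \<in> {s..t}" for a x
  proof -
    have an: "a < 0" using good_neg[OF ga[OF a]] .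
    obtain x0 where x0: "P a x0"
      using IVT'[of "g a ^^ 2" a "- a" 0] g20[OF a] an unicritical_iterate_continuous_real
      unfolding P_def by auto
    have uniq: "x = y" if "P a x" "P a y" for x y
      using g2_increasing[OF ga[OF a], of x y] g2_increasing[OF ga[OF a], of y x] that
      unfolding P_def by (cases "x < y"; cases "y < x") auto
    show "P a (X a)" unfolding X_def by (rule theI[of "P a", OF x0]) (use uniq x0 in blast)
    then show "P a x \<Longrightarrow> x = X a" using uniq by blast
  qed
  have contX: "continuous_on {s..t} X"
  proof -
    define Gr where "Gr = {z :: real \<times> real. fst z \<in> {s..t} \<and> P (fst z) (snd z)}"
    have cG: "continuous_on S (\<lambda>z :: real \<times> real. (g (fst z) ^^ 2) (snd z))" for S
      by (intro continuous_on_family continuous_intros)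
    have "Gr = {z. s \<le> fst z} \<inter> {z. fst z \<le> t} \<inter> {z. fst z \<le> snd z} \<inter> {z. snd z \<le> 0} \<inter> {z. (g (fst z) ^^ 2) (snd z) = - fst z}"
      by (auto simp: Gr_def P_def)
    also have "closed \<dots>"
      by (intro closed_Int closed_Collect_le closed_Collect_eq cG continuous_intros)
    finally have cl: "closed Gr" .
    have eq: "(\<lambda>u. (u, X u)) ` {s..t} = Gr"
    proof (intro set_eqI iffI)
      fix z assume "z \<in> (\<lambda>u. (u, X u)) ` {s..t}"
      then show "z \<in> Gr" using P1 by (auto simp: Gr_def)
    next
      fix z assume "z \<in> Gr"
      then have "fst z \<in> {s..t}" "snd z = X (fst z)" using P2[of "fst z" "snd z"] by (auto simp: Gr_def)
      then show "z \<in> (\<lambda>u. (u, X u)) ` {s..t}" by (intro image_eqI[of _ _ "fst z"]) (auto simp: prod_eq_iff)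
    qed
    have rng: "X \<in> {s..t} \<rightarrow> {-1..0}"
    proof
      fix u assume u: "u \<in> {s..t}"
      show "X u \<in> {-1..0}" using P1[OF u] good_bounds(1)[OF ga[OF u]] by (simp add: P_def)
    qed
    have "Gr \<subseteq> {s..t} \<times> {-1..0}" unfolding eq[symmetric] using rng by blast
    then have "closedin (top_of_set ({s..t} \<times> {-1..0})) ((\<lambda>u. (u, X u)) ` {s..t})"
      unfolding eq using cl by (rule closed_subset)
    then show ?thesis by (simp only: continuous_closed_graph_eq[OF compact_Icc rng])
  qed
  have "branch l a (X a) 3" if "a \<in> {s..t}" for a
    using P1[OF that] hb[OF that] unfolding P_def h_def by (intro base_branch ga[OF that]) auto
  then have "stage 3 s t X" using t(1,3) contX s(3) by (simp add: stage_def h_def)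
  then show ?thesis by blast
qed

lemma gate_weaken: assumes "gate a x \<epsilon> \<kappa>" "\<epsilon> \<le> \<epsilon>'" shows "gate a x \<epsilon>' \<kappa>"
proof -
  obtain j1 j2 y1 y2 N0 N1 where *: "x \<le> j1" "j1 < y1" "y1 < y2" "y2 < j2" "j2 < 0" "N0 \<le> N1"
     "(g a ^^ N1) j1 = a" "(g a ^^ N1) j2 = - a" "(g a ^^ N1) y1 = a / 2" "(g a ^^ N1) y2 = - a / 2"
     "strict_mono_on {j1..j2} (g a ^^ N1)" "\<forall>i<N1. \<forall>y\<in>{j1..j2}. (g a ^^ i) y \<noteq> 0"
     "\<forall>i\<le>N0. \<exists>n. \<forall>y\<in>{j1..j2}. \<bar>(g a ^^ i) y - (g a ^^ n) 0\<bar> \<le> \<epsilon>"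
     "real N0 * (y2 - y1) ^ \<kappa> \<ge> real \<kappa>"
    using assms(1) unfolding gate_def by (elim exE conjE)
  have "\<forall>i\<le>N0. \<exists>n. \<forall>y\<in>{j1..j2}. \<bar>(g a ^^ i) y - (g a ^^ n) 0\<bar> \<le> \<epsilon>'"
  proof (intro allI impI)
    fix i assume "i \<le> N0"
    then obtain n where "\<forall>y\<in>{j1..j2}. \<bar>(g a ^^ i) y - (g a ^^ n) 0\<bar> \<le> \<epsilon>" using *(13) by blast
    then have "\<forall>y\<in>{j1..j2}. \<bar>(g a ^^ i) y - (g a ^^ n) 0\<bar> \<le> \<epsilon>'"
      using assms(2) order_trans by blast
    then show "\<exists>n. \<forall>y\<in>{j1..j2}. \<bar>(g a ^^ i) y - (g a ^^ n) 0\<bar> \<le> \<epsilon>'" ..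
  qed
  then have "x \<le> j1 \<and> j1 < y1 \<and> y1 < y2 \<and> y2 < j2 \<and> j2 < 0 \<and> N0 \<le> N1 \<and>
     (g a ^^ N1) j1 = a \<and> (g a ^^ N1) j2 = - a \<and> (g a ^^ N1) y1 = a / 2 \<and> (g a ^^ N1) y2 = - a / 2 \<and>
     strict_mono_on {j1..j2} (g a ^^ N1) \<and> (\<forall>i<N1. \<forall>y\<in>{j1..j2}. (g a ^^ i) y \<noteq> 0) \<and>
     (\<forall>i\<le>N0. \<exists>n. \<forall>y\<in>{j1..j2}. \<bar>(g a ^^ i) y - (g a ^^ n) 0\<bar> \<le> \<epsilon>') \<and>
     real N0 * (y2 - y1) ^ \<kappa> \<ge> real \<kappa>"
    using *(1-12) *(14) by (intro conjI)
  then show ?thesis unfolding gate_def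
    by (intro exI[of _ j1] exI[of _ j2] exI[of _ y1] exI[of _ y2] exI[of _ N0] exI[of _ N1])
qed

lemma exists_parameter:
  "\<exists>a. good a \<and>
    (\<forall>p\<ge>1. \<bar>(g a ^^ p) 0\<bar> < \<bar>a\<bar> \<longrightarrow> (g a ^^ p) 0 < 0 \<and> (\<exists>x<0. strict_mono_on {x..0} (g a ^^ p))) \<and>
    (\<forall>\<epsilon>>0. \<forall>\<kappa>0. \<exists>x \<kappa>. \<kappa>0 \<le> \<kappa> \<and> - \<epsilon> \<le> x \<and> gate a x \<epsilon> \<kappa>) \<and>
    (\<exists>r. strict_mono (r :: nat \<Rightarrow> nat) \<and> (\<lambda>k. (g a ^^ r k) 0) \<longlonglongrightarrow> 0) \<and>
    (\<exists>x. a < x \<and> x \<le> 0 \<and> (g a ^^ 2) x = - a)"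
proof -
  define St where "St = (\<lambda>(m, s, t, X). stage m s t X)"
  define Nx where "Nx = (\<lambda>k (m, s, t, X) (m', s', t', X'). m < m' \<and> s \<le> s' \<and> t' \<le> t \<and>
    (\<forall>a\<in>{s'..t'}. gate a (X a) (1 / Suc k) k \<and> - (1 / Suc k) \<le> X' a \<and> X a \<le> (g a ^^ m) 0))"
  have "\<exists>z :: nat \<Rightarrow> nat \<times> real \<times> real \<times> (real \<Rightarrow> real). \<forall>k. St (z k) \<and> Nx k (z k) (z (Suc k))"
  proof (rule dependent_nat_choice)
    show "\<exists>z. St z" using base_stage by (auto simp: St_def)
    show "\<exists>z'. St z' \<and> Nx k z z'" if "St z" for z k
    proof -
      obtain m s t X where z: "z = (m, s, t, X)" by (cases z)
      have "stage m s t X" using that by (simp add: z St_def)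
      then obtain m' s' t' X' where "m < m' \<and> s \<le> s' \<and> t' \<le> t \<and> stage m' s' t' X' \<and>
        (\<forall>a\<in>{s'..t'}. gate a (X a) (1 / Suc k) k \<and> - (1 / Suc k) \<le> X' a \<and> X a \<le> (g a ^^ m) 0)"
        using stage_step[of m s t X "1 / Suc k" k] by auto
      then show ?thesis by (intro exI[of _ "(m', s', t', X')"]) (simp add: z St_def Nx_def)
    qed
  qed
  then obtain z where z: "\<And>k. St (z k)" "\<And>k. Nx k (z k) (z (Suc k))" by blast
  define m where "m k = fst (z k)" for k
  define s where "s k = fst (snd (z k))" for k
  define t where "t k = fst (snd (snd (z k)))" for k
  define X where "X k = snd (snd (snd (z k)))" for k
  have zk: "z k = (m k, s k, t k, X k)" for k by (simp add: m_def s_def t_def X_def)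
  have stg: "stage (m k) (s k) (t k) (X k)" for k using z(1)[of k] by (simp add: zk St_def)
  have nx: "m k < m (Suc k)" "s k \<le> s (Suc k)" "t (Suc k) \<le> t k" for k
    using z(2)[of k] by (simp_all add: zk Nx_def)
  have nx2: "gate a (X k a) (1 / Suc k) k" "- (1 / Suc k) \<le> X (Suc k) a" "X k a \<le> (g a ^^ m k) 0"
    if "a \<in> {s (Suc k)..t (Suc k)}" for k a
    using z(2)[of k] that by (auto simp: zk Nx_def)
  have sm: "strict_mono m" using nx(1) by (simp add: strict_mono_Suc_iff)
  have "\<exists>a. \<forall>k. a \<in> {s k..t k}"
  proof -
    have st: "s k < t k" for k using stg[of k] by (simp add: stage_def)
    have smon: "s i \<le> s j" if "i \<le> j" for i j using nx(2) that by (rule lift_Suc_mono_le)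
    have tmon: "t j \<le> t i" if "i \<le> j" for i j using nx(3) that by (rule lift_Suc_antimono_le)
    have le: "s i \<le> t j" for i j
      using smon[of i "max i j"] tmon[of j "max i j"] st[of "max i j"] by simp
    have bdd: "bdd_above (range s)" using le[of _ 0] by (auto intro!: bdd_aboveI[of _ "t 0"])
    show ?thesis
    proof (intro exI allI)
      fix k
      have "s k \<le> Sup (range s)" using bdd by (intro cSup_upper) auto
      moreover have "Sup (range s) \<le> t k" using le by (intro cSup_least) auto
      ultimately show "Sup (range s) \<in> {s k..t k}" by simp
    qed
  qed
  then obtain a where a: "\<And>k. a \<in> {s k..t k}" by blast
  have br: "branch l a (X k a) (m k)" for k using stg[of k] a[of k] by (auto simp: stage_def)
  have Xneg: "X k a < 0" for k
  proof -
    interpret branch l a "X k a" "m k" by (rule br)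
    have "X k a \<noteq> 0" using nx2(3)[OF a, of k] Fx a_neg by auto
    then show ?thesis using x0 by simp
  qed
  have mk: "k \<le> m k" for k using sm by (rule strict_mono_imp_increasing)
  have 1: "good a" using branch.good[OF br] .
  \<comment> \<open>\<open>p\<close> is an intermediate time of stage \<open>Suc p\<close>, since
    \<open>m\<close> increases strictly. The critical point itself violates the first alternative of
    \<open>cond\<close>, so the second holds.\<close>
  have 2: "(g a ^^ p) 0 < 0 \<and> (\<exists>x<0. strict_mono_on {x..0} (g a ^^ p))" if p: "p \<ge> 1" "\<bar>(g a ^^ p) 0\<bar> < \<bar>a\<bar>" for p
  proof -
    interpret branch l a "X (Suc p) a" "m (Suc p)" by (rule br)
    have "p < m (Suc p)" using mk[of "Suc p"] by simp
    note cond[OF p(1) this]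
    moreover have "0 \<in> {X (Suc p) a..0}" using x0 by simp
    then have "\<not> (\<forall>y\<in>{X (Suc p) a..0}. \<bar>a\<bar> \<le> \<bar>(g a ^^ p) y\<bar>)" using p(2) by (meson not_le)
    ultimately have "strict_mono_on {X (Suc p) a..0} (g a ^^ p)" "(g a ^^ p) 0 < 0" using x0 by auto
    then show ?thesis using Xneg[of "Suc p"] by blast
  qed
  have 3: "\<exists>x \<kappa>. \<kappa>0 \<le> \<kappa> \<and> - \<epsilon> \<le> x \<and> gate a x \<epsilon> \<kappa>" if e: "\<epsilon> > 0" for \<epsilon> \<kappa>0
  proof -
    obtain n where n: "1 / real (Suc n) < \<epsilon>" using e nat_approx_posE by blast
    define k where "k = Suc (max n \<kappa>0)"
    have b1: "1 / real k \<le> 1 / real (Suc n)" "1 / real (Suc k) \<le> 1 / real (Suc n)"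
      by (auto simp: k_def intro!: divide_left_mono)
    have "- (1 / k) \<le> X k a" using nx2(2)[OF a, of "max n \<kappa>0"] by (simp add: k_def)
    then have "- \<epsilon> \<le> X k a" using b1 n by linarith
    moreover have "gate a (X k a) \<epsilon> k"
      by (rule gate_weaken[OF nx2(1)[OF a]]) (use b1 n in linarith)
    ultimately show ?thesis by (intro exI[of _ "X k a"] exI[of _ k]) (simp add: k_def)
  qed
  \<comment> \<open>The critical value of \<open>F\<close> at each stage lies between
    \<open>X\<close> and \<open>0\<close>, and \<open>X\<close> tends to \<open>0\<close>; this is
    the recurrence.\<close>
  have 4: "(\<lambda>k. (g a ^^ m k) 0) \<longlonglongrightarrow> 0"
  proof (rule LIMSEQ_offset[of _ 1], rule tendsto_sandwich[of "\<lambda>k. - (1 / real (Suc k))" _ _ "\<lambda>_. 0"])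
    show "\<forall>\<^sub>F k in sequentially. - (1 / real (Suc k)) \<le> (g a ^^ m (k + 1)) 0"
      using nx2(2)[OF a] nx2(3)[OF a] by (intro always_eventually allI) (metis Suc_eq_plus1 order_trans)
    show "\<forall>\<^sub>F k in sequentially. (g a ^^ m (k + 1)) 0 \<le> 0"
      using branch.F0(2)[OF br] by simp
    have "(\<lambda>k. 1 / real (Suc k)) \<longlonglongrightarrow> 0" by (rule LIMSEQ_Suc[OF lim_1_over_n])
    from tendsto_minus[OF this] show "(\<lambda>k. - (1 / real (Suc k))) \<longlonglongrightarrow> 0" by simp
  qed simp
  have 5: "\<exists>x. a < x \<and> x \<le> 0 \<and> (g a ^^ 2) x = - a"
  proof -
    interpret branch l a "X 0 a" "m 0" by (rule br)
    obtain x where "a \<le> x" "x \<le> X 0 a" "(g a ^^ 2) x = - a"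
      using IVT'[of "g a ^^ 2" a "- a" "X 0 a"] g2x a_neg ax unicritical_iterate_continuous_real by auto
    moreover have "x \<noteq> a" using calculation(3) a_neg by auto
    ultimately show ?thesis using x0 by (intro exI[of _ x]) auto
  qed
  show ?thesis using 1 2 3 4 5 sm by blast
qed

end

section \<open>Long branches\<close>

lemma inj_continuous_monotone:
  fixes h :: "real \<Rightarrow> real"
  assumes cont: "continuous_on {u..v} h" and inj: "inj_on h {u..v}"
  shows "strict_mono_on {u..v} h \<or> strict_antimono_on {u..v} h"
proof -
  have key: "h x < h y" if hyp: "continuous_on {u..v} h" "inj_on h {u..v}" "h u < h v" "u \<le> x" "x < y" "y \<le> v" for h :: "real \<Rightarrow> real" and x y
  proof -
    have xv: "h x < h v"
    proof (cases "x = u")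
      case False
      then show ?thesis using continuous_inj_imp_mono[of u x v h] hyp by auto
    qed (use hyp in simp)
    show ?thesis
    proof (cases "y = v")
      case False
      have "continuous_on {x..v} h" "inj_on h {x..v}"
        by (rule continuous_on_subset[OF hyp(1)] inj_on_subset[OF hyp(2)]; use hyp in auto)+
      then show ?thesis using continuous_inj_imp_mono[of x y v h] hyp xv False by auto
    qed (use xv in simp)
  qed
  consider "h u < h v" | "h v < h u" | "h u = h v" by linarith
  then show ?thesis
  proof cases
    case 1
    then show ?thesis using key[OF cont inj 1] by (auto simp: strict_mono_on_def)
  next
    case 2
    have "- h x < - h y" if "u \<le> x" "x < y" "y \<le> v" for x y
      using key[of "\<lambda>x. - h x"] 2 that cont inj by (simp add: continuous_on_minus inj_on_def)
    then show ?thesis by (intro disjI2 monotone_onI) auto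
  next
    case 3
    show ?thesis
    proof (cases "u < v")
      case True
      then have "u = v" using inj 3 by (auto dest: inj_onD)
      then show ?thesis using True by simp
    next
      case False
      then show ?thesis by (intro disjI1 strict_mono_onI) auto
    qed
  qed
qed

text \<open>This makes maximal intervals of monotonicity closed, so that their end points can be
  examined.\<close>

lemma closure_monotone_interval:
  fixes h :: "real \<Rightarrow> real"
  assumes cont: "continuous_on UNIV h" and J: "monotone_interval h J"
  shows "monotone_interval h (closure J)"
proof -
  have key: "mono_on (closure J) h" if m: "mono_on J h" and cont: "continuous_on UNIV h" for h :: "real \<Rightarrow> real"
  proof (rule mono_onI)
    fix x y assume xy: "x \<in> closure J" "y \<in> closure J" "x \<le> y"
    show "h x \<le> h y"
    proof (cases "x = y")
      case False
      obtain a where a: "\<And>n. a n \<in> J" "a \<longlonglongrightarrow> x" using xy(1) unfolding closure_sequential by blast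
      obtain b where b: "\<And>n. b n \<in> J" "b \<longlonglongrightarrow> y" using xy(2) unfolding closure_sequential by blast
      have ha: "(\<lambda>n. h (a n)) \<longlonglongrightarrow> h x" by (rule continuous_on_tendsto_compose[OF cont a(2)]) auto
      have hb: "(\<lambda>n. h (b n)) \<longlonglongrightarrow> h y" by (rule continuous_on_tendsto_compose[OF cont b(2)]) auto
      define z where "z = (x + y) / 2"
      have z: "x < z" "z < y" using False xy(3) by (auto simp: z_def)
      have "\<forall>\<^sub>F n in sequentially. a n < z" "\<forall>\<^sub>F n in sequentially. z < b n"
        using order_tendstoD(2)[OF a(2) z(1)] order_tendstoD(1)[OF b(2) z(2)] by auto
      then have "\<forall>\<^sub>F n in sequentially. h (a n) \<le> h (b n)"
      proof eventually_elim
        case (elim n)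
        then show ?case using m a(1) b(1) by (intro mono_onD[OF m]) auto
      qed
      then show ?thesis by (intro tendsto_le[OF _ hb ha]) auto
    qed simp
  qed
  have "is_interval (closure J)" using J unfolding monotone_interval_def
    by (simp add: is_interval_connected_1 connected_imp_connected_closure)
  moreover have "mono_on (closure J) h \<or> antimono_on (closure J) h"
  proof (cases "mono_on J h")
    case True
    then show ?thesis using key[OF _ cont] by simp
  next
    case False
    then have "antimono_on J h" using J by (simp add: monotone_interval_def)
    then have "mono_on J (\<lambda>x. - h x)" by (auto simp: monotone_on_def)
    then have "mono_on (closure J) (\<lambda>x. - h x)" by (rule key) (intro continuous_on_minus cont)
    then show ?thesis by (auto simp: monotone_on_def)
  qed
  ultimately show ?thesis by (simp add: monotone_interval_def)
qed

context even_degree begin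

lemma finite_preimage: assumes "finite A" shows "finite ((g a ^^ n) -` A)"
proof -
  have inj: "inj_on (g a) {0..}" "inj_on (g a) {..0}"
  proof -
    have "strict_mono_on {0..} (g a)" using g_pos_increasing by (intro strict_mono_onI) auto
    then show "inj_on (g a) {0..}" by (rule strict_mono_on_imp_inj_on)
    show "inj_on (g a) {..0}"
    proof (rule inj_onI)
      fix x y assume "x \<in> {..0}" "y \<in> {..0}" "g a x = g a y"
      then show "x = y" using g_neg_decreasing[of x y a] g_neg_decreasing[of y x a] by (cases x y rule: linorder_cases) auto
    qed
  qed
  have one: "finite (g a -` B)" if "finite B" for B
  proof -
    have "g a -` B = (g a -` B \<inter> {0..}) \<union> (g a -` B \<inter> {..0})" by auto
    moreover have "finite (g a -` B \<inter> {0..})" by (rule finite_vimage_IntI[OF that inj(1)])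
    moreover have "finite (g a -` B \<inter> {..0})" by (rule finite_vimage_IntI[OF that inj(2)])
    ultimately show ?thesis by (metis finite_UnI)
  qed
  show ?thesis
  proof (induction n)
    case (Suc n)
    have "(g a ^^ Suc n) -` A = g a -` (g a ^^ n) -` A" by (auto simp: unicritical_iterate_Suc simp del: funpow.simps)
    then show ?case using one[OF Suc] by (simp only:)
  qed (use assms in simp)
qed

definition critical :: "real \<Rightarrow> nat \<Rightarrow> real \<Rightarrow> bool" where
  "critical a n y \<longleftrightarrow> (\<exists>i<n. (g a ^^ i) y = 0)"

lemma critical_finite: "finite {y. critical a n y}"
proof -
  have "{y. critical a n y} = (\<Union>i<n. (g a ^^ i) -` {0})" by (auto simp: critical_def)
  then show ?thesis using finite_preimage[of "{0}"] by simp
qed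

text \<open>End points may be critical: without interior zeros an injective iterate keeps one weak
  sign on the closed interval, and \<open>g\<close> is injective on each closed half-line.\<close>

lemma iterate_inj:
  assumes "\<And>y. u < y \<Longrightarrow> y < v \<Longrightarrow> \<not> critical a n y"
  shows "inj_on (g a ^^ n) {u..v}"
  using assms
proof (induction n)
  case (Suc n)
  have crit: "\<And>y. u < y \<Longrightarrow> y < v \<Longrightarrow> \<not> critical a n y \<and> (g a ^^ n) y \<noteq> 0"
    using Suc.prems unfolding critical_def by (metis less_Suc_eq)
  then have inj: "inj_on (g a ^^ n) {u..v}" using Suc.IH by blast
  have cont: "continuous_on S (g a ^^ n)" for S by (rule unicritical_iterate_continuous_real)
  have sgn: "(g a ^^ n) y \<ge> 0 \<and> (g a ^^ n) z \<ge> 0 \<or> (g a ^^ n) y \<le> 0 \<and> (g a ^^ n) z \<le> 0"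
    if yz: "y \<in> {u..v}" "z \<in> {u..v}" "y < z" for y z
  proof (rule ccontr)
    assume "\<not> ?thesis"
    then consider "(g a ^^ n) y < 0" "(g a ^^ n) z > 0" | "(g a ^^ n) y > 0" "(g a ^^ n) z < 0" by linarith
    then have "\<exists>w. y \<le> w \<and> w \<le> z \<and> (g a ^^ n) w = 0 \<and> w \<noteq> y \<and> w \<noteq> z"
    proof cases
      case 1
      then obtain w where "y \<le> w" "w \<le> z" "(g a ^^ n) w = 0" using IVT'[of "g a ^^ n" y 0 z] cont yz by auto
      then show ?thesis using 1 by (intro exI[of _ w]) auto
    next
      case 2
      then obtain w where "y \<le> w" "w \<le> z" "(g a ^^ n) w = 0" using IVT2'[of "g a ^^ n" z 0 y] cont yz by auto
      then show ?thesis using 2 by (intro exI[of _ w]) auto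
    qed
    then obtain w where "y \<le> w" "w \<le> z" "(g a ^^ n) w = 0" "w \<noteq> y" "w \<noteq> z" by blast
    then show False using crit[of w] yz by auto
  qed
  have ne: "g a ((g a ^^ n) y) \<noteq> g a ((g a ^^ n) z)" if yz: "y \<in> {u..v}" "z \<in> {u..v}" "y < z" for y z
  proof -
    have "(g a ^^ n) y \<noteq> (g a ^^ n) z" using inj yz by (auto dest: inj_onD)
    then show ?thesis
      using sgn[OF yz] g_pos_increasing[of "(g a ^^ n) y" "(g a ^^ n) z" a] g_pos_increasing[of "(g a ^^ n) z" "(g a ^^ n) y" a]
        g_neg_decreasing[of "(g a ^^ n) y" "(g a ^^ n) z" a] g_neg_decreasing[of "(g a ^^ n) z" "(g a ^^ n) y" a]
      by linarith
  qed
  show ?case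
  proof (rule inj_onI)
    fix y z assume "y \<in> {u..v}" "z \<in> {u..v}" "(g a ^^ Suc n) y = (g a ^^ Suc n) z"
    then show "y = z" using ne[of y z] ne[of z y] by (cases y z rule: linorder_cases) auto
  qed
qed simp

lemma noncritical_monotone:
  assumes "\<And>y. u < y \<Longrightarrow> y < v \<Longrightarrow> \<not> critical a n y"
  shows "monotone_interval (g a ^^ n) {u..v}"
proof -
  have "strict_mono_on {u..v} (g a ^^ n) \<or> strict_antimono_on {u..v} (g a ^^ n)"
    by (rule inj_continuous_monotone[OF unicritical_iterate_continuous_real iterate_inj]) (rule assms)
  then have "mono_on {u..v} (g a ^^ n) \<or> antimono_on {u..v} (g a ^^ n)"
  proof
    assume "strict_mono_on {u..v} (g a ^^ n)"
    then show ?thesis by (intro disjI1 strict_mono_on_imp_mono_on)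
  next
    assume *: "strict_antimono_on {u..v} (g a ^^ n)"
    have "antimono_on {u..v} (g a ^^ n)"
    proof (rule monotone_onI)
      fix x y assume "x \<in> {u..v}" "y \<in> {u..v}" "x \<le> y"
      then show "(g a ^^ n) x \<ge> (g a ^^ n) y" using monotone_onD[OF *, of x y] by (cases "x = y") auto
    qed
    then show ?thesis ..
  qed
  then show ?thesis by (simp add: monotone_interval_def is_interval_cc)
qed

text \<open>At an interior critical point of an iterate, evenness makes two different points have the
  same image, and the iterate is constant between them if it is monotone.\<close>

lemma monotone_noncritical:
  assumes mono: "mono_on {u..v} (g a ^^ n) \<or> antimono_on {u..v} (g a ^^ n)" and y: "u < y" "y < v"
  shows "\<not> critical a n y"
proof
  assume "critical a n y"
  then have ex: "\<exists>i. i < n \<and> (\<exists>z. u < z \<and> z < v \<and> (g a ^^ i) z = 0)" using y by (auto simp: critical_def)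
  define i where "i = (LEAST i. i < n \<and> (\<exists>z. u < z \<and> z < v \<and> (g a ^^ i) z = 0))"
  obtain z where z: "i < n" "u < z" "z < v" "(g a ^^ i) z = 0" using LeastI_ex[OF ex] unfolding i_def by blast
  have min: "\<not> critical a i w" if "u < w" "w < v" for w
  proof
    assume "critical a i w"
    then obtain j where "j < i" "(g a ^^ j) w = 0" by (auto simp: critical_def)
    then show False using not_less_Least[of j "\<lambda>i. i < n \<and> (\<exists>z. u < z \<and> z < v \<and> (g a ^^ i) z = 0)"] z(1) that
      unfolding i_def[symmetric] by fastforce
  qed
  have cont: "continuous_on S (g a ^^ i)" for S by (rule unicritical_iterate_continuous_real)
  have "strict_mono_on {u..v} (g a ^^ i) \<or> strict_antimono_on {u..v} (g a ^^ i)"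
    by (rule inj_continuous_monotone[OF cont iterate_inj]) (rule min)
  then have "\<exists>z1 z2. u \<le> z1 \<and> z1 < z2 \<and> z2 \<le> v \<and> (g a ^^ i) z1 = - (g a ^^ i) z2"
  proof
    assume sm: "strict_mono_on {u..v} (g a ^^ i)"
    have neg: "(g a ^^ i) u < 0" and pos: "(g a ^^ i) v > 0"
      using strict_mono_onD[OF sm, of u z] strict_mono_onD[OF sm, of z v] z by auto
    define e where "e = min (- (g a ^^ i) u) ((g a ^^ i) v)"
    have ee: "(g a ^^ i) u \<le> - e" "- e \<le> 0" "0 \<le> e" "e \<le> (g a ^^ i) v" using neg pos unfolding e_def by linarith+
    obtain z1 where z1: "u \<le> z1" "z1 \<le> z" "(g a ^^ i) z1 = - e"
      using IVT'[of "g a ^^ i" u "- e" z] cont z ee by auto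
    obtain z2 where z2: "z \<le> z2" "z2 \<le> v" "(g a ^^ i) z2 = e"
      using IVT'[of "g a ^^ i" z e v] cont z ee by auto
    have "z1 \<noteq> z2" using z1 z2 neg pos by (auto simp: e_def)
    then show ?thesis using z1 z2 by (intro exI[of _ z1] exI[of _ z2]) auto
  next
    assume sm: "strict_antimono_on {u..v} (g a ^^ i)"
    have pos: "(g a ^^ i) u > 0" and neg: "(g a ^^ i) v < 0"
      using monotone_onD[OF sm, of u z] monotone_onD[OF sm, of z v] z by auto
    define e where "e = min ((g a ^^ i) u) (- (g a ^^ i) v)"
    have ee: "(g a ^^ i) v \<le> - e" "- e \<le> 0" "0 \<le> e" "e \<le> (g a ^^ i) u" using neg pos unfolding e_def by linarith+
    obtain z1 where z1: "u \<le> z1" "z1 \<le> z" "(g a ^^ i) z1 = e"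
      using IVT2'[of "g a ^^ i" z e u] cont z ee by auto
    obtain z2 where z2: "z \<le> z2" "z2 \<le> v" "(g a ^^ i) z2 = - e"
      using IVT2'[of "g a ^^ i" v "- e" z] cont z ee by auto
    have "z1 \<noteq> z2" using z1 z2 neg pos by (auto simp: e_def)
    then show ?thesis using z1 z2 by (intro exI[of _ z1] exI[of _ z2]) auto
  qed
  then obtain z1 z2 where zz: "u \<le> z1" "z1 < z2" "z2 \<le> v" "(g a ^^ i) z1 = - (g a ^^ i) z2" by blast
  have split: "(g a ^^ n) w = (g a ^^ (n - i)) ((g a ^^ i) w)" for w
    using z(1) by (metis funpow_add less_imp_le le_add_diff_inverse2 o_apply)
  have eq: "(g a ^^ n) z1 = (g a ^^ n) z2" unfolding split zz(4) using z(1) by (intro iterate_minus) simp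
  have "(g a ^^ n) w = (g a ^^ n) z1" if "w \<in> {z1..z2}" for w
    using mono
  proof
    assume m: "mono_on {u..v} (g a ^^ n)"
    have "(g a ^^ n) z1 \<le> (g a ^^ n) w" "(g a ^^ n) w \<le> (g a ^^ n) z2"
      by (rule mono_onD[OF m]; use that zz in auto)+
    then show ?thesis using eq by simp
  next
    assume m: "antimono_on {u..v} (g a ^^ n)"
    have "(g a ^^ n) z1 \<ge> (g a ^^ n) w" "(g a ^^ n) w \<ge> (g a ^^ n) z2"
      by (rule monotone_onD[OF m]; use that zz in auto)+
    then show ?thesis using eq by simp
  qed
  then have "{z1..z2} \<subseteq> (g a ^^ n) -` {(g a ^^ n) z1}" by (intro subsetI vimageI2 singletonI) (simp only: singleton_iff)
  then have "finite {z1..z2}" by (rule finite_subset) (simp add: finite_preimage)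
  then show False using zz(2) infinite_Icc by blast
qed

text \<open>\<open>e1\<close> becomes critical at time \<open>i\<close> and \<open>e2\<close> later,
  at time \<open>j\<close>. Measured at time \<open>j\<close>, the branch joins \<open>g^p 0\<close>
  to \<open>0\<close>, with \<open>p = j - i\<close>; \<open>n - j\<close> more iterates
  remain.\<close>

lemma branch_length:
  assumes a: "good a"
    and crit: "\<And>p. p \<ge> 1 \<Longrightarrow> \<bar>(g a ^^ p) 0\<bar> < \<bar>a\<bar> \<Longrightarrow> (g a ^^ p) 0 < 0 \<and> (\<exists>x<0. strict_mono_on {x..0} (g a ^^ p))"
    and x: "a < x" "x \<le> 0" "(g a ^^ 2) x = - a"
    and uv: "u < v" "\<And>y. u < y \<Longrightarrow> y < v \<Longrightarrow> \<not> critical a n y"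
    and e: "{e1, e2} = {u, v}" "i < j" "j < n" "(g a ^^ i) e1 = 0" "(g a ^^ j) e2 = 0"
  shows "\<bar>(g a ^^ n) e1 - (g a ^^ n) e2\<bar> \<ge> min (\<bar>a\<bar> ^ l) \<bar>a\<bar>"
proof -
  have an: "a < 0" using a good_neg by blast
  have e12: "e1 \<in> {u..v}" "e2 \<in> {u..v}" "e1 \<noteq> e2" using e(1) uv(1) by (auto simp: doubleton_eq_iff)
  have cont: "continuous_on S (g a ^^ k)" for S k by (rule unicritical_iterate_continuous_real)
  have split: "(g a ^^ (r + k)) z = (g a ^^ r) ((g a ^^ k) z)" for r k z by (simp add: funpow_add)
  have interior: "\<exists>z. u < z \<and> z < v \<and> (g a ^^ k) z = w"
    if "w \<in> {min ((g a ^^ k) e1) ((g a ^^ k) e2)<..<max ((g a ^^ k) e1) ((g a ^^ k) e2)}" for k w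
  proof -
    have "connected ((g a ^^ k) ` {u..v})" by (rule connected_continuous_image[OF cont]) simp
    moreover have "(g a ^^ k) e1 \<in> (g a ^^ k) ` {u..v}" "(g a ^^ k) e2 \<in> (g a ^^ k) ` {u..v}" using e12 by auto
    ultimately have "w \<in> (g a ^^ k) ` {u..v}"
      using that unfolding connected_iff_interval by (metis greaterThanLessThan_iff less_imp_le max_def min_def)
    then obtain z where z: "z \<in> {u..v}" "(g a ^^ k) z = w" by blast
    moreover have "z \<noteq> e1" "z \<noteq> e2" using z(2) that by auto
    then have "z \<noteq> u" "z \<noteq> v" using e(1) by (auto simp: doubleton_eq_iff)
    ultimately show ?thesis by (intro exI[of _ z]) auto
  qed
  text \<open>By evenness, everything is pulled to the negative side of the critical point.\<close>
  have noncrit: "\<not> critical a (n - k) w" if k: "k < n" and w: "w < 0"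
    and or: "(g a ^^ k) e1 = 0 \<and> - \<bar>(g a ^^ k) e2\<bar> < w \<or> (g a ^^ k) e2 = 0 \<and> - \<bar>(g a ^^ k) e1\<bar> < w" for k w
  proof
    assume "critical a (n - k) w"
    then obtain r where r: "r < n - k" "(g a ^^ r) w = 0" by (auto simp: critical_def)
    then have r1: "r \<ge> 1" using w by (cases r) auto
    have "w \<in> {min ((g a ^^ k) e1) ((g a ^^ k) e2)<..<max ((g a ^^ k) e1) ((g a ^^ k) e2)} \<or>
       - w \<in> {min ((g a ^^ k) e1) ((g a ^^ k) e2)<..<max ((g a ^^ k) e1) ((g a ^^ k) e2)}"
      using or w by (auto simp: min_def max_def abs_if split: if_splits)
    then obtain z where z: "u < z" "z < v" "(g a ^^ k) z = w \<or> (g a ^^ k) z = - w" using interior by blast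
    then have "(g a ^^ (r + k)) z = 0" unfolding split using r(2) iterate_minus[OF r1, of a w] by auto
    then show False using uv(2)[OF z(1,2)] r(1) unfolding critical_def by (meson less_diff_conv)
  qed
  define p where "p = j - i"
  have p1: "p \<ge> 1" using e(2) by (simp add: p_def)
  define y where "y = - \<bar>(g a ^^ i) e2\<bar>"
  have ge1: "(g a ^^ j) e1 = (g a ^^ p) 0"
    using split[of p i e1] e(2,4) by (simp add: p_def)
  have gp: "(g a ^^ p) y = 0"
  proof -
    have "(g a ^^ p) ((g a ^^ i) e2) = 0" using split[of p i e2] e(2,5) by (simp add: p_def)
    then show ?thesis unfolding y_def using iterate_minus[OF p1] by (auto simp: abs_if)
  qed
  have y0: "y < 0"
  proof -
    have "inj_on (g a ^^ i) {u..v}"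
      by (rule iterate_inj) (use uv(2) e(2,3) in \<open>force simp: critical_def\<close>)
    then have "(g a ^^ i) e1 \<noteq> (g a ^^ i) e2" using e12 by (auto dest: inj_onD)
    then show ?thesis using e(4) by (simp add: y_def)
  qed
  have inj_y: "inj_on (g a ^^ p) {y..0}"
  proof (rule iterate_inj)
    fix w assume "y < w" "w < 0"
    then have "\<not> critical a (n - i) w" using e by (intro noncrit) (auto simp: y_def)
    then show "\<not> critical a p w" using e(2,3) unfolding critical_def p_def by (meson diff_less_mono less_imp_le less_trans)
  qed
  \<comment> \<open>Otherwise \<open>g^p\<close> is negative at \<open>0\<close> and increases on
    the left of it, yet returns to \<open>0\<close> at \<open>y\<close>. It would take the value
    \<open>g^p 0\<close> once more on \<open>[y, 0]\<close>, where it is injective.\<close>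
  have cp: "\<bar>(g a ^^ p) 0\<bar> \<ge> \<bar>a\<bar>"
  proof (rule ccontr)
    assume "\<not> ?thesis"
    then obtain x' where x': "(g a ^^ p) 0 < 0" "x' < 0" "strict_mono_on {x'..0} (g a ^^ p)" using crit[OF p1] by auto
    define w where "w = max x' (y / 2)"
    have w: "w < 0" "w \<in> {x'..0}" "y < w" using x'(2) y0 by (auto simp: w_def)
    have lt: "(g a ^^ p) w < (g a ^^ p) 0" by (rule strict_mono_onD[OF x'(3)]) (use w x' in auto)
    obtain w' where w': "y \<le> w'" "w' \<le> w" "(g a ^^ p) w' = (g a ^^ p) 0"
      using IVT2'[of "g a ^^ p" w "(g a ^^ p) 0" y] lt gp x'(1) w cont by auto
    have "w' = 0" by (rule inj_onD[OF inj_y w'(3)]) (use w'(1,2) w(1) y0 in auto)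
    then show False using w' w by simp
  qed
  define q where "q = n - j"
  have q1: "q \<ge> 1" using e(3) by (simp add: q_def)
  define C where "C = - \<bar>(g a ^^ p) 0\<bar>"
  have Ca: "C \<le> a" using cp an by (simp add: C_def)
  have inj_q: "inj_on (g a ^^ q) {C..0}"
  proof (rule iterate_inj)
    fix w assume "C < w" "w < 0"
    then show "\<not> critical a q w" unfolding q_def using e by (intro noncrit) (auto simp: C_def ge1)
  qed
  have h1: "(g a ^^ n) e1 = (g a ^^ q) C"
  proof -
    have "(g a ^^ n) e1 = (g a ^^ q) ((g a ^^ p) 0)" using split[of q j e1] e(3) ge1 by (simp add: q_def)
    then show ?thesis unfolding C_def using iterate_minus[OF q1] by (auto simp: abs_if)
  qed
  have h2: "(g a ^^ n) e2 = (g a ^^ q) 0" using split[of q j e2] e(3,5) by (simp add: q_def)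
  \<comment> \<open>Up to sign the branch now covers \<open>[a, 0]\<close>, which contains
    \<open>a\<close> and \<open>x\<close>; these are identified by \<open>g^3\<close>, since
    \<open>g^2 x = -a\<close>.\<close>
  have "q \<le> 2"
  proof (rule ccontr)
    assume "\<not> q \<le> 2"
    then have "(g a ^^ q) z = (g a ^^ (q - 3)) ((g a ^^ 3) z)" for z using split[of "q - 3" 3 z] by simp
    moreover have "(g a ^^ 3) x = (g a ^^ 3) a"
    proof -
      have "(g a ^^ 3) x = g a ((g a ^^ 2) x)" by (simp add: numeral_3_eq_3 numeral_2_eq_2)
      then show ?thesis by (simp add: x(3) g_minus)
    qed
    ultimately have eq: "(g a ^^ q) x = (g a ^^ q) a" by simp
    have "x = a" by (rule inj_onD[OF inj_q eq]) (use x(1,2) Ca an in auto)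
    then show False using x by simp
  qed
  then consider "q = 1" | "q = 2" using q1 by linarith
  then show ?thesis
  proof cases
    case 1
    have "(g a ^^ n) e1 - (g a ^^ n) e2 = C ^ l" unfolding h1 h2 1 using l2 by (simp add: unicritical_def power_0_left)
    also have "\<dots> = \<bar>C\<bar> ^ l" using even_l by (simp add: power_even_abs)
    also have "\<dots> \<ge> \<bar>a\<bar> ^ l" using Ca an by (intro power_mono) auto
    finally show ?thesis by simp
  next
    case 2
    \<comment> \<open>The value at \<open>a\<close> is \<open>a\<close> and that at \<open>0\<close>
      is at least \<open>-a\<close>, so here the image has length at least
      \<open>2 * \<bar>a\<bar>\<close>.\<close>
    have lt: "(g a ^^ 2) a < (g a ^^ 2) 0" using g2_increasing[OF a, of a 0] an by simp
    have "strict_mono_on {C..0} (g a ^^ 2) \<or> strict_antimono_on {C..0} (g a ^^ 2)"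
      using inj_continuous_monotone[OF cont inj_q] by (simp add: 2)
    moreover have "\<not> strict_antimono_on {C..0} (g a ^^ 2)"
      using lt Ca an monotone_onD[of "{C..0}" "(<)" "(>)" "g a ^^ 2" a 0] by auto
    ultimately have sm: "strict_mono_on {C..0} (g a ^^ 2)" by blast
    have "(g a ^^ 2) C \<le> (g a ^^ 2) a" using Ca an by (intro strict_mono_on_leD[OF sm]) auto
    moreover have "- a \<le> (g a ^^ 2) 0" using g2_mono[OF a, of x 0] x by simp
    ultimately show ?thesis unfolding h1 h2 2 using an by simp
  qed
qed

text \<open>An unbounded branch has an unbounded image. The ends of a bounded one are critical by
  maximality, and at different times, since the iterate up to then is injective;
  \<open>branch_length\<close> applies. Halving in \<kappa> gives the strict inequality.\<close>

lemma long_branched_family: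
  assumes a: "good a"
    and crit: "\<And>p. p \<ge> 1 \<Longrightarrow> \<bar>(g a ^^ p) 0\<bar> < \<bar>a\<bar> \<Longrightarrow> (g a ^^ p) 0 < 0 \<and> (\<exists>x<0. strict_mono_on {x..0} (g a ^^ p))"
    and x: "a < x" "x \<le> 0" "(g a ^^ 2) x = - a"
  shows "long_branched (g a)"
proof -
  have an: "a < 0" using a good_neg by blast
  define \<kappa> where "\<kappa> = min (\<bar>a\<bar> ^ l) \<bar>a\<bar> / 2"
  have k: "\<kappa> > 0" using an by (simp add: \<kappa>_def)
  show ?thesis unfolding long_branched_def
  proof (intro exI[of _ \<kappa>] conjI allI impI)
    show "\<kappa> > 0" by (rule k)
    fix n :: nat and J assume n: "1 \<le> n" and J: "maximal_monotone_interval (g a ^^ n) J"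
    let ?h = "g a ^^ n"
    have cont: "continuous_on S (g a ^^ k)" for S k by (rule unicritical_iterate_continuous_real)
    have mono: "monotone_interval ?h J" and max: "\<And>J'. monotone_interval ?h J' \<Longrightarrow> J \<subseteq> J' \<Longrightarrow> J' = J"
      using J by (auto simp: maximal_monotone_interval_def)
    have suff: "emeasure lborel (?h ` J) > ennreal \<kappa>" if p: "p \<in> J" "q \<in> J" "\<kappa> < ?h q - ?h p" for p q
    proof -
      have "connected (?h ` J)" using mono cont
        by (intro connected_continuous_image) (auto simp: monotone_interval_def is_interval_connected_1)
      then have "{?h p..?h q} \<subseteq> ?h ` J" using p by (intro connected_contains_Icc) auto
      moreover have "?h ` J \<in> sets borel"
        using \<open>connected (?h ` J)\<close> by (intro real_interval_borel_measurable) (simp add: is_interval_connected_1)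
      ultimately have "emeasure lborel {?h p..?h q} \<le> emeasure lborel (?h ` J)" by (intro emeasure_mono) auto
      moreover have "emeasure lborel {?h p..?h q} = ennreal (?h q - ?h p)" using p k by simp
      moreover have "ennreal \<kappa> < ennreal (?h q - ?h p)" using p k by (simp add: ennreal_less_iff)
      ultimately show ?thesis by (simp only: order_less_le_trans)
    qed
    have "closure J = J" by (rule max[OF closure_monotone_interval[OF cont mono] closure_subset])
    then have closedJ: "closed J" by (simp only: closure_eq)
    have neJ: "J \<noteq> {}"
    proof
      assume "J = {}"
      moreover have "monotone_interval ?h {0..0}" by (rule noncritical_monotone) linarith
      ultimately show False using max[of "{0..0}"] by simp
    qed
    show "emeasure lborel (?h ` J) > ennreal \<kappa>"
    proof (cases "bounded J")
      case False
      obtain p where p: "p \<in> J" using neJ by blast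
      define b where "b = max (2 + \<bar>a - a ^ l\<bar>) (\<bar>?h p\<bar> + \<kappa> + 1)"
      obtain q where q: "q \<in> J" "\<bar>q\<bar> > b" using False unfolding bounded_iff by (metis not_le real_norm_def)
      have "?h \<bar>q\<bar> \<ge> \<bar>q\<bar> + real n" using q by (intro iterate_grow) (auto simp: b_def)
      moreover have "?h \<bar>q\<bar> = ?h q" using iterate_minus[OF n, of a q] by (simp add: abs_if)
      ultimately have "\<kappa> < ?h q - ?h p" using q(2) unfolding b_def by linarith
      then show ?thesis by (rule suff[OF p q(1)])
    next
      case True
      then have "compact J" using closedJ compact_eq_bounded_closed by blast
      moreover have "connected J" using mono by (simp add: monotone_interval_def is_interval_connected_1)
      ultimately obtain u v where Juv: "J = {u..v}" using connected_compact_interval_1[of J] unfolding cbox_interval by blast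
      have uv: "u \<le> v" using neJ Juv by simp
      have fin: "finite {y. critical a n y}" by (rule critical_finite)
      have inner: "\<not> critical a n y" if "u < y" "y < v" for y
        using mono that unfolding monotone_interval_def Juv by (intro monotone_noncritical) auto
      have right: "\<exists>e>z. \<forall>y. z < y \<longrightarrow> y < e \<longrightarrow> \<not> critical a n y" for z
      proof -
        obtain d where d: "d > 0" "\<And>y. critical a n y \<Longrightarrow> y \<noteq> z \<Longrightarrow> d \<le> dist z y"
          using finite_set_avoid[OF fin, of z] by auto
        have "\<not> critical a n y" if "z < y" "y < z + d" for y using d(2)[of y] that by (auto simp: dist_real_def)
        then show ?thesis using d(1) by (intro exI[of _ "z + d"]) auto
      qed
      have left: "\<exists>e<z. \<forall>y. e < y \<longrightarrow> y < z \<longrightarrow> \<not> critical a n y" for z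
      proof -
        obtain d where d: "d > 0" "\<And>y. critical a n y \<Longrightarrow> y \<noteq> z \<Longrightarrow> d \<le> dist z y"
          using finite_set_avoid[OF fin, of z] by auto
        have "\<not> critical a n y" if "z - d < y" "y < z" for y using d(2)[of y] that by (auto simp: dist_real_def)
        then show ?thesis using d(1) by (intro exI[of _ "z - d"]) auto
      qed
      have uv': "u < v"
      proof (rule ccontr)
        assume "\<not> u < v"
        then have eq: "u = v" using uv by simp
        obtain e where e: "e > v" "\<And>y. v < y \<Longrightarrow> y < e \<Longrightarrow> \<not> critical a n y" using right by blast
        have "monotone_interval ?h {u..e}" by (rule noncritical_monotone) (use e eq in auto)
        then show False using max[of "{u..e}"] e Juv eq by auto
      qed
      have cu: "critical a n u"
      proof (rule ccontr)
        assume nc: "\<not> critical a n u"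
        obtain e where e: "e < u" "\<And>y. e < y \<Longrightarrow> y < u \<Longrightarrow> \<not> critical a n y" using left by blast
        have "monotone_interval ?h {e..v}"
        proof (rule noncritical_monotone)
          show "\<not> critical a n y" if "e < y" "y < v" for y using e(2)[of y] inner[of y] nc that by (cases y u rule: linorder_cases) auto
        qed
        then show False using max[of "{e..v}"] e Juv uv by auto
      qed
      have cv: "critical a n v"
      proof (rule ccontr)
        assume nc: "\<not> critical a n v"
        obtain e where e: "e > v" "\<And>y. v < y \<Longrightarrow> y < e \<Longrightarrow> \<not> critical a n y" using right by blast
        have "monotone_interval ?h {u..e}"
        proof (rule noncritical_monotone)
          show "\<not> critical a n y" if "u < y" "y < e" for y using e(2)[of y] inner[of y] nc that by (cases y v rule: linorder_cases) auto
        qed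
        then show False using max[of "{u..e}"] e Juv uv by auto
      qed
      obtain i where i: "i < n" "(g a ^^ i) u = 0" using cu by (auto simp: critical_def)
      obtain j where j: "j < n" "(g a ^^ j) v = 0" using cv by (auto simp: critical_def)
      have "i \<noteq> j"
      proof
        assume eq: "i = j"
        have "inj_on (g a ^^ i) {u..v}"
          by (rule iterate_inj) (use inner i(1) in \<open>force simp: critical_def\<close>)
        then have "u = v" by (rule inj_onD) (use i(2) j(2) eq uv in auto)
        then show False using uv' by simp
      qed
      then consider "i < j" | "j < i" by linarith
      then have "\<bar>?h u - ?h v\<bar> \<ge> min (\<bar>a\<bar> ^ l) \<bar>a\<bar>"
      proof cases
        case 1
        show ?thesis by (rule branch_length[OF a crit x uv' inner _ 1 j(1) i(2) j(2)]) auto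
      next
        case 2
        have "\<bar>?h v - ?h u\<bar> \<ge> min (\<bar>a\<bar> ^ l) \<bar>a\<bar>"
          by (rule branch_length[OF a crit x uv' inner _ 2 i(1) j(2) i(2)]) auto
        then show ?thesis by (simp add: abs_minus_commute)
      qed
      moreover have "min (\<bar>a\<bar> ^ l) \<bar>a\<bar> = 2 * \<kappa>" by (simp add: \<kappa>_def)
      ultimately have "\<kappa> < \<bar>?h u - ?h v\<bar>" using k by linarith
      then show ?thesis using suff[of u v] suff[of v u] Juv uv by (auto simp: abs_if split: if_splits)
    qed
  qed
qed

end

section \<open>The postcritical set\<close>

lemma omega_limit_iff:
  fixes f :: "'a::metric_space \<Rightarrow> 'a"
  shows "y \<in> omega_limit f x \<longleftrightarrow> (\<forall>e>0. \<forall>N. \<exists>n>N. dist ((f ^^ n) x) y < e)"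
proof
  assume "y \<in> omega_limit f x"
  then obtain r where r: "strict_mono (r :: nat \<Rightarrow> nat)" "(\<lambda>k. (f ^^ r k) x) \<longlonglongrightarrow> y"
    by (auto simp: omega_limit_def)
  show "\<forall>e>0. \<forall>N. \<exists>n>N. dist ((f ^^ n) x) y < e"
  proof (intro allI impI)
    fix e :: real and N :: nat assume "e > 0"
    then obtain k0 where k0: "\<And>k. k \<ge> k0 \<Longrightarrow> dist ((f ^^ r k) x) y < e"
      using metric_LIMSEQ_D[OF r(2)] by blast
    define k where "k = max k0 (Suc N)"
    have "N < k" "k \<le> r k" using seq_suble[OF r(1)] by (auto simp: k_def)
    then show "\<exists>n>N. dist ((f ^^ n) x) y < e" using k0[of k] by (intro exI[of _ "r k"]) (auto simp: k_def)
  qed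
next
  assume *: "\<forall>e>0. \<forall>N. \<exists>n>N. dist ((f ^^ n) x) y < e"
  have "\<exists>r. \<forall>k. dist ((f ^^ r k) x) y < inverse (Suc k) \<and> r k < r (Suc k)"
  proof (rule dependent_nat_choice)
    show "\<exists>n. dist ((f ^^ n) x) y < inverse (real (Suc 0))" using *[rule_format, of "inverse (real (Suc 0))" 0] by auto
    show "\<exists>n'. dist ((f ^^ n') x) y < inverse (real (Suc (Suc k))) \<and> n < n'" for n k
      using *[rule_format, of "inverse (real (Suc (Suc k)))" n] by auto
  qed
  then obtain r where r: "\<And>k. dist ((f ^^ r k) x) y < inverse (Suc k)" "\<And>k. r k < r (Suc k)" by blast
  have "(\<lambda>k. dist ((f ^^ r k) x) y) \<longlonglongrightarrow> 0"
    by (rule tendsto_sandwich[OF _ _ tendsto_const LIMSEQ_inverse_real_of_nat])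
      (use r(1) in \<open>auto intro!: always_eventually less_imp_le\<close>)
  then have "(\<lambda>k. (f ^^ r k) x) \<longlonglongrightarrow> y" by (rule tendsto_dist_iff[THEN iffD2])
  moreover have "strict_mono r" using r(2) by (simp add: strict_mono_Suc_iff)
  ultimately show "y \<in> omega_limit f x" by (auto simp: omega_limit_def)
qed

lemma closed_omega_limit:
  fixes f :: "'a::metric_space \<Rightarrow> 'a"
  shows "closed (omega_limit f x)"
proof -
  have "y \<in> omega_limit f x" if y: "y \<in> closure (omega_limit f x)" for y
    unfolding omega_limit_iff
  proof (intro allI impI)
    fix e :: real and N :: nat assume e: "e > 0"
    then obtain z where z: "z \<in> omega_limit f x" "dist z y < e / 2"
      using y unfolding closure_approachable by (meson half_gt_zero)
    then obtain n where "n > N" "dist ((f ^^ n) x) z < e / 2"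
      using e unfolding omega_limit_iff by (meson half_gt_zero)
    then show "\<exists>n>N. dist ((f ^^ n) x) y < e"
      using z(2) dist_triangle_half_r[of z "(f ^^ n) x" e y] by (auto simp: dist_commute)
  qed
  then show ?thesis by (intro closure_subset_eq[THEN iffD1] subsetI)
qed

lemma recurrent_orbit:
  assumes "recurrent f x" "continuous_on UNIV (f ^^ n)"
  shows "(f ^^ n) x \<in> omega_limit f x"
proof -
  obtain r where r: "strict_mono (r :: nat \<Rightarrow> nat)" "(\<lambda>k. (f ^^ r k) x) \<longlonglongrightarrow> x"
    using assms(1) by (auto simp: recurrent_def omega_limit_def)
  have "(\<lambda>k. (f ^^ n) ((f ^^ r k) x)) \<longlonglongrightarrow> (f ^^ n) x"
    by (rule continuous_on_tendsto_compose[OF assms(2) r(2)]) auto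
  then have "(\<lambda>k. (f ^^ (n + r k)) x) \<longlonglongrightarrow> (f ^^ n) x" by (simp add: funpow_add)
  moreover have "strict_mono (\<lambda>k. n + r k)" using r(1) by (simp add: strict_mono_def)
  ultimately show ?thesis unfolding omega_limit_def by blast
qed

text \<open>The maps \<open>\<psi> i\<close>, inverse branches of the last \<open>N - i\<close>
  iterates, are univalent on a strip with margin \<open>s\<close> around the disc of radius
  \<open>s\<close>; hence the distortion \<open>exp (2 * koebe)\<close>. Their size is read off at a
  mean value point on the real axis, so the complex pullback stays comparable to the real interval
  at every time.\<close>

lemma pullback_disc:
  fixes c s y1 y2 j1 j2 :: real
  assumes l: "even l" "l \<ge> 2" and s: "s > 0" and ord: "j1 \<le> y1" "y1 < y2" "y2 \<le> j2"
    and ends: "(unicritical l c ^^ N) j1 = - (2 * s)" "(unicritical l c ^^ N) j2 = 2 * s"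
      "(unicritical l c ^^ N) y1 = - s" "(unicritical l c ^^ N) y2 = s"
    and mono: "strict_mono_on {j1..j2} (unicritical l c ^^ N)"
    and nz: "\<And>i y. i < N \<Longrightarrow> y \<in> {j1..j2} \<Longrightarrow> (unicritical l c ^^ i) y \<noteq> 0"
  obtains \<phi> where "\<phi> holomorphic_on cball 0 s"
    "\<And>w. w \<in> cball 0 s \<Longrightarrow> (unicritical l (complex_of_real c) ^^ N) (\<phi> w) = w"
    "\<And>w i. w \<in> cball 0 s \<Longrightarrow> i \<le> N \<Longrightarrow>
       norm ((unicritical l (complex_of_real c) ^^ i) (\<phi> w) - of_real ((unicritical l c ^^ i) y1))
         \<le> exp (2 * koebe) * \<bar>(unicritical l c ^^ i) y2 - (unicritical l c ^^ i) y1\<bar>"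
    "\<And>w. w \<in> cball 0 s \<Longrightarrow>
       norm (orbit_deriv l (complex_of_real c) N (\<phi> w)) \<le> 2 * s * exp (2 * koebe) / (y2 - y1)"
proof -
  let ?g = "unicritical l c" and ?f = "unicritical l (complex_of_real c)"
  define U where "U = {w. - (2 * s) < Re w \<and> Re w < 2 * s}"
  have U: "open U" "convex U" unfolding U_def by (rule strip_open, rule strip_convex)
  have cont: "continuous_on S (?g ^^ i)" for S i by (rule unicritical_iterate_continuous_real)
  have im: "x \<in> (?g ^^ N) ` {j1..j2}" if "complex_of_real x \<in> U" for x
  proof -
    have "- (2 * s) \<le> x" "x \<le> 2 * s" using that by (auto simp: U_def)
    then obtain y where "j1 \<le> y" "y \<le> j2" "(?g ^^ N) y = x"
      using IVT'[of "?g ^^ N" j1 x j2] ends(1,2) cont ord by auto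
    then show ?thesis by auto
  qed
  obtain \<phi> where \<phi>: "\<phi> holomorphic_on U" "\<And>w. w \<in> U \<Longrightarrow> (?f ^^ N) (\<phi> w) = w"
    "\<And>y. y \<in> {j1..j2} \<Longrightarrow> complex_of_real ((?g ^^ N) y) \<in> U \<Longrightarrow> \<phi> (of_real ((?g ^^ N) y)) = of_real y"
    using real_inverse_branch[where S="{j1..j2}" and N=N and c=c and U=U, OF l connected_Icc nz U(1) im] by blast
  have T: "ball z s \<subseteq> U" if "z \<in> cball 0 s" for z
    unfolding U_def by (rule strip_ball) (use that abs_Re_le_cmod[of z] in auto)
  have TU: "cball 0 s \<subseteq> U" using T s by (meson centre_in_ball subset_iff)
  define \<psi> where "\<psi> i = (?f ^^ i) \<circ> \<phi>" for i
  have hol: "\<psi> i holomorphic_on U" for i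
    unfolding \<psi>_def by (rule holomorphic_on_compose[OF \<phi>(1) unicritical_iterate_holomorphic])
  have split: "(?f ^^ (N - i)) (\<psi> i w) = w" if "w \<in> U" "i \<le> N" for w i
  proof -
    have "(?f ^^ (N - i)) ((?f ^^ i) (\<phi> w)) = (?f ^^ (N - i + i)) (\<phi> w)" by (simp only: funpow_add o_apply)
    then show ?thesis using that \<phi>(2)[OF that(1)] by (simp add: \<psi>_def)
  qed
  have inj: "inj_on (\<psi> i) U" if "i \<le> N" for i
    by (rule inj_on_inverseI[where g = "?f ^^ (N - i)"]) (rule split[OF _ that])
  have dist: "norm (deriv (\<psi> i) x) \<le> exp (2 * koebe) * norm (deriv (\<psi> i) y)"
    if "i \<le> N" "x \<in> cball 0 s" "y \<in> cball 0 s" for i x y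
  proof -
    have "norm (deriv (\<psi> i) x) \<le> exp (koebe / s * norm (x - y)) * norm (deriv (\<psi> i) y)"
      by (rule univalent_distortion[OF hol U inj[OF that(1)] convex_cball s T that(2,3)])
    also have "\<dots> \<le> exp (2 * koebe) * norm (deriv (\<psi> i) y)"
    proof (rule mult_right_mono)
      have "norm (x - y) \<le> norm x + norm y" by (rule norm_triangle_ineq4)
      also have "\<dots> \<le> 2 * s" using that by auto
      finally have "koebe / s * norm (x - y) \<le> koebe / s * (2 * s)"
        using koebe_pos s by (intro mult_left_mono) auto
      then show "exp (koebe / s * norm (x - y)) \<le> exp (2 * koebe)" using s by simp
    qed simp
    finally show ?thesis .
  qed
  have core: "\<exists>w\<in>cball 0 s. norm (deriv (\<psi> i) w) = \<bar>(?g ^^ i) y2 - (?g ^^ i) y1\<bar> / (2 * s)" if i: "i \<le> N" for i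
  proof -
    define u v where "u = (?g ^^ i) y1" and "v = (?g ^^ i) y2"
    have sp: "(?g ^^ (N - i)) ((?g ^^ i) y) = (?g ^^ N) y" for y
    proof -
      have "(?g ^^ (N - i)) ((?g ^^ i) y) = (?g ^^ (N - i + i)) y" by (simp only: funpow_add o_apply)
      then show ?thesis using i by simp
    qed
    have gu: "(?g ^^ (N - i)) u = - s" and gv: "(?g ^^ (N - i)) v = s" unfolding u_def v_def sp by (fact ends)+
    have "u \<noteq> v" using gu gv s by auto
    then have mm: "min u v < max u v" by auto
    obtain z where z: "min u v < z" "z < max u v"
      "(?g ^^ (N - i)) (max u v) - (?g ^^ (N - i)) (min u v) = (max u v - min u v) * orbit_deriv l c (N - i) z"
      by (rule iterate_MVT[OF mm])
    have "\<bar>(?g ^^ (N - i)) (max u v) - (?g ^^ (N - i)) (min u v)\<bar> = 2 * s" using gu gv s by (cases "u < v") auto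
    moreover have "\<bar>max u v - min u v\<bar> = \<bar>v - u\<bar>" by auto
    ultimately have eq: "2 * s = \<bar>v - u\<bar> * \<bar>orbit_deriv l c (N - i) z\<bar>" using z(3) by (simp add: abs_mult)
    have "\<exists>y. y1 \<le> y \<and> y \<le> y2 \<and> (?g ^^ i) y = z"
    proof (cases "u < v")
      case True
      then have "u \<le> z" "z \<le> v" using z(1,2) by auto
      then show ?thesis using IVT'[of "?g ^^ i" y1 z y2] cont ord(2) unfolding u_def v_def by auto
    next
      case False
      then have "v \<le> z" "z \<le> u" using z(1,2) by auto
      then show ?thesis using IVT2'[of "?g ^^ i" y2 z y1] cont ord(2) unfolding u_def v_def by auto
    qed
    then obtain y where y: "y1 \<le> y" "y \<le> y2" "(?g ^^ i) y = z" by blast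
    have "(?g ^^ N) y1 \<le> (?g ^^ N) y" "(?g ^^ N) y \<le> (?g ^^ N) y2"
      by (rule strict_mono_on_leD[OF mono]; use y(1,2) ord in simp)+
    then have sm: "\<bar>(?g ^^ N) y\<bar> \<le> s" unfolding ends by linarith
    define w where "w = complex_of_real ((?g ^^ N) y)"
    have w: "w \<in> cball 0 s" using sm by (simp add: w_def)
    have "\<phi> w = of_real y" unfolding w_def using y ord w TU by (intro \<phi>(3)) (auto simp: w_def)
    then have "\<psi> i w = of_real z" using y(3) by (simp add: \<psi>_def unicritical_iterate_of_real)
    moreover have "orbit_deriv l (complex_of_real c) (N - i) (\<psi> i w) * deriv (\<psi> i) w = 1"
      by (rule inverse_branch_deriv[OF hol U(1)]) (use split i w TU in auto)
    ultimately have "norm (complex_of_real (orbit_deriv l c (N - i) z) * deriv (\<psi> i) w) = 1"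
      by (simp add: orbit_deriv_of_real)
    then have "\<bar>orbit_deriv l c (N - i) z\<bar> * norm (deriv (\<psi> i) w) = 1" by (simp add: norm_mult)
    then have "2 * s * norm (deriv (\<psi> i) w) = \<bar>v - u\<bar>" unfolding eq by (simp add: mult.assoc)
    then show ?thesis using w s unfolding u_def v_def by (intro bexI[of _ w]) (simp add: field_simps)
  qed
  show ?thesis
  proof (rule that)
    show "\<phi> holomorphic_on cball 0 s" by (rule holomorphic_on_subset[OF \<phi>(1) TU])
    show "(?f ^^ N) (\<phi> w) = w" if "w \<in> cball 0 s" for w using \<phi>(2) that TU by blast
    show "norm ((?f ^^ i) (\<phi> w) - of_real ((?g ^^ i) y1)) \<le> exp (2 * koebe) * \<bar>(?g ^^ i) y2 - (?g ^^ i) y1\<bar>"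
      if w: "w \<in> cball 0 s" and i: "i \<le> N" for w i
    proof -
      define d where "d = \<bar>(?g ^^ i) y2 - (?g ^^ i) y1\<bar>"
      obtain w' where w': "w' \<in> cball 0 s" "norm (deriv (\<psi> i) w') = d / (2 * s)" using core[OF i] unfolding d_def by blast
      have s0: "complex_of_real (- s) \<in> cball 0 s" using s by simp
      have "norm (\<psi> i w - \<psi> i (of_real (- s))) \<le> exp (2 * koebe) * (d / (2 * s)) * norm (w - of_real (- s))"
      proof (rule field_differentiable_bound[OF convex_cball _ _ w s0])
        fix z :: complex assume z: "z \<in> cball 0 s"
        show "(\<psi> i has_field_derivative deriv (\<psi> i) z) (at z within cball 0 s)"
          using holomorphic_derivI[OF hol U(1)] z TU by (blast intro: has_field_derivative_at_within)
        show "norm (deriv (\<psi> i) z) \<le> exp (2 * koebe) * (d / (2 * s))"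
          using dist[OF i z w'(1)] unfolding w'(2) .
      qed
      also have "\<dots> \<le> exp (2 * koebe) * (d / (2 * s)) * (2 * s)"
      proof (rule mult_left_mono)
        have "norm (w - of_real (- s)) \<le> norm w + norm (complex_of_real (- s))" by (rule norm_triangle_ineq4)
        then show "norm (w - of_real (- s)) \<le> 2 * s" using w s by simp
      qed (use s in \<open>simp add: d_def\<close>)
      also have "\<dots> = exp (2 * koebe) * d" using s by simp
      finally have "norm (\<psi> i w - \<psi> i (of_real (- s))) \<le> exp (2 * koebe) * d" .
      moreover have "\<phi> (of_real (- s)) = of_real y1"
      proof -
        have "complex_of_real (- s) \<in> U" using s0 TU by (rule subsetD[rotated])
        then show ?thesis using \<phi>(3)[of y1] ord unfolding ends(3) by simp
      qed
      then have "\<psi> i (of_real (- s)) = of_real ((?g ^^ i) y1)" by (simp add: \<psi>_def unicritical_iterate_of_real)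
      ultimately show ?thesis by (simp add: \<psi>_def d_def)
    qed
    show "norm (orbit_deriv l (complex_of_real c) N (\<phi> w)) \<le> 2 * s * exp (2 * koebe) / (y2 - y1)"
      if w: "w \<in> cball 0 s" for w
    proof -
      obtain w' where w': "w' \<in> cball 0 s" "norm (deriv (\<psi> 0) w') = (y2 - y1) / (2 * s)"
        using core[of 0] ord by auto
      have "(y2 - y1) / (2 * s) \<le> exp (2 * koebe) * norm (deriv \<phi> w)"
        using dist[OF _ w'(1) w, of 0] unfolding w'(2) by (simp add: \<psi>_def)
      then have "y2 - y1 \<le> 2 * s * exp (2 * koebe) * norm (deriv \<phi> w)" using s by (simp add: field_simps)
      then have "(y2 - y1) * norm (orbit_deriv l (complex_of_real c) N (\<phi> w))
          \<le> 2 * s * exp (2 * koebe) * norm (deriv \<phi> w) * norm (orbit_deriv l (complex_of_real c) N (\<phi> w))"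
        by (rule mult_right_mono) simp
      also have "\<dots> = 2 * s * exp (2 * koebe) * norm (orbit_deriv l (complex_of_real c) N (\<phi> w) * deriv \<phi> w)"
        by (simp add: norm_mult)
      also have "orbit_deriv l (complex_of_real c) N (\<phi> w) * deriv \<phi> w = 1"
        by (rule inverse_branch_deriv[OF \<phi>(1) U(1) \<phi>(2)]) (use w TU in auto)
      finally show ?thesis using ord(2) by (simp add: pos_le_divide_eq mult.commute)
    qed
  qed
qed

context even_degree begin

text \<open>If \<open>0\<close> were interior to the filled Julia set, Cauchy's estimate would bound
  the derivatives of all iterates near \<open>0\<close>. But gates near \<open>0\<close> contain
  arbitrarily short intervals that are mapped onto \<open>[a, -a]\<close>.\<close>

lemma zero_in_julia:
  assumes a: "good a"
    and gates: "\<And>\<epsilon> \<kappa>0. \<epsilon> > 0 \<Longrightarrow> \<exists>x \<kappa>. \<kappa>0 \<le> \<kappa> \<and> - \<epsilon> \<le> x \<and> gate a x \<epsilon> \<kappa>"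
  shows "0 \<in> filled_julia l (of_real (a - a ^ l))" "0 \<in> julia_set (unicritical l (of_real (a - a ^ l)))"
proof -
  define c where "c = complex_of_real (a - a ^ l)"
  interpret unicritical_map l c by unfold_locales (rule l2)
  have orb: "(f ^^ n) (of_real y) = of_real ((g a ^^ n) y)" for n y
    unfolding c_def by (rule unicritical_iterate_of_real)
  have "norm ((f ^^ n) 0) \<le> R" for n
  proof -
    have "\<bar>(g a ^^ n) 0\<bar> \<le> 2" using iterate_bounded[OF a, of 0 n] good_bounds[OF a] by linarith
    then show ?thesis using orb[of n 0] R_pos by simp
  qed
  then have K0: "0 \<in> K" by (simp add: mem_filled_alt)
  then show "0 \<in> filled_julia l (of_real (a - a ^ l))" by (simp only: c_def)
  have "0 \<notin> interior K"
  proof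
    assume "0 \<in> interior K"
    then obtain r where r: "r > 0" "ball 0 r \<subseteq> K" unfolding mem_interior by blast
    have a0: "\<bar>a\<bar> > 0" using a good_neg by force
    have bound: "norm (orbit_deriv l c n z) \<le> R / (r / 3)" if z: "norm z < r / 3" for n z
    proof -
      have "norm ((deriv ^^ 1) (f ^^ n) z) \<le> fact 1 * R / (r / 3) ^ 1"
      proof (rule Cauchy_inequality)
        show "norm ((f ^^ n) x) \<le> R" if "norm (z - x) = r / 3" for x
        proof -
          have "norm x \<le> norm z + norm (z - x)" by (metis norm_triangle_sub norm_minus_commute)
          then have "norm x < r" using z that r(1) by linarith
          then have "x \<in> K" using r(2) by auto
          then show ?thesis by (simp add: mem_filled_alt)
        qed
      qed (use r in \<open>auto intro: unicritical_iterate_holomorphic unicritical_iterate_continuous\<close>)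
      then show ?thesis by (simp add: deriv_iterate)
    qed
    \<comment> \<open>With this length and the derivative bound \<open>3 * R / r\<close> the image
      has length at most \<open>\<bar>a\<bar>\<close> instead of
      \<open>2 * \<bar>a\<bar>\<close>.\<close>
    define \<epsilon> where "\<epsilon> = min (r / 4) (\<bar>a\<bar> * r / (3 * R))"
    have \<epsilon>: "\<epsilon> > 0" using r a0 R_pos by (simp add: \<epsilon>_def)
    obtain x \<kappa> where x: "- \<epsilon> \<le> x" "gate a x \<epsilon> \<kappa>" using gates[OF \<epsilon>, of 0] by blast
    obtain j1 j2 y1 y2 N0 N1 where j: "x \<le> j1" "j1 < y1" "y1 < y2" "y2 < j2" "j2 < 0"
      "(g a ^^ N1) j1 = a" "(g a ^^ N1) j2 = - a"
      using x(2) unfolding gate_def by (elim exE conjE) (rule that)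
    have "j1 < j2" using j by linarith
    then obtain z where z: "j1 < z" "z < j2"
      "(g a ^^ N1) j2 - (g a ^^ N1) j1 = (j2 - j1) * orbit_deriv l (a - a ^ l) N1 z"
      by (rule iterate_MVT)
    have "norm (orbit_deriv l c N1 (of_real z)) \<le> R / (r / 3)"
    proof (rule bound)
      have "\<bar>z\<bar> < r / 3" using z(1,2) j x(1) r(1) unfolding \<epsilon>_def by linarith
      then show "norm (complex_of_real z) < r / 3" by simp
    qed
    then have D: "\<bar>orbit_deriv l (a - a ^ l) N1 z\<bar> \<le> R / (r / 3)"
      unfolding c_def orbit_deriv_of_real by simp
    have "2 * \<bar>a\<bar> = \<bar>(g a ^^ N1) j2 - (g a ^^ N1) j1\<bar>" unfolding j by simp
    also have "\<dots> = (j2 - j1) * \<bar>orbit_deriv l (a - a ^ l) N1 z\<bar>" unfolding z(3) using \<open>j1 < j2\<close> by (simp add: abs_mult)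
    also have "\<dots> \<le> (\<bar>a\<bar> * r / (3 * R)) * (R / (r / 3))"
    proof (rule mult_mono[OF _ D])
      show "j2 - j1 \<le> \<bar>a\<bar> * r / (3 * R)" using j x(1) unfolding \<epsilon>_def by linarith
    qed (use r R_pos in auto)
    also have "\<dots> = \<bar>a\<bar>" using r R_pos by (simp add: field_simps)
    finally show False using a0 by linarith
  qed
  then show "0 \<in> julia_set (unicritical l (of_real (a - a ^ l)))"
    using K0 closure_subset[of K] julia_eq_frontier unfolding frontier_def c_def by auto
qed

text \<open>Since the exponent \<open>\<kappa>\<close> of a gate may be taken larger than \<open>\<delta>\<close>, the time of passage beats the
  conformal measure of the set that passes, which is of order \<open>(y2 - y1)\<^sup>\<delta>\<close>.\<close>

lemma slow_passage:
  assumes a: "good a"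
    and gates: "\<And>\<epsilon> \<kappa>0. \<epsilon> > 0 \<Longrightarrow> \<exists>x \<kappa>. \<kappa>0 \<le> \<kappa> \<and> - \<epsilon> \<le> x \<and> gate a x \<epsilon> \<kappa>"
    and conf: "conformal l (of_real (a - a ^ l)) \<delta> m" and e: "e > 0"
  shows "\<exists>W T. W \<in> sets borel \<and> W \<subseteq> ball 0 e \<and>
    (\<forall>z\<in>W. \<forall>i\<le>T. \<exists>n. dist ((unicritical l (of_real (a - a ^ l)) ^^ i) z)
       ((unicritical l (of_real (a - a ^ l)) ^^ n) 0) < e) \<and> real T * measure m W \<ge> M"
proof -
  define c where "c = complex_of_real (a - a ^ l)"
  interpret conformal l c \<delta> m using conf by (simp only: c_def)
  have orb: "(f ^^ n) (of_real y) = of_real ((g a ^^ n) y)" for n y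
    unfolding c_def by (rule unicritical_iterate_of_real)
  define s where "s = - a / 2"
  have an: "a < 0" using a good_neg by blast
  have s: "s > 0" using an by (simp add: s_def)
  define E where "E = exp (2 * koebe)"
  have E1: "E > 0" by (simp add: E_def)
  define \<eta> where "\<eta> = measure m (ball 0 s)"
  have \<eta>: "\<eta> > 0" unfolding \<eta>_def
    using zero_in_julia(2)[OF a gates] s by (intro measure_ball_pos) (simp_all add: c_def)
  define B where "B = 2 * s * E"
  have B: "B > 0" using s E1 by (simp add: B_def)
  \<comment> \<open>The pullback of the disc stays within \<open>E * (2 * \<epsilon>)\<close> of the
    real orbit of \<open>y1\<close>, which is \<epsilon>-close to the critical orbit. The bound 1/2
    makes \<open>y2 - y1 \<le> 1\<close>, so that a larger exponent gives a smaller power.\<close>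
  define \<epsilon> where "\<epsilon> = min (1 / 2) (e / (4 * E + 4))"
  have \<epsilon>: "\<epsilon> > 0" using e E1 by (simp add: \<epsilon>_def)
  have \<epsilon>e: "(4 * E + 4) * \<epsilon> \<le> e"
  proof -
    have "\<epsilon> \<le> e / (4 * E + 4)" by (simp add: \<epsilon>_def)
    then show ?thesis using E1 by (simp add: field_simps)
  qed
  have small: "E * (2 * \<epsilon>) + 2 * \<epsilon> < e"
  proof -
    have "0 < 2 * E * \<epsilon> + 2 * \<epsilon>" using E1 \<epsilon> by (simp add: add_pos_pos)
    then show ?thesis using \<epsilon>e by (simp add: algebra_simps)
  qed
  \<comment> \<open>\<kappa> has to exceed \<delta> in order to replace the power \<delta> of the
    length, and has to exceed the constant that converts the measure of \<open>ball 0 s\<close> into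
    that of \<open>W\<close>.\<close>
  define \<kappa>0 where "\<kappa>0 = nat \<lceil>max \<delta> (M * B powr \<delta> / \<eta>)\<rceil>"
  obtain x \<kappa> where x: "\<kappa>0 \<le> \<kappa>" "- \<epsilon> \<le> x" "gate a x \<epsilon> \<kappa>" using gates[OF \<epsilon>] by blast
  have "max \<delta> (M * B powr \<delta> / \<eta>) \<le> real \<kappa>0" unfolding \<kappa>0_def by (rule real_nat_ceiling_ge)
  also have "\<dots> \<le> real \<kappa>" using x(1) by simp
  finally have \<kappa>: "\<delta> \<le> real \<kappa>" "M * B powr \<delta> / \<eta> \<le> real \<kappa>" by simp_all
  obtain j1 j2 y1 y2 N0 N1 where j: "x \<le> j1" "j1 < y1" "y1 < y2" "y2 < j2" "j2 < 0" "N0 \<le> N1"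
    "(g a ^^ N1) j1 = a" "(g a ^^ N1) j2 = - a" "(g a ^^ N1) y1 = a / 2" "(g a ^^ N1) y2 = - a / 2"
    "strict_mono_on {j1..j2} (g a ^^ N1)" and nz: "\<forall>i<N1. \<forall>y\<in>{j1..j2}. (g a ^^ i) y \<noteq> 0"
    and near: "\<forall>i\<le>N0. \<exists>n. \<forall>y\<in>{j1..j2}. \<bar>(g a ^^ i) y - (g a ^^ n) 0\<bar> \<le> \<epsilon>"
    and long: "real N0 * (y2 - y1) ^ \<kappa> \<ge> real \<kappa>"
    using x(3) unfolding gate_def by (elim exE conjE) (rule that)
  have yy: "y1 \<in> {j1..j2}" "y2 \<in> {j1..j2}" using j by auto
  obtain \<phi> where \<phi>: "\<phi> holomorphic_on cball 0 s" "\<And>w. w \<in> cball 0 s \<Longrightarrow> (f ^^ N1) (\<phi> w) = w"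
    and close: "\<And>w i. w \<in> cball 0 s \<Longrightarrow> i \<le> N1 \<Longrightarrow>
       norm ((f ^^ i) (\<phi> w) - of_real ((g a ^^ i) y1)) \<le> E * \<bar>(g a ^^ i) y2 - (g a ^^ i) y1\<bar>"
    and slope: "\<And>w. w \<in> cball 0 s \<Longrightarrow> norm (orbit_deriv l c N1 (\<phi> w)) \<le> B / (y2 - y1)"
    unfolding c_def E_def B_def
  proof (rule pullback_disc[OF even_l l2 s, of j1 y1 y2 j2 N1 "a - a ^ l"])
    show "(g a ^^ i) y \<noteq> 0" if "i < N1" "y \<in> {j1..j2}" for i y using nz that by blast
  qed (use j in \<open>auto simp: s_def\<close>)
  define W where "W = \<phi> ` ball 0 s"
  have inj: "inj_on \<phi> (ball 0 s)" by (rule inj_on_inverseI[where g = "f ^^ N1"]) (use \<phi>(2) in auto)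
  have "open W" unfolding W_def
    by (rule open_mapping_thm3[OF _ open_ball inj]) (rule holomorphic_on_subset[OF \<phi>(1) ball_subset_cball])
  then have Wb: "W \<in> sets borel" by simp
  have im: "(f ^^ N1) ` W = ball 0 s" unfolding W_def image_image using \<phi>(2) by auto
  have injW: "inj_on (f ^^ N1) W" unfolding W_def by (rule inj_onI) (use \<phi>(2) in auto)
  have eps: "\<bar>y1\<bar> \<le> \<epsilon>" "\<bar>y2 - y1\<bar> \<le> \<epsilon>" using j x(2) by linarith+
  have dist: "dist ((f ^^ i) z) ((f ^^ n) 0) < e"
    if z: "z \<in> W" and i: "i \<le> N0" and n: "\<bar>(g a ^^ i) y1 - (g a ^^ n) 0\<bar> \<le> \<epsilon>" "\<bar>(g a ^^ i) y2 - (g a ^^ n) 0\<bar> \<le> \<epsilon>" for z i n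
  proof -
    obtain w where w: "w \<in> cball 0 s" "z = \<phi> w" using z ball_subset_cball[of 0 s] unfolding W_def by blast
    have "norm ((f ^^ i) z - of_real ((g a ^^ i) y1)) \<le> E * \<bar>(g a ^^ i) y2 - (g a ^^ i) y1\<bar>"
      unfolding w(2) using i j(6) by (intro close w(1)) simp
    also have "\<dots> \<le> E * (2 * \<epsilon>)" using n E1 by (intro mult_left_mono) linarith+
    finally have 1: "dist ((f ^^ i) z) (of_real ((g a ^^ i) y1)) \<le> E * (2 * \<epsilon>)" by (simp add: dist_norm)
    have "dist (complex_of_real ((g a ^^ i) y1)) ((f ^^ n) 0) = \<bar>(g a ^^ i) y1 - (g a ^^ n) 0\<bar>"
      using orb[of n 0] by (simp add: dist_of_real dist_real_def)
    then have 2: "dist (complex_of_real ((g a ^^ i) y1)) ((f ^^ n) 0) \<le> \<epsilon>" using n by simp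
    have "dist ((f ^^ i) z) ((f ^^ n) 0) \<le> dist ((f ^^ i) z) (of_real ((g a ^^ i) y1)) + dist (complex_of_real ((g a ^^ i) y1)) ((f ^^ n) 0)"
      by (rule dist_triangle)
    then show ?thesis using 1 2 small \<epsilon> by linarith
  qed
  have "W \<subseteq> ball 0 e"
  proof
    fix z assume z: "z \<in> W"
    obtain w where w: "w \<in> cball 0 s" "z = \<phi> w" using z ball_subset_cball[of 0 s] unfolding W_def by blast
    have "norm (z - of_real y1) \<le> E * \<bar>y2 - y1\<bar>" using close[OF w(1), of 0] w(2) by simp
    also have "\<dots> \<le> E * \<epsilon>" using eps E1 by (intro mult_left_mono) auto
    finally have "norm (z - of_real y1) \<le> E * \<epsilon>" .
    moreover have "norm z \<le> norm (complex_of_real y1) + norm (z - of_real y1)" by (rule norm_triangle_sub)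
    moreover have "E * \<epsilon> > 0" using E1 \<epsilon> by simp
    ultimately have "norm z < e" using eps small \<epsilon> by simp
    then show "z \<in> ball 0 e" by simp
  qed
  moreover have "\<exists>n. dist ((f ^^ i) z) ((f ^^ n) 0) < e" if zi: "z \<in> W" "i \<le> N0" for z i
  proof -
    obtain n where n: "\<forall>y\<in>{j1..j2}. \<bar>(g a ^^ i) y - (g a ^^ n) 0\<bar> \<le> \<epsilon>"
      using near[rule_format, OF zi(2)] by (elim exE)
    show ?thesis using dist[OF zi n[rule_format, OF yy(1)] n[rule_format, OF yy(2)]] by (rule exI)
  qed
  moreover have "real N0 * measure m W \<ge> M"
  proof -
    define d where "d = y2 - y1"
    have d: "0 < d" "d \<le> 1" using j eps unfolding d_def \<epsilon>_def by linarith+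
    have "\<eta> \<le> (B / d) powr \<delta> * measure m W"
    proof -
      have "measure m ((f ^^ N1) ` W) \<le> (B / d) powr \<delta> * measure m W"
        by (rule measure_iterate_le[OF Wb injW]) (use slope B d in \<open>auto simp: W_def d_def\<close>)
      then show ?thesis unfolding im \<eta>_def .
    qed
    also have "(B / d) powr \<delta> = B powr \<delta> / d powr \<delta>" using B d by (simp add: powr_divide)
    finally have 1: "\<eta> * d powr \<delta> \<le> B powr \<delta> * measure m W" using d by (simp add: field_simps)
    have "d ^ \<kappa> = d powr real \<kappa>" using d by (simp add: powr_realpow)
    also have "\<dots> \<le> d powr \<delta>" using d \<kappa>(1) by (intro powr_mono') auto
    finally have "\<eta> * d ^ \<kappa> \<le> B powr \<delta> * measure m W" using 1 \<eta> by (meson mult_left_mono less_imp_le order_trans)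
    then have "real N0 * (\<eta> * d ^ \<kappa>) \<le> real N0 * (B powr \<delta> * measure m W)" by (rule mult_left_mono) simp
    moreover have "\<eta> * real \<kappa> \<le> \<eta> * (real N0 * d ^ \<kappa>)" using long \<eta> unfolding d_def by (intro mult_left_mono) auto
    moreover have "M * B powr \<delta> \<le> \<eta> * real \<kappa>" using \<kappa>(2) \<eta> by (simp add: field_simps)
    ultimately have "M * B powr \<delta> \<le> (real N0 * measure m W) * B powr \<delta>" by (simp add: algebra_simps)
    then show ?thesis using B by (simp add: mult_le_cancel_right)
  qed
  ultimately show ?thesis using Wb unfolding c_def by blast
qed

end

context conformal begin

text \<open>The complement of the limit set is a countable union of balls whose doubles miss it, and
  each is null. Recurrence puts the whole critical orbit into the limit set, which can therefore
  serve as the postcritical set.\<close>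

lemma acip_on_omega_limit:
  assumes acip: "acip f m \<mu>" and rec: "recurrent f 0"
    and slow: "\<And>e M. e > 0 \<Longrightarrow> \<exists>W T. W \<in> sets borel \<and> W \<subseteq> ball 0 e \<and>
       (\<forall>z\<in>W. \<forall>i\<le>T. \<exists>n. dist ((f ^^ i) z) ((f ^^ n) 0) < e) \<and> real T * measure m W \<ge> M"
  shows "emeasure \<mu> (omega_limit f 0) = 1"
proof -
  let ?P = "omega_limit f 0"
  interpret mu: prob_space \<mu> using acip by (simp add: acip_def)
  have sets_mu: "sets \<mu> = sets borel" using acip by (simp add: acip_def invariant_measure_def)
  have space_mu: "space \<mu> = UNIV" using sets_eq_imp_space_eq[OF sets_mu] by simp
  have orbit: "(f ^^ n) 0 \<in> ?P" for n by (rule recurrent_orbit[OF rec unicritical_iterate_continuous])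
  define F where "F = {ball w r |w r. r > 0 \<and> ball w (2 * r) \<inter> ?P = {}}"
  have null: "D \<in> null_sets \<mu>" if D: "D \<in> F" for D
  proof -
    obtain w r where D: "D = ball w r" and r: "r > 0" "ball w (2 * r) \<inter> ?P = {}"
      using D unfolding F_def mem_Collect_eq by (elim exE conjE) (rule that)
    have "measure \<mu> D = 0" unfolding D
    proof (rule acip_null_off_postcritical[OF acip r(1) orbit r(2)])
      fix \<epsilon> M :: real assume e: "\<epsilon> > 0"
      obtain W T where W: "W \<in> sets borel" "W \<subseteq> ball 0 \<epsilon>"
        "\<forall>z\<in>W. \<forall>i\<le>T. \<exists>n. dist ((f ^^ i) z) ((f ^^ n) 0) < \<epsilon>" "real T * measure m W \<ge> M"
        using slow[OF e, of M] by (elim exE conjE) (rule that)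
      have "\<forall>z\<in>W. \<forall>i\<le>T. \<exists>p\<in>?P. dist ((f ^^ i) z) p < \<epsilon>"
      proof (intro ballI allI impI)
        fix z i assume "z \<in> W" "i \<le> T"
        then obtain n where "dist ((f ^^ i) z) ((f ^^ n) 0) < \<epsilon>" using W(3) by blast
        then show "\<exists>p\<in>?P. dist ((f ^^ i) z) p < \<epsilon>" by (rule bexI) (rule orbit)
      qed
      then show "\<exists>W T. W \<in> sets borel \<and> W \<subseteq> ball 0 \<epsilon> \<and>
         (\<forall>z\<in>W. \<forall>i\<le>T. \<exists>p\<in>?P. dist ((f ^^ i) z) p < \<epsilon>) \<and> real T * measure m W \<ge> M"
        using W(1,2,4) by (intro exI[of _ W] exI[of _ T] conjI)
    qed
    then show ?thesis by (simp add: D null_sets_def mu.emeasure_eq_measure sets_mu)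
  qed
  obtain F' where F': "F' \<subseteq> F" "countable F'" "\<Union>F' = \<Union>F"
  proof (rule Lindelof)
    show "open S" if "S \<in> F" for S using that by (auto simp: F_def)
  qed
  have "\<Union>F = - ?P"
  proof (intro equalityI subsetI)
    fix z assume "z \<in> \<Union>F"
    then obtain w r where "z \<in> ball w r" "r > 0" "ball w (2 * r) \<inter> ?P = {}" unfolding F_def by blast
    moreover have "ball w r \<subseteq> ball w (2 * r)" using \<open>r > 0\<close> by (intro subset_ball) simp
    ultimately show "z \<in> - ?P" by blast
  next
    fix z assume "z \<in> - ?P"
    then obtain e where e: "e > 0" "ball z e \<subseteq> - ?P" using closed_omega_limit[of f 0] open_contains_ball[of "- ?P"] by auto
    have "ball z (e / 2) \<in> F" unfolding F_def using e by (intro CollectI exI[of _ z] exI[of _ "e / 2"]) auto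
    then show "z \<in> \<Union>F" using e(1) by (intro UnionI[of "ball z (e / 2)"]) auto
  qed
  then have "- ?P = (\<Union>D\<in>F'. D)" using F'(3) by simp
  also have "\<dots> \<in> null_sets \<mu>" using F'(1) null by (intro null_sets_UN'[OF F'(2)]) blast
  finally have "- ?P \<in> null_sets \<mu>" .
  moreover have "?P = space \<mu> - (- ?P)" by (simp add: space_mu)
  ultimately have "emeasure \<mu> ?P = emeasure \<mu> (space \<mu>)" by (metis emeasure_Diff_null_set sets.top)
  then show ?thesis by (simp add: mu.emeasure_space_1)
qed

end

theorem theorem2:
  fixes l :: nat
  assumes "even l" and "l \<ge> 2"
  shows "\<exists>C::real set. C \<noteq> {} \<and>
    (\<forall>c\<in>C.
       long_branched (unicritical l c) \<and>
       connected (julia_set (unicritical l (complex_of_real c))) \<and>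
       0 \<in> julia_set (unicritical l (complex_of_real c)) \<and>
       recurrent (unicritical l (complex_of_real c)) 0 \<and>
       (\<forall>\<delta> m \<mu>. \<delta> > 0 \<longrightarrow>
          conformal_measure (unicritical l (complex_of_real c)) \<delta> m \<longrightarrow>
          acip (unicritical l (complex_of_real c)) m \<mu> \<longrightarrow>
          emeasure \<mu> (omega_limit (unicritical l (complex_of_real c)) 0) = 1))"
proof -
  interpret even_degree l by unfold_locales (rule assms)+
  obtain a r x where a: "good a"
    and crit: "\<forall>p\<ge>1. \<bar>(g a ^^ p) 0\<bar> < \<bar>a\<bar> \<longrightarrow> (g a ^^ p) 0 < 0 \<and> (\<exists>x<0. strict_mono_on {x..0} (g a ^^ p))"
    and gates: "\<forall>\<epsilon>>0. \<forall>\<kappa>0. \<exists>x \<kappa>. \<kappa>0 \<le> \<kappa> \<and> - \<epsilon> \<le> x \<and> gate a x \<epsilon> \<kappa>"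
    and r: "strict_mono (r :: nat \<Rightarrow> nat)" "(\<lambda>k. (g a ^^ r k) 0) \<longlonglongrightarrow> 0"
    and x: "a < x" "x \<le> 0" "(g a ^^ 2) x = - a"
    using exists_parameter by (elim exE conjE) (rule that)
  have gates': "\<exists>x \<kappa>. \<kappa>0 \<le> \<kappa> \<and> - \<epsilon> \<le> x \<and> gate a x \<epsilon> \<kappa>" if "\<epsilon> > 0" for \<epsilon> \<kappa>0 using gates that by blast
  let ?c = "a - a ^ l"
  let ?f = "unicritical l (complex_of_real ?c)"
  interpret unicritical_map l "complex_of_real ?c" by unfold_locales (rule l2)
  have "long_branched (unicritical l ?c)"
    by (rule long_branched_family[OF a _ x]) (use crit in simp)
  moreover have "connected (julia_set ?f)" by (rule connected_julia[OF zero_in_julia(1)[OF a gates']])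
  moreover have "0 \<in> julia_set ?f" by (rule zero_in_julia(2)[OF a gates'])
  moreover have recf: "recurrent ?f 0"
  proof -
    have "(\<lambda>k. complex_of_real ((g a ^^ r k) 0)) \<longlonglongrightarrow> of_real 0" by (rule tendsto_of_real[OF r(2)])
    moreover have "(?f ^^ n) 0 = complex_of_real ((g a ^^ n) 0)" for n
      using unicritical_iterate_of_real[where c = ?c and n = n and x = 0 and l = l] by simp
    ultimately have "(\<lambda>k. (?f ^^ r k) 0) \<longlonglongrightarrow> 0" by simp
    then show ?thesis using r(1) unfolding recurrent_def omega_limit_def by blast
  qed
  moreover have "emeasure \<mu> (omega_limit ?f 0) = 1"
    if "\<delta> > 0" "conformal_measure ?f \<delta> m" "acip ?f m \<mu>" for \<delta> m \<mu>
  proof -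
    \<comment> \<open>The blow-up of Julia neighbourhoods behind the conformal estimates needs a
      nonzero constant term.\<close>
    have "?c < 0" using good_neg[OF a] good_bounds(4)[OF a] by linarith
    then have "complex_of_real ?c \<noteq> 0" by (metis of_real_eq_0_iff less_irrefl)
    then have conf: "conformal l (complex_of_real ?c) \<delta> m"
      using that(1,2) by unfold_locales
    show ?thesis by (rule conformal.acip_on_omega_limit[OF conf that(3) recf slow_passage[OF a gates' conf]])
  qed
  ultimately show ?thesis by (intro exI[of _ "{?c}"]) blast
qed

end
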